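(* Let $G$ be a brick. Then $G\in\mathfrak{B}$ if and only if $G$ is (isomorphic to) one of $K_4$, $K_4^2$, $K_4^4$, the Petersen graph, $T_1$, or $K_4^6$.
   Context: Graphs are finite, loopless, and may have parallel edges (parallel edges are distinct edges, so perfect matchings differing only by the choice of a parallel edge are different). An edge is a $k$-matching edge if it belongs to exactly $k$ perfect matchings. A connected graph is matching covered if every edge belongs to at least one perfect matching. $\mathfrak{B}$ is the class of connected graphs (admitting a perfect matching) in which every edge is either a $1$-matching edge or a $2$-matching edge, and no perfect matching contains both a $1$-matching edge and a $2$-matching edge. For $X\subseteq V(G)$, $\nabla(X)$ is the set of edges with exactly one end in $X$; it is a cut with shores $X$ and $V(G)\setminus X$, and it is trivial if one of its shores is a single vertex. A cut $C=\nabla(X)$ with $|X|$ odd in a matching covered graph is tight if $|C\cap M|=1$ for every perfect matching $M$. A brick is a nonbipartite matching covered graph with no nontrivial tight cut. The complete graph $K_4$ has three perfect matchings, which partition its six edges. $K_4^2$, $K_4^4$, $K_4^6$ are obtained from $K_4$ by doubling (giving multiplicity $2$ to) all edges of exactly one, exactly two, or all three of these perfect matchings, respectively (so $2$, $4$, $6$ edges are added). $T_1$ is the simple graph obtained from the complement $\overline{C_6}$ of the $6$-cycle $C_6$ by adding the three edges of a perfect matching of $C_6$; equivalently, $T_1$ is the octahedron $K_{2,2,2}$. *)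

theory Defs
  imports Main
begin

text \<open>Undirected loopless multigraphs: edges are objects of their own, and each edge is assigned
  its two-element set of ends, so parallel edges are distinct edges with the same ends.\<close>

record ('v, 'e) mgraph =
  verts :: "'v set"
  edges :: "'e set"
  ends :: "'e \<Rightarrow> 'v set"

definition graph :: "('v, 'e) mgraph \<Rightarrow> bool" where
  "graph G \<longleftrightarrow> finite (verts G) \<and> finite (edges G) \<and>
     (\<forall>e\<in>edges G. ends G e \<subseteq> verts G \<and> card (ends G e) = 2)"

definition adj :: "('v, 'e) mgraph \<Rightarrow> ('v \<times> 'v) set" where
  "adj G = {(u, v). \<exists>e\<in>edges G. ends G e = {u, v}}"

definition connected :: "('v, 'e) mgraph \<Rightarrow> bool" where
  "connected G \<longleftrightarrow> verts G \<noteq> {} \<and> (\<forall>u\<in>verts G. \<forall>v\<in>verts G. (u, v) \<in> (adj G)\<^sup>*)"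

definition perfect_matching :: "('v, 'e) mgraph \<Rightarrow> 'e set \<Rightarrow> bool" where
  "perfect_matching G M \<longleftrightarrow> M \<subseteq> edges G \<and> (\<forall>v\<in>verts G. \<exists>!e. e \<in> M \<and> v \<in> ends G e)"

definition matching_edge :: "nat \<Rightarrow> ('v, 'e) mgraph \<Rightarrow> 'e \<Rightarrow> bool" where
  "matching_edge k G e \<longleftrightarrow> e \<in> edges G \<and> card {M. perfect_matching G M \<and> e \<in> M} = k"

definition matching_covered :: "('v, 'e) mgraph \<Rightarrow> bool" where
  "matching_covered G \<longleftrightarrow> graph G \<and> connected G \<and>
     (\<forall>e\<in>edges G. \<exists>M. perfect_matching G M \<and> e \<in> M)"

definition class_B :: "('v, 'e) mgraph \<Rightarrow> bool" where
  "class_B G \<longleftrightarrow> graph G \<and> connected G \<and> (\<exists>M. perfect_matching G M) \<and>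
     (\<forall>e\<in>edges G. matching_edge 1 G e \<or> matching_edge 2 G e) \<and>
     (\<forall>M. perfect_matching G M \<longrightarrow>
        \<not> (\<exists>e\<in>M. \<exists>f\<in>M. matching_edge 1 G e \<and> matching_edge 2 G f))"

definition cut :: "('v, 'e) mgraph \<Rightarrow> 'v set \<Rightarrow> 'e set" where
  "cut G X = {e \<in> edges G. card (ends G e \<inter> X) = 1}"

definition shore :: "('v, 'e) mgraph \<Rightarrow> 'e set \<Rightarrow> 'v set \<Rightarrow> bool" where
  "shore G C X \<longleftrightarrow> X \<subseteq> verts G \<and> C = cut G X"

text \<open>In a graph, if \<open>X\<close> is a shore of a cut then so is \<open>verts G - X\<close>; hence existence of a
  singleton shore covers both shores.\<close>

definition trivial_cut :: "('v, 'e) mgraph \<Rightarrow> 'e set \<Rightarrow> bool" where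
  "trivial_cut G C \<longleftrightarrow> (\<exists>X. shore G C X \<and> card X = 1)"

definition tight_cut :: "('v, 'e) mgraph \<Rightarrow> 'e set \<Rightarrow> bool" where
  "tight_cut G C \<longleftrightarrow> (\<exists>X. shore G C X \<and> odd (card X)) \<and>
     (\<forall>M. perfect_matching G M \<longrightarrow> card (C \<inter> M) = 1)"

definition bipartite :: "('v, 'e) mgraph \<Rightarrow> bool" where
  "bipartite G \<longleftrightarrow> (\<exists>A\<subseteq>verts G. edges G = cut G A)"

definition brick :: "('v, 'e) mgraph \<Rightarrow> bool" where
  "brick G \<longleftrightarrow> matching_covered G \<and> \<not> bipartite G \<and> (\<forall>C. tight_cut G C \<longrightarrow> trivial_cut G C)"

definition isomorphic :: "('v, 'e) mgraph \<Rightarrow> ('w, 'f) mgraph \<Rightarrow> bool" where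
  "isomorphic G H \<longleftrightarrow> (\<exists>\<phi> \<psi>. bij_betw \<phi> (verts G) (verts H) \<and> bij_betw \<psi> (edges G) (edges H) \<and>
     (\<forall>e\<in>edges G. ends H (\<psi> e) = \<phi> ` ends G e))"

definition simple_graph :: "'v set \<Rightarrow> 'v set set \<Rightarrow> ('v, 'v set) mgraph" where
  "simple_graph V E = \<lparr>verts = V, edges = E, ends = (\<lambda>e. e)\<rparr>"

definition pairs :: "'v set \<Rightarrow> 'v set set" where
  "pairs V = {e. e \<subseteq> V \<and> card e = 2}"

text \<open>Every edge \<open>e\<close> is kept as \<open>(e, False)\<close>, and every \<open>e \<in> F\<close> gets a parallel copy \<open>(e, True)\<close>.\<close>

definition double_edges :: "('v, 'e) mgraph \<Rightarrow> 'e set \<Rightarrow> ('v, 'e \<times> bool) mgraph" where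
  "double_edges G F = \<lparr>verts = verts G, edges = edges G \<times> {False} \<union> F \<times> {True},
     ends = (\<lambda>(e, b). ends G e)\<rparr>"

definition K4 :: "(nat, nat set) mgraph" where
  "K4 = simple_graph {0..<4} (pairs {0..<4})"

text \<open>The automorphism group of \<open>K4\<close> acts as the full symmetric group on its three perfect
  matchings \<open>{01, 23}\<close>, \<open>{02, 13}\<close>, \<open>{03, 12}\<close>, so up to isomorphism it does not matter which
  of them are doubled.\<close>

definition K4_2 :: "(nat, nat set \<times> bool) mgraph" where
  "K4_2 = double_edges K4 {{0, 1}, {2, 3}}"

definition K4_4 :: "(nat, nat set \<times> bool) mgraph" where
  "K4_4 = double_edges K4 ({{0, 1}, {2, 3}} \<union> {{0, 2}, {1, 3}})"

definition K4_6 :: "(nat, nat set \<times> bool) mgraph" where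
  "K4_6 = double_edges K4 ({{0, 1}, {2, 3}} \<union> {{0, 2}, {1, 3}} \<union> {{0, 3}, {1, 2}})"

text \<open>The Petersen graph as the Kneser graph on the two-element subsets of a five-element set.\<close>

definition petersen :: "(nat set, nat set set) mgraph" where
  "petersen = simple_graph (pairs {0..<5}) {{a, b} | a b. a \<in> pairs {0..<5} \<and> b \<in> pairs {0..<5} \<and> a \<inter> b = {}}"

definition C6_edges :: "nat set set" where
  "C6_edges = {{i, Suc i mod 6} | i. i < 6}"

definition T1 :: "(nat, nat set) mgraph" where
  "T1 = simple_graph {0..<6} ((pairs {0..<6} - C6_edges) \<union> {{0, 1}, {2, 3}, {4, 5}})"

end

theory Submission
  imports Defs
begin

text \<open>Give every perfect matching of \<open>G\<close> weight 2 if it consists of 1-matching edges and weight 1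
  otherwise; then every edge has total weight 2, so \<open>G\<close> is \<open>r\<close>-regular and every odd cut has at least
  \<open>r\<close> edges, with equality only for tight, hence trivial, cuts; by parity nontrivial odd cuts have at
  least \<open>r + 2\<close> edges.  If only two perfect matchings \<open>M\<close>, \<open>N\<close> contain an edge \<open>e = uv\<close> and
  \<open>f\<close> lies in \<open>M - N\<close>, then \<open>G - u - v - f\<close> has a unique perfect matching, hence by Kotzig's theorem a
  cut with a single edge.  Comparing the two odd cuts of \<open>G\<close> obtained from it with the bounds above
  shows that, once \<open>G\<close> has at least six vertices, \<open>G\<close> is simple and one end of \<open>f\<close> has degree 2 in
  \<open>G - u - v\<close>.  So \<open>r\<close> is 3 or 4, and the alternating cycle formed by \<open>M\<close> and \<open>N\<close> is covered by
  neighbours of \<open>u\<close> and \<open>v\<close>.  (For a 1-matching edge the same comparison leaves only four vertices.)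

  If \<open>r = 4\<close>, every edge lies in two triangles, and a closed neighbourhood then gives an odd cut with at
  most four edges; this forces six vertices and the octahedron.  If \<open>r = 3\<close>, two perfect matchings
  share at most one edge; as there are six of them and every edge lies in exactly two, there are at
  most ten vertices, and the only nonbipartite possibility is the Petersen graph.\<close>

section \<open>Enumerating perfect matchings of concrete graphs\<close>

text \<open>The arithmetic of the comparison: if \<open>X\<close> and \<open>Y\<close> partition the
  vertices other than \<open>u\<close> and \<open>v\<close>, the sizes of their two cuts add up to
  \<open>2r\<close> plus twice the number of edges between \<open>X\<close> and \<open>Y\<close>
  minus twice the multiplicity of \<open>uv\<close>. Kotzig's cut bounds that number by 2 (its
  single edge and the deleted \<open>f\<close>), while each cut has size \<open>r\<close> or at
  least \<open>r + 2\<close>; little freedom is left.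

  The obstacle in the cubic case is that two matchings might share two edges. They differ along a
  single cycle, for otherwise switching one of several cycles would give a third matching through a
  common edge. With a second common edge, the vertices attached to the one and to the other
  alternate on the cycle; any edge between the two common edges yields too many matchings, and
  without one the cycle shrinks to length four, too short to supply all neighbours.

  The count gives the exact order: two disjoint matchings allow at most six vertices, and otherwise
  the five remaining matchings meet a given one in five different edges. The converse is
  computational: the perfect matchings of explicit edge lists are enumerated.\<close>

definition covers :: "('e \<Rightarrow> 'v set) \<Rightarrow> 'e set \<Rightarrow> 'v set \<Rightarrow> bool" where
  "covers d M S \<longleftrightarrow> (\<forall>e\<in>M. d e \<subseteq> S) \<and> (\<forall>v\<in>S. \<exists>!e. e \<in> M \<and> v \<in> d e)"

lemma covers_ex:
  assumes "covers d M S" "v \<in> S"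
  shows "\<exists>f\<in>M. v \<in> d f \<and> (\<forall>g\<in>M. v \<in> d g \<longrightarrow> g = f)"
  using assms unfolding covers_def by (metis (no_types))

lemma coversI:
  assumes "\<And>e. e \<in> M \<Longrightarrow> d e \<subseteq> S" "\<And>v. v \<in> S \<Longrightarrow> \<exists>f\<in>M. v \<in> d f \<and> (\<forall>g\<in>M. v \<in> d g \<longrightarrow> g = f)"
  shows "covers d M S"
  using assms unfolding covers_def by (metis (no_types))

lemma covers_Un:
  assumes "covers d M S" "covers d N R" "S \<inter> R = {}"
  shows "covers d (M \<union> N) (S \<union> R)"
proof (rule coversI)
  have sub: "\<And>e. e \<in> M \<Longrightarrow> d e \<subseteq> S" "\<And>e. e \<in> N \<Longrightarrow> d e \<subseteq> R"
    using assms(1,2) unfolding covers_def by blast+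
  then show "d e \<subseteq> S \<union> R" if "e \<in> M \<union> N" for e using that by blast
  show "\<exists>f\<in>M \<union> N. v \<in> d f \<and> (\<forall>g\<in>M \<union> N. v \<in> d g \<longrightarrow> g = f)" if "v \<in> S \<union> R" for v
  proof (cases "v \<in> S")
    case True
    then have "v \<notin> d g" if "g \<in> N" for g using that sub assms(3) by blast
    then show ?thesis using covers_ex[OF assms(1) True] by blast
  next
    case False
    then have "v \<in> R" using that by blast
    then have "v \<notin> d g" if "g \<in> M" for g using that sub assms(3) by blast
    then show ?thesis using covers_ex[OF assms(2) \<open>v \<in> R\<close>] by blast
  qed
qed

lemma covers_insert:
  assumes "covers d M S" "d e \<inter> S = {}"
  shows "covers d (insert e M) (d e \<union> S)"
proof -
  have "covers d {e} (d e)" by (rule coversI) auto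
  from covers_Un[OF this assms] show ?thesis by simp
qed

lemma covers_remove:
  assumes "covers d M S" "e \<in> M"
  shows "covers d (M - {e}) (S - d e)"
proof (rule coversI)
  have *: "\<exists>f\<in>M. v \<in> d f \<and> (\<forall>g\<in>M. v \<in> d g \<longrightarrow> g = f)" if "v \<in> S" for v
    using covers_ex[OF assms(1) that] .
  show "d f \<subseteq> S - d e" if "f \<in> M - {e}" for f
  proof
    fix v assume v: "v \<in> d f"
    then have "v \<in> S" using that assms(1) unfolding covers_def by blast
    moreover have "v \<notin> d e" using *[OF \<open>v \<in> S\<close>] v that assms(2) by blast
    ultimately show "v \<in> S - d e" by blast
  qed
  show "\<exists>f\<in>M - {e}. v \<in> d f \<and> (\<forall>g\<in>M - {e}. v \<in> d g \<longrightarrow> g = f)" if "v \<in> S - d e" for v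
    using * that by blast
qed

lemma perfect_matching_iff:
  "perfect_matching G M \<longleftrightarrow> M \<subseteq> edges G \<and>
     (\<forall>v\<in>verts G. \<exists>e\<in>M. v \<in> ends G e \<and> (\<forall>f\<in>M. v \<in> ends G f \<longrightarrow> f = e))"
proof -
  have "(\<exists>!e. e \<in> M \<and> v \<in> ends G e) \<longleftrightarrow> (\<exists>e\<in>M. v \<in> ends G e \<and> (\<forall>f\<in>M. v \<in> ends G f \<longrightarrow> f = e))" for v
    by (metis (no_types))
  then show ?thesis unfolding perfect_matching_def by simp
qed

lemma perfect_matching_covers:
  assumes "graph G"
  shows "perfect_matching G M \<longleftrightarrow> M \<subseteq> edges G \<and> covers (ends G) M (verts G)"
  using assms unfolding perfect_matching_def covers_def graph_def by blast

text \<open>Backtracking on the first unmatched vertex: some edge must cover it, so branching over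
  the edges from it to another unmatched vertex finds every perfect matching. Edges are carried as
  an index with two ends, so that parallel edges lead to different lists.\<close>

function matching_lists :: "nat list \<Rightarrow> (nat \<times> nat \<times> nat) list \<Rightarrow> nat list list" where
  "matching_lists [] es = [[]]"
| "matching_lists (v # vs) es = concat (map (\<lambda>(k, i, j).
     if i = v \<and> j \<in> set vs then map ((#) k) (matching_lists (remove1 j vs) es)
     else if j = v \<and> i \<in> set vs then map ((#) k) (matching_lists (remove1 i vs) es)
     else []) es)"
  by pat_completeness auto
termination
  by (relation "measure (length \<circ> fst)") (auto simp: length_remove1)

definition list_graph :: "nat \<Rightarrow> (nat \<times> nat) list \<Rightarrow> (nat, nat) mgraph" where
  "list_graph n ps = \<lparr>verts = {..<n}, edges = {..<length ps},
     ends = (\<lambda>k. {fst (ps ! k), snd (ps ! k)})\<rparr>"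

lemma matching_lists_sound:
  assumes "\<forall>k i j. (k, i, j) \<in> set es \<longrightarrow> d k = {i, j}" "distinct vs" "m \<in> set (matching_lists vs es)"
  shows "covers d (set m) (set vs) \<and> set m \<subseteq> fst ` set es \<and> distinct m"
  using assms
proof (induction vs es arbitrary: m rule: matching_lists.induct)
  case (1 es)
  then show ?case by (simp add: covers_def)
next
  case (2 v vs es)
  from "2.prems"(3) obtain k i j where kij: "(k, i, j) \<in> set es"
    and m: "m \<in> set (if i = v \<and> j \<in> set vs then map ((#) k) (matching_lists (remove1 j vs) es)
       else if j = v \<and> i \<in> set vs then map ((#) k) (matching_lists (remove1 i vs) es) else [])"
    by auto
  have dk: "d k = {i, j}" using "2.prems"(1) kij by blast
  have "\<exists>w m'. w \<in> set vs \<and> d k = {v, w} \<and> m = k # m' \<and> m' \<in> set (matching_lists (remove1 w vs) es) \<and>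
     covers d (set m') (set (remove1 w vs)) \<and> set m' \<subseteq> fst ` set es \<and> distinct m'"
  proof (cases "i = v \<and> j \<in> set vs")
    case True
    then obtain m' where "m = k # m'" "m' \<in> set (matching_lists (remove1 j vs) es)" using m by auto
    moreover have "distinct (remove1 j vs)" using "2.prems"(2) by simp
    ultimately show ?thesis using "2.IH"(1)[OF kij refl refl True "2.prems"(1)] True dk by blast
  next
    case False
    then have jv: "j = v \<and> i \<in> set vs" using m by (auto split: if_splits)
    then obtain m' where "m = k # m'" "m' \<in> set (matching_lists (remove1 i vs) es)" using m False by (auto split: if_splits)
    moreover have "distinct (remove1 i vs)" using "2.prems"(2) by simp
    ultimately show ?thesis using "2.IH"(2)[OF kij refl refl False jv "2.prems"(1)] jv dk by blast
  qed
  then obtain w m' where w: "w \<in> set vs" "d k = {v, w}" "m = k # m'"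
     "covers d (set m') (set (remove1 w vs))" "set m' \<subseteq> fst ` set es" "distinct m'" by blast
  have s: "set (remove1 w vs) = set vs - {w}" using "2.prems"(2) by simp
  have "covers d (insert k (set m')) (d k \<union> set (remove1 w vs))"
    using w "2.prems"(2) s by (intro covers_insert) auto
  moreover have "d k \<union> set (remove1 w vs) = set (v # vs)" using w s by auto
  moreover have "k \<notin> set m'" using w(4) w(2) s unfolding covers_def by force
  moreover have "k \<in> fst ` set es" using kij by force
  ultimately show ?case using w by auto
qed

text \<open>The member of \<open>M\<close> at the first vertex selects the branch, and deleting it
  leaves a cover of the remaining vertices. Requiring \<open>i \<noteq> j\<close> rules out a loop,
  which would cover that vertex but start no branch.\<close>

lemma matching_lists_complete:
  assumes "\<forall>k i j. (k, i, j) \<in> set es \<longrightarrow> d k = {i, j} \<and> i \<noteq> j" "distinct vs" 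
    "covers d M (set vs)" "M \<subseteq> fst ` set es"
  shows "M \<in> set ` set (matching_lists vs es)"
  using assms
proof (induction vs es arbitrary: M rule: matching_lists.induct)
  case (1 es)
  have "M = {}"
  proof (rule ccontr)
    assume "M \<noteq> {}"
    then obtain k where "k \<in> M" by blast
    then obtain i j where "(k,i,j) \<in> set es" using "1.prems"(4) by force
    then have "d k = {i, j}" using "1.prems"(1) by blast
    moreover have "d k \<subseteq> {}" using \<open>k \<in> M\<close> "1.prems"(3) unfolding covers_def by simp
    ultimately show False by blast
  qed
  then show ?case by simp
next
  case (2 v vs es)
  obtain k where k: "k \<in> M" "v \<in> d k" using "2.prems"(3) unfolding covers_def by (meson list.set_intros(1))
  then obtain i j where kij: "(k,i,j) \<in> set es" using "2.prems"(4) by force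
  then have dk: "d k = {i, j}" "i \<noteq> j" using "2.prems"(1) by blast+
  have sub: "d k \<subseteq> set (v # vs)" using k "2.prems"(3) unfolding covers_def by blast
  have rem: "covers d (M - {k}) (set (v # vs) - d k)" using covers_remove[OF "2.prems"(3) k(1)] .
  have *: "M - {k} \<subseteq> fst ` set es" using "2.prems"(4) by blast
  have ins: "M = insert k (M - {k})" using k by blast
  show ?case
  proof (cases "i = v \<and> j \<in> set vs")
    case True
    have "set (v # vs) - d k = set (remove1 j vs)" using "2.prems"(2) True dk by auto
    with "2.IH"(1)[OF kij refl refl True "2.prems"(1) _ _ *] "2.prems"(2) rem
    have "M - {k} \<in> set ` set (matching_lists (remove1 j vs) es)" by simp
    then obtain m where m: "m \<in> set (matching_lists (remove1 j vs) es)" "M - {k} = set m" by blast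
    have "M = set (k # m)" using ins m(2) by simp
    moreover have "k # m \<in> set (matching_lists (v # vs) es)"
      using kij True m(1) by (auto intro!: bexI[of _ "(k, i, j)"])
    ultimately show ?thesis by blast
  next
    case False
    then have jv: "j = v \<and> i \<in> set vs" using k(2) dk sub by auto
    have "set (v # vs) - d k = set (remove1 i vs)" using "2.prems"(2) jv dk by auto
    with "2.IH"(2)[OF kij refl refl False jv "2.prems"(1) _ _ *] "2.prems"(2) rem
    have "M - {k} \<in> set ` set (matching_lists (remove1 i vs) es)" by simp
    then obtain m where m: "m \<in> set (matching_lists (remove1 i vs) es)" "M - {k} = set m" by blast
    have "M = set (k # m)" using ins m(2) by simp
    moreover have "k # m \<in> set (matching_lists (v # vs) es)"
      using kij jv False m(1) by (auto intro!: bexI[of _ "(k, i, j)"])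
    ultimately show ?thesis by blast
  qed
qed

definition indexed :: "(nat \<times> nat) list \<Rightarrow> (nat \<times> nat \<times> nat) list" where
  "indexed ps = map (\<lambda>k. (k, ps ! k)) [0..<length ps]"

definition wf_list_graph :: "nat \<Rightarrow> (nat \<times> nat) list \<Rightarrow> bool" where
  "wf_list_graph n ps \<longleftrightarrow> (\<forall>p\<in>set ps. fst p < n \<and> snd p < n \<and> fst p \<noteq> snd p)"

lemma perfect_matching_list_graph:
  assumes "wf_list_graph n ps"
  shows "{M. perfect_matching (list_graph n ps) M} = set ` set (matching_lists [0..<n] (indexed ps))"
proof -
  let ?d = "\<lambda>k. {fst (ps ! k), snd (ps ! k)}"
  have ix: "(k, i, j) \<in> set (indexed ps) \<longleftrightarrow> k < length ps \<and> ps ! k = (i, j)" for k i j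
    unfolding indexed_def by auto
  have fs: "fst ` set (indexed ps) = {..<length ps}" by (simp add: indexed_def image_image lessThan_atLeast0)
  have wf: "i < n \<and> j < n \<and> i \<noteq> j" if "k < length ps" "ps ! k = (i, j)" for i j k
  proof -
    have "(i, j) \<in> set ps" using that nth_mem by metis
    then show ?thesis using assms unfolding wf_list_graph_def by fastforce
  qed
  have pm: "perfect_matching (list_graph n ps) M \<longleftrightarrow> M \<subseteq> fst ` set (indexed ps) \<and> covers ?d M (set [0..<n])" for M
  proof -
    have d: "?d k \<subseteq> {..<n}" if "k < length ps" for k using wf[OF that, of "fst (ps ! k)" "snd (ps ! k)"] by simp
    let ?Q = "\<forall>v\<in>{..<n}. \<exists>!e. e \<in> M \<and> v \<in> ?d e"
    have 1: "perfect_matching (list_graph n ps) M \<longleftrightarrow> M \<subseteq> {..<length ps} \<and> ?Q"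
      by (simp add: perfect_matching_def list_graph_def)
    have 2: "covers ?d M (set [0..<n]) \<longleftrightarrow> (\<forall>e\<in>M. ?d e \<subseteq> {..<n}) \<and> ?Q"
      unfolding covers_def lessThan_atLeast0 set_upt ..
    have 3: "\<forall>e\<in>M. ?d e \<subseteq> {..<n}" if "M \<subseteq> {..<length ps}" using d that by (metis lessThan_iff subsetD)
    show ?thesis unfolding fs 1 2 using 3 by argo
  qed
  have c: "M \<in> set ` set (matching_lists [0..<n] (indexed ps))" if "perfect_matching (list_graph n ps) M" for M
    using that unfolding pm by (intro matching_lists_complete[of _ ?d]) (auto simp: ix dest: wf)
  have s: "perfect_matching (list_graph n ps) (set m)" if "m \<in> set (matching_lists [0..<n] (indexed ps))" for m
    unfolding pm using matching_lists_sound[of "indexed ps" ?d "[0..<n]" m] that by (auto simp: ix)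
  show ?thesis
  proof (intro equalityI subsetI)
    fix M assume "M \<in> {M. perfect_matching (list_graph n ps) M}"
    then show "M \<in> set ` set (matching_lists [0..<n] (indexed ps))" using c by (simp only: mem_Collect_eq)
  next
    fix M assume "M \<in> set ` set (matching_lists [0..<n] (indexed ps))"
    then obtain m where "m \<in> set (matching_lists [0..<n] (indexed ps))" "M = set m" by (elim imageE)
    then show "M \<in> {M. perfect_matching (list_graph n ps) M}" using s by (simp only: mem_Collect_eq)
  qed
qed

definition edge_count :: "nat list list \<Rightarrow> nat \<Rightarrow> nat" where
  "edge_count L k = length (filter (\<lambda>m. k \<in> set m) L)"

text \<open>The first conjunct says that no matching is listed twice, even in another order, so that
  counting lists counts matchings. The last one expresses that 1-matching and 2-matching edges do
  not mix, as equality of the counts along each matching.\<close>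

definition check_B :: "nat list list \<Rightarrow> nat \<Rightarrow> bool" where
  "check_B L l \<longleftrightarrow> distinct (map sort L) \<and> (\<forall>k<l. edge_count L k = 1 \<or> edge_count L k = 2) \<and>
     (\<forall>m\<in>set L. \<forall>i\<in>set m. \<forall>j\<in>set m. edge_count L i = edge_count L j)"

lemma matching_edge_list_graph:
  assumes wf: "wf_list_graph n ps" and L: "L = matching_lists [0..<n] (indexed ps)" 
    and ds: "distinct (map sort L)" 
  shows "card {M. perfect_matching (list_graph n ps) M \<and> k \<in> M} = edge_count L k"
proof -
  have d: "distinct m" if "m \<in> set L" for m
  proof -
    have "(\<forall>k i j. (k, i, j) \<in> set (indexed ps) \<longrightarrow> (\<lambda>k. {fst (ps ! k), snd (ps ! k)}) k = {i, j})"
      unfolding indexed_def by (clarsimp) (metis fst_conv snd_conv)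
    from matching_lists_sound[OF this _ that[unfolded L]] show ?thesis by simp
  qed
  have inj: "inj_on set (set L)"
  proof (rule inj_onI)
    fix a b assume ab: "a \<in> set L" "b \<in> set L" "set a = set b"
    then have "sort a = sort b" using d by (metis sorted_list_of_set_sort_remdups distinct_remdups_id)
    then show "a = b" using ds ab by (simp add: distinct_map inj_on_def)
  qed
  have "{M. perfect_matching (list_graph n ps) M \<and> k \<in> M} = {M \<in> {M. perfect_matching (list_graph n ps) M}. k \<in> M}" by simp
  also have "\<dots> = set ` set (filter (\<lambda>m. k \<in> set m) L)"
    unfolding perfect_matching_list_graph[OF wf] L by auto
  also have "card \<dots> = card (set (filter (\<lambda>m. k \<in> set m) L))"
    by (intro card_image inj_on_subset[OF inj]) auto
  also have "\<dots> = length (filter (\<lambda>m. k \<in> set m) L)"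
    using ds by (intro distinct_card distinct_filter) (simp add: distinct_map)
  finally show ?thesis unfolding edge_count_def .
qed

section \<open>Isomorphisms and their action on perfect matchings\<close>

lemma isomorphic_list_graphI:
  assumes "distinct vl" "set vl = verts G" "distinct el" "set el = edges G" "length el = length ps"
    "\<And>k. k < length ps \<Longrightarrow> ends G (el ! k) = {vl ! fst (ps ! k), vl ! snd (ps ! k)}"
  shows "isomorphic (list_graph (length vl) ps) G"
  unfolding isomorphic_def
proof (intro exI conjI)
  show "bij_betw ((!) vl) (verts (list_graph (length vl) ps)) (verts G)"
    using bij_betw_nth[OF assms(1) refl refl] assms(2) by (simp add: list_graph_def)
  show "bij_betw ((!) el) (edges (list_graph (length vl) ps)) (edges G)"
    using bij_betw_nth[OF assms(3) refl refl] assms(4,5) by (simp add: list_graph_def)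
  show "\<forall>e\<in>edges (list_graph (length vl) ps). ends G (el ! e) = (!) vl ` ends (list_graph (length vl) ps) e"
    using assms(6) by (simp add: list_graph_def)
qed

text \<open>The map on vertices is injective on \<open>verts G\<close> only; its inverse recovers an
  end set from its image because that set consists of vertices.\<close>

lemma isomorphic_sym:
  assumes "isomorphic G H" "\<And>e. e \<in> edges G \<Longrightarrow> ends G e \<subseteq> verts G"
  shows "isomorphic H G"
proof -
  obtain \<phi> \<psi> where *: "bij_betw \<phi> (verts G) (verts H)" "bij_betw \<psi> (edges G) (edges H)"
     "\<forall>e\<in>edges G. ends H (\<psi> e) = \<phi> ` ends G e" using assms(1) unfolding isomorphic_def by blast
  let ?p = "inv_into (verts G) \<phi>" and ?q = "inv_into (edges G) \<psi>"
  have "ends G (?q f) = ?p ` ends H f" if "f \<in> edges H" for f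
  proof -
    have q: "?q f \<in> edges G" "\<psi> (?q f) = f" using *(2) that
      by (auto simp: bij_betw_def inv_into_into f_inv_into_f)
    then have "ends H f = \<phi> ` ends G (?q f)" using *(3) by metis
    then show ?thesis using assms(2)[OF q(1)] *(1)
      by (simp add: bij_betw_def inv_into_image_cancel)
  qed
  then show ?thesis using *(1,2) unfolding isomorphic_def
    by (intro exI[of _ ?p] exI[of _ ?q]) (auto intro: bij_betw_inv_into)
qed

lemma isomorphic_trans:
  assumes "isomorphic G H" "isomorphic H K"
  shows "isomorphic G K"
proof -
  obtain p q where *: "bij_betw p (verts G) (verts H)" "bij_betw q (edges G) (edges H)"
     "\<forall>e\<in>edges G. ends H (q e) = p ` ends G e" using assms(1) unfolding isomorphic_def by blast
  obtain p' q' where **: "bij_betw p' (verts H) (verts K)" "bij_betw q' (edges H) (edges K)"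
     "\<forall>e\<in>edges H. ends K (q' e) = p' ` ends H e" using assms(2) unfolding isomorphic_def by blast
  have "q e \<in> edges H" if "e \<in> edges G" for e using *(2) that by (auto simp: bij_betw_def)
  then have "\<forall>e\<in>edges G. ends K ((q' \<circ> q) e) = (p' \<circ> p) ` ends G e" using *(3) **(3)
    by (simp add: image_comp)
  then show ?thesis using *(1,2) **(1,2) unfolding isomorphic_def by (meson bij_betw_trans)
qed

lemma isomorphic_iff_list_graph:
  assumes "isomorphic (list_graph n ps) H" "wf_list_graph n ps"
  shows "isomorphic G H \<longleftrightarrow> isomorphic G (list_graph n ps)"
proof -
  have H: "isomorphic H (list_graph n ps)"
    by (rule isomorphic_sym[OF assms(1)]) (use assms(2) in \<open>auto simp: wf_list_graph_def list_graph_def\<close>)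
  show ?thesis using isomorphic_trans[OF _ H] isomorphic_trans[OF _ assms(1)] by (rule iffI)
qed

lemma perfect_matching_isomorphic:
  assumes "bij_betw p (verts G) (verts H)" "bij_betw q (edges G) (edges H)"
     "\<forall>e\<in>edges G. ends H (q e) = p ` ends G e" "\<forall>e\<in>edges G. ends G e \<subseteq> verts G"
     "M \<subseteq> edges G"
  shows "perfect_matching H (q ` M) \<longleftrightarrow> perfect_matching G M"
proof -
  have iq: "q e = q f \<longleftrightarrow> e = f" if "e \<in> M" "f \<in> M" for e f
    using that assms(2,5) by (auto simp: bij_betw_def inj_on_def)
  have mem: "p v \<in> ends H (q e) \<longleftrightarrow> v \<in> ends G e" if "v \<in> verts G" "e \<in> M" for v e
  proof -
    have "e \<in> edges G" using that assms(5) by blast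
    then show ?thesis using that assms(1,3,4) inj_on_image_mem_iff[of p "verts G" v "ends G e"]
      by (simp add: bij_betw_def)
  qed
  have "(\<exists>f\<in>q ` M. p v \<in> ends H f \<and> (\<forall>g\<in>q ` M. p v \<in> ends H g \<longrightarrow> g = f)) \<longleftrightarrow>
      (\<exists>e\<in>M. v \<in> ends G e \<and> (\<forall>g\<in>M. v \<in> ends G g \<longrightarrow> g = e))" if v: "v \<in> verts G" for v
    by (simp add: mem[OF v] iq cong: conj_cong)
  moreover have "verts H = p ` verts G" "q ` M \<subseteq> edges H"
    using assms(1,2,5) unfolding bij_betw_def by blast+
  ultimately show ?thesis using assms(5) unfolding perfect_matching_iff by simp
qed

lemma matching_edge_isomorphic:
  assumes "bij_betw p (verts G) (verts H)" "bij_betw q (edges G) (edges H)"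
     "\<forall>e\<in>edges G. ends H (q e) = p ` ends G e" "\<forall>e\<in>edges G. ends G e \<subseteq> verts G"
     "e \<in> edges G"
  shows "card {M. perfect_matching H M \<and> q e \<in> M} = card {M. perfect_matching G M \<and> e \<in> M}"
proof -
  have inj: "inj_on q (edges G)" and im: "q ` edges G = edges H" using assms(2) by (auto simp: bij_betw_def)
  have "{M. perfect_matching H M \<and> q e \<in> M} = (`) q ` {M. perfect_matching G M \<and> e \<in> M}" (is "?L = ?R")
  proof
    show "?L \<subseteq> ?R"
    proof
      fix M' assume M': "M' \<in> ?L"
      then have "M' \<subseteq> q ` edges G" unfolding perfect_matching_def im by auto
      then obtain M where M: "M \<subseteq> edges G" "M' = q ` M" by (meson subset_imageE)
      then have "perfect_matching G M" using M' perfect_matching_isomorphic[OF assms(1-4) M(1)] by simp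
      moreover have "e \<in> M" using M' M inj assms(5) by (simp add: inj_on_image_mem_iff)
      ultimately show "M' \<in> ?R" using M by blast
    qed
    show "?R \<subseteq> ?L"
    proof
      fix M' assume "M' \<in> ?R"
      then obtain M where M: "perfect_matching G M" "e \<in> M" "M' = q ` M" by blast
      then have "M \<subseteq> edges G" unfolding perfect_matching_def by blast
      then show "M' \<in> ?L" using M perfect_matching_isomorphic[OF assms(1-4)] by blast
    qed
  qed
  moreover have "inj_on ((`) q) {M. perfect_matching G M \<and> e \<in> M}"
    using inj by (intro inj_onI) (auto simp: perfect_matching_def inj_on_image_eq_iff)
  ultimately show ?thesis by (simp add: card_image)
qed

text \<open>A graph without edges is bipartite, with the empty set as a colour class; hence a brick
  has an edge, and that edge lies in a perfect matching.\<close>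

lemma brick_perfect_matching:
  assumes "brick G" shows "\<exists>M. perfect_matching G M"
proof -
  have "edges G \<noteq> {}" using assms unfolding brick_def bipartite_def cut_def by auto
  then show ?thesis using assms unfolding brick_def matching_covered_def by blast
qed

lemma class_B_list_graph:
  assumes "brick G" "isomorphic G (list_graph n ps)" "wf_list_graph n ps"
    "check_B (matching_lists [0..<n] (indexed ps)) (length ps)"
  shows "class_B G"
proof -
  let ?H = "list_graph n ps"
  define L where "L = matching_lists [0..<n] (indexed ps)"
  have mc: "graph G" "connected G" using assms(1) unfolding brick_def matching_covered_def by auto
  obtain p q where *: "bij_betw p (verts G) (verts ?H)" "bij_betw q (edges G) (edges ?H)"
     "\<forall>e\<in>edges G. ends ?H (q e) = p ` ends G e" using assms(2) unfolding isomorphic_def by blast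
  have eG: "\<forall>e\<in>edges G. ends G e \<subseteq> verts G" using mc unfolding graph_def by blast
  have ch: "distinct (map sort L)" "\<forall>k<length ps. edge_count L k = 1 \<or> edge_count L k = 2"
    "\<forall>m\<in>set L. \<forall>i\<in>set m. \<forall>j\<in>set m. edge_count L i = edge_count L j"
    using assms(4) unfolding check_B_def L_def[symmetric] by blast+
  have ql: "q e < length ps" if "e \<in> edges G" for e
    using *(2) that by (auto simp: bij_betw_def list_graph_def)
  have me: "matching_edge k G e \<longleftrightarrow> edge_count L (q e) = k" if "e \<in> edges G" for e k
    using that matching_edge_isomorphic[OF * eG that] matching_edge_list_graph[OF assms(3) L_def ch(1)]
    by (simp add: matching_edge_def)
  have "edge_count L (q e) = edge_count L (q f)" if M: "perfect_matching G M" "e \<in> M" "f \<in> M" for M e f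
  proof -
    have sub: "M \<subseteq> edges G" using M unfolding perfect_matching_def by blast
    then have "perfect_matching ?H (q ` M)" using perfect_matching_isomorphic[OF * eG sub] M by blast
    then have "q ` M \<in> set ` set L" using perfect_matching_list_graph[OF assms(3), folded L_def] by (metis mem_Collect_eq)
    then obtain m where "m \<in> set L" "q ` M = set m" by (elim imageE)
    then show ?thesis using ch(3) M by blast
  qed
  moreover have "e \<in> edges G" if "perfect_matching G M" "e \<in> M" for M e
    using that unfolding perfect_matching_def by blast
  ultimately have "\<not> (\<exists>e\<in>M. \<exists>f\<in>M. matching_edge 1 G e \<and> matching_edge 2 G f)" if "perfect_matching G M" for M
    using that me by (metis numeral_eq_one_iff semiring_norm(85))
  moreover have "matching_edge 1 G e \<or> matching_edge 2 G e" if "e \<in> edges G" for e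
    using me[OF that] ch(2) ql[OF that] by blast
  ultimately show ?thesis unfolding class_B_def using mc brick_perfect_matching[OF assms(1)] by blast
qed

section \<open>The six graphs\<close>

text \<open>The parameters are the multiplicities of the three perfect matchings of the complete
  graph on \<open>0, 1, 2, 3\<close>; the two edges of one matching are repeated equally
  often.\<close>

definition K4_pairs :: "nat \<Rightarrow> nat \<Rightarrow> nat \<Rightarrow> (nat \<times> nat) list" where
  "K4_pairs i j k = replicate i (0, 1) @ replicate i (2, 3) @ replicate j (0, 2) @ replicate j (1, 3) @
     replicate k (0, 3) @ replicate k (1, 2)"

text \<open>An 8-cycle with chords \<open>15\<close> and \<open>37\<close>, and an edge
  \<open>89\<close> whose ends are joined to the cycle vertices \<open>0\<close>, \<open>4\<close>
  and \<open>2\<close>, \<open>6\<close> respectively. The graph is found in this shape: two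
  matchings share the edge \<open>89\<close> and alternate along the 8-cycle.\<close>

definition petersen_pairs :: "(nat \<times> nat) list" where
  "petersen_pairs = [(0, 1), (1, 2), (2, 3), (3, 4), (4, 5), (5, 6), (6, 7), (7, 0), (1, 5), (3, 7), (8, 9), (8, 0), (8, 4), (9, 2), (9, 6)]"

text \<open>The octahedron with antipodal, hence missing, pairs \<open>05\<close>, \<open>12\<close>
  and \<open>34\<close>.\<close>

definition T1_pairs :: "(nat \<times> nat) list" where
  "T1_pairs = [(0, 1), (0, 2), (0, 3), (0, 4), (1, 3), (1, 4), (1, 5), (2, 3), (2, 4), (2, 5), (3, 5), (4, 5)]"

lemma K4_pairs_check:
  assumes "i \<in> {1, 2}" "j \<in> {1, 2}" "k \<in> {1, 2}"
  shows "wf_list_graph 4 (K4_pairs i j k)"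
    "check_B (matching_lists [0..<4] (indexed (K4_pairs i j k))) (length (K4_pairs i j k))"
proof -
  have "\<forall>i\<in>{1, 2}. \<forall>j\<in>{1, 2}. \<forall>k\<in>{1, 2}. wf_list_graph 4 (K4_pairs i j k) \<and>
    check_B (matching_lists [0..<4] (indexed (K4_pairs i j k))) (length (K4_pairs i j k))"
    by code_simp
  then show "wf_list_graph 4 (K4_pairs i j k)"
    "check_B (matching_lists [0..<4] (indexed (K4_pairs i j k))) (length (K4_pairs i j k))"
    using assms by blast+
qed

lemma petersen_pairs_check:
  "wf_list_graph 10 petersen_pairs"
  "check_B (matching_lists [0..<10] (indexed petersen_pairs)) (length petersen_pairs)"
  by code_simp+

lemma T1_pairs_check:
  "wf_list_graph 6 T1_pairs"
  "check_B (matching_lists [0..<6] (indexed T1_pairs)) (length T1_pairs)"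
  by code_simp+

lemma pairs_eqI:
  assumes "\<forall>a\<in>V. \<forall>b\<in>V. a \<noteq> b \<longrightarrow> {a, b} \<in> R" "\<forall>e\<in>R. e \<subseteq> V \<and> card e = 2"
  shows "pairs V = R"
  using assms unfolding pairs_def card_2_iff by blast

lemma pairs_4: "pairs {0..<4::nat} = {{0, 1}, {2, 3}, {0, 2}, {1, 3}, {0, 3}, {1, 2}}"
proof -
  have *: "{0..<4::nat} = {0, 1, 2, 3}" by auto
  show ?thesis unfolding * by (rule pairs_eqI) (simp_all add: insert_commute)
qed

lemma pairs_5: "pairs {0..<5::nat} = set [{0, 1}, {0, 2}, {0, 3}, {0, 4}, {1, 2}, {1, 3}, {1, 4}, {2, 3}, {2, 4}, {3, 4}]"
proof -
  have *: "{0..<5::nat} = {0, 1, 2, 3, 4}" by auto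
  show ?thesis unfolding * by (rule pairs_eqI) (simp_all add: insert_commute)
qed

lemma pairs_6: "pairs {0..<6::nat} - C6_edges \<union> {{0, 1}, {2, 3}, {4, 5}} = set [{0, 1}, {0, 2}, {0, 3}, {0, 4}, {1, 3}, {1, 4}, {1, 5}, {2, 3}, {2, 4}, {2, 5}, {3, 5}, {4, 5}]"
proof -
  have *: "{0..<6::nat} = {0, 1, 2, 3, 4, 5}" by auto
  have p: "pairs {0..<6::nat} = {{0, 1}, {0, 2}, {0, 3}, {0, 4}, {0, 5}, {1, 2}, {1, 3}, {1, 4}, {1, 5},
    {2, 3}, {2, 4}, {2, 5}, {3, 4}, {3, 5}, {4, 5}}"
    unfolding * by (rule pairs_eqI) (simp_all add: insert_commute)
  have "i < 6 \<longleftrightarrow> i \<in> {0, 1, 2, 3, 4, 5}" for i :: nat by auto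
  then have "C6_edges = (\<lambda>i. {i, Suc i mod 6}) ` {0, 1, 2, 3, 4, 5}" unfolding C6_edges_def by blast
  also have "\<dots> = {{0, 1}, {1, 2}, {2, 3}, {3, 4}, {4, 5}, {0, 5}}" by (simp, simp add: insert_commute numeral_eq_Suc)
  finally have c: "C6_edges = {{0, 1}, {1, 2}, {2, 3}, {3, 4}, {4, 5}, {0, 5}}" .
  define S :: "nat set set" where "S = set [{0, 1}, {0, 2}, {0, 3}, {0, 4}, {1, 3}, {1, 4}, {1, 5}, {2, 3}, {2, 4}, {2, 5}, {3, 5}, {4, 5}]"
  have "\<forall>e\<in>pairs {0..<6}. e \<in> C6_edges \<or> e \<in> S" "\<forall>e\<in>S. e \<in> pairs {0..<6} \<and> e \<notin> C6_edges \<or> e \<in> {{0, 1}, {2, 3}, {4, 5}}"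
    "\<forall>e\<in>{{0, 1}, {2, 3}, {4, 5}}. e \<in> S"
    unfolding p c S_def by (simp_all add: doubleton_eq_iff)
  then have "pairs {0..<6} - C6_edges \<union> {{0, 1}, {2, 3}, {4, 5}} = S" by blast
  then show ?thesis unfolding S_def .
qed

lemma list_graph_T1: "isomorphic (list_graph 6 T1_pairs) T1"
proof -
  have "isomorphic (list_graph (length [0..<6]) T1_pairs) T1"
  proof (rule isomorphic_list_graphI[where el = "map (\<lambda>(i, j). {i, j}) T1_pairs"])
    show "set (map (\<lambda>(i, j). {i, j}) T1_pairs) = edges T1"
      unfolding T1_def simple_graph_def pairs_6 by (simp add: T1_pairs_def)
  qed (auto simp: T1_pairs_def T1_def simple_graph_def doubleton_eq_iff less_Suc_eq numeral_eq_Suc)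
  then show ?thesis by simp
qed

lemma list_graph_petersen: "isomorphic (list_graph 10 petersen_pairs) petersen"
proof -
  define vl :: "nat set list" where "vl = [{0, 1}, {2, 3}, {0, 4}, {1, 2}, {0, 3}, {1, 4}, {0, 2}, {3, 4}, {2, 4}, {1, 3}]"
  define el :: "nat set set list" where "el = [{{0, 1}, {2, 3}}, {{2, 3}, {0, 4}}, {{0, 4}, {1, 2}}, {{1, 2}, {0, 3}}, {{0, 3}, {1, 4}}, {{1, 4}, {0, 2}}, {{0, 2}, {3, 4}}, {{3, 4}, {0, 1}}, {{2, 3}, {1, 4}}, {{1, 2}, {3, 4}}, {{2, 4}, {1, 3}}, {{2, 4}, {0, 1}}, {{2, 4}, {0, 3}}, {{1, 3}, {0, 4}}, {{1, 3}, {0, 2}}]"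
  have "isomorphic (list_graph (length vl) petersen_pairs) petersen"
  proof (rule isomorphic_list_graphI[where el = el])
    show d: "distinct vl" by (simp add: vl_def doubleton_eq_iff)
    show v: "set vl = verts petersen" unfolding petersen_def simple_graph_def pairs_5
      by (simp add: vl_def insert_commute)
    show l: "length el = length petersen_pairs" by (simp add: el_def petersen_pairs_def)
    have *: "el = map (\<lambda>(i, j). {vl ! i, vl ! j}) petersen_pairs"
      by (simp add: el_def vl_def petersen_pairs_def)
    then show "ends petersen (el ! k) = {vl ! fst (petersen_pairs ! k), vl ! snd (petersen_pairs ! k)}"
      if "k < length petersen_pairs" for k
      using that by (simp add: petersen_def simple_graph_def split_beta)
    show "distinct el" by (simp add: el_def doubleton_eq_iff)
    have "edges petersen = {{a, b} | a b. a \<in> set vl \<and> b \<in> set vl \<and> a \<inter> b = {}}"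
      using v by (simp add: petersen_def simple_graph_def)
    also have "\<dots> = set el"
    proof
      show "set el \<subseteq> {{a, b} | a b. a \<in> set vl \<and> b \<in> set vl \<and> a \<inter> b = {}}"
      proof -
        have "\<forall>(i, j)\<in>set petersen_pairs. i < length vl \<and> j < length vl \<and> vl ! i \<inter> vl ! j = {}"
          by (simp add: petersen_pairs_def vl_def)
        then show ?thesis unfolding * by fastforce
      qed
      have "\<forall>a\<in>set vl. \<forall>b\<in>set vl. a \<inter> b = {} \<longrightarrow> {a, b} \<in> set el"
        unfolding vl_def el_def by (simp add: insert_commute)
      then show "{{a, b} | a b. a \<in> set vl \<and> b \<in> set vl \<and> a \<inter> b = {}} \<subseteq> set el" by blast
    qed
    finally show "set el = edges petersen" by simp
  qed
  moreover have "length vl = 10" by (simp add: vl_def)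
  ultimately show ?thesis by (simp only:)
qed

lemma list_graph_K4: "isomorphic (list_graph 4 (K4_pairs 1 1 1)) K4"
proof -
  define el :: "nat set list" where "el = [{0, 1}, {2, 3}, {0, 2}, {1, 3}, {0, 3}, {1, 2}]"
  have ps: "K4_pairs 1 1 1 = [(0, 1), (2, 3), (0, 2), (1, 3), (0, 3), (1, 2)]"
    by (simp add: K4_pairs_def)
  have "isomorphic (list_graph (length [0..<4]) (K4_pairs 1 1 1)) K4"
  proof (rule isomorphic_list_graphI[where el = el])
    show "distinct el" by (simp add: el_def doubleton_eq_iff)
    show "set el = edges K4" by (simp add: el_def K4_def simple_graph_def pairs_4)
    have "map (ends K4) el = map (\<lambda>p. {[0..<4] ! fst p, [0..<4] ! snd p}) (K4_pairs 1 1 1)"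
      unfolding ps by (simp add: el_def K4_def simple_graph_def numeral_2_eq_2)
    then show "ends K4 (el ! k) = {[0..<4] ! fst (K4_pairs 1 1 1 ! k), [0..<4] ! snd (K4_pairs 1 1 1 ! k)}"
      if "k < length (K4_pairs 1 1 1)" for k
      using that by (metis (no_types, lifting) length_map nth_map)
    show "length el = length (K4_pairs 1 1 1)" unfolding el_def ps by simp
    show "set [0..<4] = verts K4" by (simp add: K4_def simple_graph_def)
  qed simp
  then show ?thesis by simp
qed

lemma list_graph_K4_2: "isomorphic (list_graph 4 (K4_pairs 2 1 1)) K4_2"
proof -
  define el :: "(nat set \<times> bool) list" where "el = [({0, 1}, False), ({0, 1}, True), ({2, 3}, False), ({2, 3}, True), ({0, 2}, False), ({1, 3}, False), ({0, 3}, False), ({1, 2}, False)]"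
  have ps: "K4_pairs 2 1 1 = [(0, 1), (0, 1), (2, 3), (2, 3), (0, 2), (1, 3), (0, 3), (1, 2)]"
    by (simp add: K4_pairs_def numeral_eq_Suc)
  have "isomorphic (list_graph (length [0..<4]) (K4_pairs 2 1 1)) K4_2"
  proof (rule isomorphic_list_graphI[where el = el])
    show "distinct el" by (simp add: el_def doubleton_eq_iff)
    show "set el = edges K4_2" by (simp add: insert_commute insert_Times_insert el_def K4_2_def double_edges_def K4_def simple_graph_def pairs_4)
    have "map (ends K4_2) el = map (\<lambda>p. {[0..<4] ! fst p, [0..<4] ! snd p}) (K4_pairs 2 1 1)"
      unfolding ps by (simp add: el_def K4_2_def double_edges_def K4_def simple_graph_def numeral_2_eq_2)
    then show "ends K4_2 (el ! k) = {[0..<4] ! fst (K4_pairs 2 1 1 ! k), [0..<4] ! snd (K4_pairs 2 1 1 ! k)}"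
      if "k < length (K4_pairs 2 1 1)" for k
      using that by (metis (no_types, lifting) length_map nth_map)
    show "length el = length (K4_pairs 2 1 1)" unfolding el_def ps by simp
    show "set [0..<4] = verts K4_2" by (simp add: K4_2_def double_edges_def K4_def simple_graph_def)
  qed simp
  then show ?thesis by simp
qed

lemma list_graph_K4_4: "isomorphic (list_graph 4 (K4_pairs 2 2 1)) K4_4"
proof -
  define el :: "(nat set \<times> bool) list" where "el = [({0, 1}, False), ({0, 1}, True), ({2, 3}, False), ({2, 3}, True), ({0, 2}, False), ({0, 2}, True), ({1, 3}, False), ({1, 3}, True), ({0, 3}, False), ({1, 2}, False)]"
  have ps: "K4_pairs 2 2 1 = [(0, 1), (0, 1), (2, 3), (2, 3), (0, 2), (0, 2), (1, 3), (1, 3), (0, 3), (1, 2)]"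
    by (simp add: K4_pairs_def numeral_eq_Suc)
  have "isomorphic (list_graph (length [0..<4]) (K4_pairs 2 2 1)) K4_4"
  proof (rule isomorphic_list_graphI[where el = el])
    show "distinct el" by (simp add: el_def doubleton_eq_iff)
    show "set el = edges K4_4" by (simp add: insert_commute insert_Times_insert el_def K4_4_def double_edges_def K4_def simple_graph_def pairs_4)
    have "map (ends K4_4) el = map (\<lambda>p. {[0..<4] ! fst p, [0..<4] ! snd p}) (K4_pairs 2 2 1)"
      unfolding ps by (simp add: el_def K4_4_def double_edges_def K4_def simple_graph_def numeral_2_eq_2)
    then show "ends K4_4 (el ! k) = {[0..<4] ! fst (K4_pairs 2 2 1 ! k), [0..<4] ! snd (K4_pairs 2 2 1 ! k)}"
      if "k < length (K4_pairs 2 2 1)" for k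
      using that by (metis (no_types, lifting) length_map nth_map)
    show "length el = length (K4_pairs 2 2 1)" unfolding el_def ps by simp
    show "set [0..<4] = verts K4_4" by (simp add: K4_4_def double_edges_def K4_def simple_graph_def)
  qed simp
  then show ?thesis by simp
qed

lemma list_graph_K4_6: "isomorphic (list_graph 4 (K4_pairs 2 2 2)) K4_6"
proof -
  define el :: "(nat set \<times> bool) list" where "el = [({0, 1}, False), ({0, 1}, True), ({2, 3}, False), ({2, 3}, True), ({0, 2}, False), ({0, 2}, True), ({1, 3}, False), ({1, 3}, True), ({0, 3}, False), ({0, 3}, True), ({1, 2}, False), ({1, 2}, True)]"
  have ps: "K4_pairs 2 2 2 = [(0, 1), (0, 1), (2, 3), (2, 3), (0, 2), (0, 2), (1, 3), (1, 3), (0, 3), (0, 3), (1, 2), (1, 2)]"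
    by (simp add: K4_pairs_def numeral_eq_Suc)
  have "isomorphic (list_graph (length [0..<4]) (K4_pairs 2 2 2)) K4_6"
  proof (rule isomorphic_list_graphI[where el = el])
    show "distinct el" by (simp add: el_def doubleton_eq_iff)
    show "set el = edges K4_6" by (simp add: insert_commute insert_Times_insert el_def K4_6_def double_edges_def K4_def simple_graph_def pairs_4)
    have "map (ends K4_6) el = map (\<lambda>p. {[0..<4] ! fst p, [0..<4] ! snd p}) (K4_pairs 2 2 2)"
      unfolding ps by (simp add: el_def K4_6_def double_edges_def K4_def simple_graph_def numeral_2_eq_2)
    then show "ends K4_6 (el ! k) = {[0..<4] ! fst (K4_pairs 2 2 2 ! k), [0..<4] ! snd (K4_pairs 2 2 2 ! k)}"
      if "k < length (K4_pairs 2 2 2)" for k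
      using that by (metis (no_types, lifting) length_map nth_map)
    show "length el = length (K4_pairs 2 2 2)" unfolding el_def ps by simp
    show "set [0..<4] = verts K4_6" by (simp add: K4_6_def double_edges_def K4_def simple_graph_def)
  qed simp
  then show ?thesis by simp
qed

section \<open>Kotzig's theorem on unique perfect matchings\<close>

text \<open>Skew-symmetric digraphs: \<open>\<mu>\<close> is a fixed-point-free involution reversing the arcs \<open>T\<close>.
  For a graph with a perfect matching, \<open>\<mu>\<close> is the mate function and \<open>T a b\<close> says that the mate of
  \<open>a\<close> is joined to \<open>b\<close> by a non-matching edge, so regular paths are alternating paths.\<close>

locale skew_digraph =
  fixes V :: "'a set" and \<mu> :: "'a \<Rightarrow> 'a" and T :: "'a \<Rightarrow> 'a \<Rightarrow> bool"
  assumes fin: "finite V"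
    and mate_in: "v \<in> V \<Longrightarrow> \<mu> v \<in> V" and mate_mate: "v \<in> V \<Longrightarrow> \<mu> (\<mu> v) = v" and mate_neq: "v \<in> V \<Longrightarrow> \<mu> v \<noteq> v"
    and T_in: "T a b \<Longrightarrow> a \<in> V \<and> b \<in> V" and skew: "T a b \<Longrightarrow> T (\<mu> b) (\<mu> a)"
begin

text \<open>At most one end of each matching edge is listed, so the alternating path that visits
  every listed \<open>a\<close> and then \<open>\<mu> a\<close> never repeats a vertex.\<close>

definition regular :: "'a list \<Rightarrow> bool" where
  "regular xs \<longleftrightarrow> xs \<noteq> [] \<and> set xs \<subseteq> V \<and> distinct xs \<and> set xs \<inter> \<mu> ` set xs = {} \<and> successively T xs"

text \<open>An alternating cycle. A single vertex with \<open>T a a\<close> qualifies: it stands for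
  a non-matching edge parallel to a matching edge.\<close>

definition regular_cycle :: "'a list \<Rightarrow> bool" where
  "regular_cycle xs \<longleftrightarrow> regular xs \<and> T (last xs) (hd xs)"

definition reach :: "'a \<Rightarrow> 'a set" where
  "reach r = {last xs | xs. regular xs \<and> hd xs = r}"

lemma regular_appendD:
  assumes "regular (xs @ ys)"
  shows "xs \<noteq> [] \<Longrightarrow> regular xs" "ys \<noteq> [] \<Longrightarrow> regular ys"
  using assms unfolding regular_def by (auto simp: successively_append_iff)

lemma regular_append:
  assumes "regular xs" "regular ys" "T (last xs) (hd ys)"
    "set xs \<inter> set ys = {}" "\<mu> ` set xs \<inter> set ys = {}"
  shows "regular (xs @ ys)"
proof -
  have "set xs \<inter> \<mu> ` set ys = {}"
  proof (rule ccontr)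
    assume "set xs \<inter> \<mu> ` set ys \<noteq> {}"
    then obtain y where "y \<in> set ys" "\<mu> y \<in> set xs" by blast
    moreover then have "\<mu> (\<mu> y) = y" using assms(2) mate_mate unfolding regular_def by blast
    ultimately show False using assms(5) by (metis IntI empty_iff imageI)
  qed
  then show ?thesis using assms unfolding regular_def
    by (auto simp: successively_append_iff)
qed

text \<open>The alternating path traversed backwards: every matching edge is entered at its other
  end, so each listed vertex is replaced by its mate.\<close>

lemma regular_rev:
  assumes "regular xs"
  shows "regular (map \<mu> (rev xs))"
proof -
  have inj: "inj_on \<mu> (set xs)"
    using assms mate_mate unfolding regular_def by (metis inj_on_inverseI subsetD)
  have s: "set xs \<subseteq> V" using assms unfolding regular_def by blast
  have "\<mu> ` \<mu> ` set xs = set xs" using s mate_mate by (force simp: image_image)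
  moreover have "successively T (map \<mu> (rev xs))"
  proof -
    have "successively (\<lambda>x y. T (\<mu> y) (\<mu> x)) xs"
    proof (rule successively_mono)
      show "successively T xs" using assms unfolding regular_def by blast
    qed (use skew in blast)
    then show ?thesis by (simp add: successively_map)
  qed
  ultimately show ?thesis using assms inj s mate_in unfolding regular_def
    by (auto simp: distinct_map)
qed

lemma reach_in: "reach r \<subseteq> V"
  unfolding reach_def regular_def by auto

lemma mate_notin_reach:
  assumes "r \<in> V" shows "\<mu> r \<notin> reach r"
proof
  assume "\<mu> r \<in> reach r"
  then obtain xs where xs: "regular xs" "hd xs = r" "last xs = \<mu> r" unfolding reach_def by force
  then have "r \<in> set xs" "\<mu> r \<in> set xs" unfolding regular_def by (metis hd_in_set, metis last_in_set)
  then show False using xs(1) unfolding regular_def by blast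
qed

text \<open>Kotzig's argument: extend to a vertex whose reachable set is smallest.\<close>

lemma ex_closed_reach:
  assumes "V \<noteq> {}" and no_cycle: "\<And>xs. \<not> regular_cycle xs"
  obtains r where "r \<in> V" "r \<in> reach r" "\<And>a w. a \<in> reach r \<Longrightarrow> T a w \<Longrightarrow> \<mu> w \<in> reach r"
proof -
  obtain r where r: "r \<in> V" "\<And>s. s \<in> V \<Longrightarrow> card (reach r) \<le> card (reach s)"
    using ex_min_if_finite[of "(\<lambda>r. card (reach r)) ` V"] fin assms(1)
    by (metis (no_types, lifting) arg_min_if_finite(1,2) linorder_not_le)
  have refl: "r \<in> reach r" if "r \<in> V" for r
  proof -
    have "regular [r]" using that mate_neq unfolding regular_def by auto
    then show ?thesis unfolding reach_def by force
  qed
  have "\<mu> w \<in> reach r" if a: "a \<in> reach r" "T a w" for a w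
  proof (rule ccontr)
    assume nw: "\<mu> w \<notin> reach r"
    obtain xs where xs: "regular xs" "hd xs = r" "last xs = a" using a(1) unfolding reach_def by blast
    have w: "w \<in> V" using T_in a(2) by blast
    have pre: "x \<in> reach r" if x: "x \<in> set xs" for x
    proof -
      obtain ys zs where s: "xs = ys @ x # zs" using x by (meson split_list)
      then have "regular (ys @ [x])" using regular_appendD(1)[of "ys @ [x]" zs] xs(1) by simp
      moreover have "hd (ys @ [x]) = r" using s xs(2) by (cases ys) auto
      ultimately show ?thesis unfolding reach_def by force
    qed
    \<comment> \<open>A path \<open>ys\<close> from \<open>w\<close> with an arc back to
      \<open>x\<close> closes up with the part of \<open>xs\<close> from \<open>x\<close> to
      \<open>a\<close> into a regular cycle.\<close>
    have close: False if x: "x \<in> set xs" and "regular ys" "hd ys = w" "T (last ys) x" "set xs \<inter> set ys = {}"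
        "\<mu> ` set xs \<inter> set ys = {}" for x ys
    proof -
      obtain us vs where s: "xs = us @ x # vs" using x by (meson split_list)
      have 1: "regular (x # vs)" using regular_appendD(2)[of us "x # vs"] xs(1) s by simp
      have "last (x # vs) = a" using xs(3) s by simp
      then have "regular ((x # vs) @ ys)" using that s a(2) 1 by (intro regular_append) auto
      moreover have "T (last ((x # vs) @ ys)) (hd ((x # vs) @ ys))" using that(2,4) unfolding regular_def by simp
      ultimately show False using no_cycle unfolding regular_cycle_def by blast
    qed
    have wxs: "w \<notin> set xs"
    proof
      assume "w \<in> set xs"
      then obtain us vs where s: "xs = us @ w # vs" by (meson split_list)
      have "regular (w # vs)" using regular_appendD(2)[of us "w # vs"] xs(1) s by simp
      moreover have "T (last (w # vs)) (hd (w # vs))" using a(2) xs(3) s by simp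
      ultimately show False using no_cycle unfolding regular_cycle_def by blast
    qed
    have mwxs: "\<mu> w \<notin> set xs" using nw pre by blast
    \<comment> \<open>Take the first vertex \<open>p\<close> of \<open>ys\<close> that lies in
      \<open>xs\<close> or among its mates. In \<open>xs\<close> it would close a cycle. If it is
      the mate of some \<open>q\<close> on \<open>xs\<close>, going along \<open>xs\<close> to
      \<open>q\<close> and then backwards along the mates of the earlier part of \<open>ys\<close>
      reaches \<open>\<mu> w\<close>.\<close>
    have disj: "set xs \<inter> set ys = {} \<and> \<mu> ` set xs \<inter> set ys = {}" if "regular ys" "hd ys = w" for ys
    proof (rule ccontr)
      assume n: "\<not> (set xs \<inter> set ys = {} \<and> \<mu> ` set xs \<inter> set ys = {})"
      let ?P = "\<lambda>p. p \<in> set xs \<or> p \<in> \<mu> ` set xs"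
      have "\<exists>p\<in>set ys. ?P p" using n by blast
      then obtain us p vs where s: "ys = us @ p # vs" "?P p" "\<forall>q\<in>set us. \<not> ?P q"
        using split_list_first_prop[of ys ?P] by blast
      have "us \<noteq> []"
      proof
        assume "us = []"
        then have "p = w" using s(1) that(2) by simp
        then have "w \<in> \<mu> ` set xs" using s(2) wxs by blast
        then have "\<mu> w \<in> set xs" using mate_mate xs(1) unfolding regular_def by auto
        then show False using mwxs by blast
      qed
      have us: "regular us" "hd us = w" using regular_appendD(1)[of us "p # vs"] that s(1) \<open>us \<noteq> []\<close> by auto
      have Tp: "T (last us) p" using that(1) s(1) \<open>us \<noteq> []\<close> unfolding regular_def
        by (auto simp: successively_append_iff)
      have d: "set xs \<inter> set us = {}" "\<mu> ` set xs \<inter> set us = {}" using s(3) by blast+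
      have "p \<notin> set xs" using close[OF _ us Tp d] by blast
      then obtain q where q: "q \<in> set xs" "p = \<mu> q" using s(2) by blast
      then obtain xs1 xs2 where x: "xs = (xs1 @ [q]) @ xs2" using split_list by fastforce
      have rq: "regular (xs1 @ [q])" using regular_appendD(1)[of "xs1 @ [q]" xs2] xs(1) x by simp
      have qV: "q \<in> V" using q(1) xs(1) unfolding regular_def by blast
      have usV: "set us \<subseteq> V" using us(1) unfolding regular_def by blast
      have "regular ((xs1 @ [q]) @ map \<mu> (rev us))"
      proof (rule regular_append[OF rq regular_rev[OF us(1)]])
        have "T (\<mu> p) (\<mu> (last us))" using skew[OF Tp] .
        then show "T (last (xs1 @ [q])) (hd (map \<mu> (rev us)))"
          using q(2) qV mate_mate \<open>us \<noteq> []\<close> by (simp add: hd_map hd_rev)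
        have m: "\<mu> (\<mu> z) = z" if "z \<in> set us" for z using that usV mate_mate by blast
        show "set (xs1 @ [q]) \<inter> set (map \<mu> (rev us)) = {}"
        proof (rule ccontr)
          assume "\<not> ?thesis"
          then obtain z where "z \<in> set us" "\<mu> z \<in> set xs" using x by auto
          then have "z \<in> \<mu> ` set xs" using m by (metis imageI)
          then show False using d(2) \<open>z \<in> set us\<close> by blast
        qed
        show "\<mu> ` set (xs1 @ [q]) \<inter> set (map \<mu> (rev us)) = {}"
        proof (rule ccontr)
          assume "\<not> ?thesis"
          then have "\<exists>z\<in>set us. \<exists>y\<in>set (xs1 @ [q]). \<mu> y = \<mu> z" by fastforce
          then obtain z y where "z \<in> set us" "y \<in> set xs" "\<mu> z = \<mu> y" unfolding x by fastforce
          moreover then have "\<mu> (\<mu> y) = y" using xs(1) mate_mate unfolding regular_def by blast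
          ultimately have "z = y" using m by metis
          then show False using d(1) \<open>z \<in> set us\<close> \<open>y \<in> set xs\<close> by blast
        qed
      qed
      moreover have "hd ((xs1 @ [q]) @ map \<mu> (rev us)) = r" using x xs(2) by (cases xs1) auto
      moreover have "last ((xs1 @ [q]) @ map \<mu> (rev us)) = \<mu> w"
        using us(2) \<open>us \<noteq> []\<close> by (simp add: last_map last_rev)
      ultimately show False using nw unfolding reach_def by force
    qed
    \<comment> \<open>Prefixing \<open>xs\<close> turns every path from \<open>w\<close> into a path
      from \<open>r\<close>; as \<open>r\<close> itself is not reached from \<open>w\<close>, the
      inclusion is strict, against the choice of \<open>r\<close>.\<close>
    have "reach w \<subseteq> reach r"
    proof
      fix y assume "y \<in> reach w"
      then obtain ys where ys: "regular ys" "hd ys = w" "last ys = y" unfolding reach_def by blast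
      have "regular (xs @ ys)" using disj[OF ys(1,2)] xs ys a(2) by (intro regular_append) auto
      moreover have "hd (xs @ ys) = r" "last (xs @ ys) = y" using xs(1,2) ys(1,3) unfolding regular_def by auto
      ultimately show "y \<in> reach r" unfolding reach_def by force
    qed
    moreover have "r \<notin> reach w"
    proof
      assume "r \<in> reach w"
      then obtain ys where ys: "regular ys" "hd ys = w" "last ys = r" unfolding reach_def by blast
      then have "r \<in> set ys" "r \<in> set xs" using xs(1,2) unfolding regular_def by (metis last_in_set, metis hd_in_set)
      then show False using disj[OF ys(1,2)] by blast
    qed
    ultimately have "reach w \<subset> reach r" using refl[OF r(1)] by blast
    then have "card (reach w) < card (reach r)"
      using reach_in fin by (meson finite_subset psubset_card_mono)
    then show False using r(2)[OF w] by simp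
  qed
  then show ?thesis using that r(1) refl by blast
qed

end

section \<open>Mates and alternating cycles in a graph with a perfect matching\<close>

definition mate :: "('v, 'e) mgraph \<Rightarrow> 'e set \<Rightarrow> 'v \<Rightarrow> 'v" where
  "mate G M v = (THE w. \<exists>e\<in>M. ends G e = {v, w})"

lemma mateI:
  assumes "graph G" "perfect_matching G M" "e \<in> M" "ends G e = {v, w}"
  shows "mate G M v = w"
  unfolding mate_def
proof (rule the_equality)
  show "\<exists>e\<in>M. ends G e = {v, w}" using assms(3,4) by blast
  fix x assume "\<exists>e\<in>M. ends G e = {v, x}"
  then obtain f where f: "f \<in> M" "ends G f = {v, x}" by blast
  have "v \<in> verts G" using assms unfolding graph_def perfect_matching_def by blast
  then have "f = e" using assms(2-4) f unfolding perfect_matching_iff by (metis insertI1)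
  then show "x = w" using f(2) assms(4) by (metis doubleton_eq_iff)
qed

lemma mate_edge:
  assumes "graph G" "perfect_matching G M" "v \<in> verts G"
  shows "\<exists>e\<in>M. ends G e = {v, mate G M v}"
proof -
  obtain e where e: "e \<in> M" "v \<in> ends G e" using assms(2,3) unfolding perfect_matching_iff by blast
  then have "card (ends G e) = 2" using assms(1,2) unfolding graph_def perfect_matching_def by blast
  then obtain w where "ends G e = {v, w}" using e(2) unfolding card_2_iff by fastforce
  then show ?thesis using mateI[OF assms(1,2) e(1)] e(1) by blast
qed

lemma mate_props:
  assumes "graph G" "perfect_matching G M" "v \<in> verts G"
  shows "mate G M v \<in> verts G" "mate G M (mate G M v) = v" "mate G M v \<noteq> v"
proof -
  obtain e where e: "e \<in> M" "ends G e = {v, mate G M v}" using mate_edge[OF assms] by blast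
  then have *: "ends G e \<subseteq> verts G" "card (ends G e) = 2" using assms(1,2) unfolding graph_def perfect_matching_def by blast+
  show "mate G M v \<in> verts G" using *(1) unfolding e(2) by blast
  show "mate G M v \<noteq> v" using *(2) unfolding e(2) by auto
  show "mate G M (mate G M v) = v" 
    by (rule mateI[OF assms(1,2) e(1)]) (use e(2) in blast)
qed

text \<open>Kotzig's theorem. Uniqueness forbids alternating cycles, so
  \<open>ex_closed_reach\<close> supplies a vertex \<open>r\<close> with a closed reachable set. The
  shore consists of the mates of reachable vertices, which is the reachable set with
  \<open>r\<close> replaced by its mate; only the matching edge at \<open>r\<close> leaves
  it.\<close>

lemma unique_perfect_matching_cut:
  assumes G: "graph G" and ne: "verts G \<noteq> {}" and M: "perfect_matching G M"
    and un: "\<And>N. perfect_matching G N \<Longrightarrow> N = M"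
  obtains X e where "X \<subseteq> verts G" "e \<in> M" "cut G X = {e}"
proof -
  let ?\<mu> = "mate G M"
  define T where "T a b \<longleftrightarrow> a \<in> verts G \<and> b \<in> verts G \<and> (\<exists>e\<in>edges G - M. ends G e = {?\<mu> a, b})" for a b
  note mp = mate_props[OF G M]
  interpret skew_digraph "verts G" ?\<mu> T
  proof
    show "finite (verts G)" using G unfolding graph_def by blast
    show "T (?\<mu> b) (?\<mu> a)" if ab: "T a b" for a b
    proof -
      obtain e where "e \<in> edges G - M" "ends G e = {?\<mu> a, b}" "a \<in> verts G" "b \<in> verts G"
        using ab unfolding T_def by blast
      moreover then have "ends G e = {?\<mu> (?\<mu> b), ?\<mu> a}" using mp(2) by (simp add: insert_commute)
      ultimately show ?thesis using mp(1) unfolding T_def by blast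
    qed
  qed (use mp in \<open>auto simp: T_def\<close>)
  have no_cycle: "\<not> regular_cycle xs" for xs
  proof
    assume rc: "regular_cycle xs"
    define ys where "ys = rotate1 xs"
    define S where "S = set xs \<union> ?\<mu> ` set xs"
    have xs: "xs \<noteq> []" "set xs \<subseteq> verts G" "distinct xs" "set xs \<inter> ?\<mu> ` set xs = {}" "successively T xs"
      "T (last xs) (hd xs)" using rc unfolding regular_cycle_def regular_def by blast+
    have ys: "distinct ys" "set ys = set xs" "length ys = length xs" using xs(3) unfolding ys_def by simp_all
    have "T (xs ! i) (ys ! i)" if "i < length xs" for i
    proof (cases "Suc i < length xs")
      case True
      then show ?thesis using xs(5) that by (simp add: ys_def nth_rotate1 successively_conv_nth)
    next
      case False
      then have "i = length xs - 1" using that by simp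
      then show ?thesis using xs(1,6) that by (simp add: ys_def nth_rotate1 last_conv_nth hd_conv_nth)
    qed
    then have "\<forall>i<length xs. \<exists>e. e \<in> edges G - M \<and> ends G e = {?\<mu> (xs ! i), ys ! i}" unfolding T_def by blast
    then obtain g where g: "\<And>i. i < length xs \<Longrightarrow> g i \<in> edges G - M"
      "\<And>i. i < length xs \<Longrightarrow> ends G (g i) = {?\<mu> (xs ! i), ys ! i}" by metis
    have muxs: "?\<mu> (xs ! i) \<in> ?\<mu> ` set xs" "ys ! i \<in> set xs" if "i < length xs" for i
      using that ys nth_mem by (simp, metis nth_mem)
    \<comment> \<open>Switching along the cycle: \<open>g i\<close> joins the mate of
      \<open>xs ! i\<close> to the next listed vertex \<open>ys ! i\<close>, and these edges replace
      the matching edges inside \<open>S\<close>.\<close>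
    define N where "N = {e\<in>M. ends G e \<inter> S = {}} \<union> g ` {..<length xs}"
    have "covers (ends G) {e\<in>M. ends G e \<inter> S = {}} (verts G - S)"
    proof (rule coversI)
      show "ends G e \<subseteq> verts G - S" if "e \<in> {e\<in>M. ends G e \<inter> S = {}}" for e
        using that G M unfolding graph_def perfect_matching_def by blast
      show "\<exists>f\<in>{e\<in>M. ends G e \<inter> S = {}}. v \<in> ends G f \<and> (\<forall>h\<in>{e\<in>M. ends G e \<inter> S = {}}. v \<in> ends G h \<longrightarrow> h = f)"
        if v: "v \<in> verts G - S" for v
      proof -
        obtain e where e: "e \<in> M" "ends G e = {v, ?\<mu> v}" using mate_edge[OF G M] v by blast
        have "?\<mu> v \<notin> S"
        proof
          assume "?\<mu> v \<in> S"
          then consider "?\<mu> v \<in> set xs" | x where "x \<in> set xs" "?\<mu> v = ?\<mu> x" unfolding S_def by blast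
          then have "?\<mu> (?\<mu> v) \<in> S"
          proof cases
            case 1
            then show ?thesis unfolding S_def by simp
          next
            case 2
            then have "?\<mu> (?\<mu> v) = x" using mp(2) xs(2) by auto
            then show ?thesis using 2 unfolding S_def by simp
          qed
          then show False using mp(2)[of v] v by simp
        qed
        then have "ends G e \<inter> S = {}" using e v by simp
        moreover have "h = e" if "h \<in> M" "v \<in> ends G h" for h
          using that M e v unfolding perfect_matching_iff by (metis DiffD1 insertI1)
        ultimately show ?thesis using e by blast
      qed
    qed
    moreover have "covers (ends G) (g ` {..<length xs}) S"
    proof (rule coversI)
      show "ends G e \<subseteq> S" if "e \<in> g ` {..<length xs}" for e
        using that g(2) muxs unfolding S_def by auto
      have inj: "i = j" if "i < length xs" "j < length xs" "?\<mu> (xs ! i) = ?\<mu> (xs ! j)" for i j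
        using that xs(2,3) mp(2) by (metis nth_eq_iff_index_eq nth_mem subsetD)
      have uniq: "i = j" if "v \<in> ends G (g i)" "v \<in> ends G (g j)" "i < length xs" "j < length xs" for i j v
      proof -
        have "(v = ?\<mu> (xs ! i) \<and> v = ?\<mu> (xs ! j)) \<or> (v = ys ! i \<and> v = ys ! j)"
          using that g(2) muxs xs(4) by (metis (no_types, lifting) IntI empty_iff insertE)
        then show ?thesis
        proof
          assume "v = ?\<mu> (xs ! i) \<and> v = ?\<mu> (xs ! j)"
          then show ?thesis using inj that by metis
        next
          assume "v = ys ! i \<and> v = ys ! j"
          then show ?thesis using that ys by (metis nth_eq_iff_index_eq)
        qed
      qed
      fix v assume "v \<in> S"
      then have "\<exists>i<length xs. v \<in> ends G (g i)"
      proof (cases "v \<in> set xs")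
        case True
        then obtain i where "i < length xs" "v = ys ! i" using ys by (metis in_set_conv_nth)
        then show ?thesis using g(2) by blast
      next
        case False
        then have "v \<in> ?\<mu> ` set xs" using \<open>v \<in> S\<close> unfolding S_def by blast
        then obtain i where "i < length xs" "v = ?\<mu> (xs ! i)" by (auto simp: in_set_conv_nth)
        then show ?thesis using g(2) by blast
      qed
      then obtain i where i: "i < length xs" "v \<in> ends G (g i)" by blast
      have "h = g i" if "h \<in> g ` {..<length xs}" "v \<in> ends G h" for h
        using that uniq[OF i(2) _ i(1)] by auto
      then show "\<exists>f\<in>g ` {..<length xs}. v \<in> ends G f \<and> (\<forall>h\<in>g ` {..<length xs}. v \<in> ends G h \<longrightarrow> h = f)"
        using i by blast
    qed
    ultimately have "covers (ends G) N ((verts G - S) \<union> S)" unfolding N_def by (intro covers_Un) auto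
    moreover have "(verts G - S) \<union> S = verts G" using xs(2) mp(1) unfolding S_def by blast
    moreover have "N \<subseteq> edges G" using g(1) M unfolding N_def perfect_matching_def by auto
    ultimately have "perfect_matching G N" using perfect_matching_covers[OF G] by simp
    then have "N = M" using un by blast
    moreover have "g 0 \<in> N" using xs(1) unfolding N_def by auto
    moreover have "g 0 \<notin> M" using g(1) xs(1) by blast
    ultimately show False by blast
  qed
  obtain r where r: "r \<in> verts G" "r \<in> reach r" "\<And>a w. a \<in> reach r \<Longrightarrow> T a w \<Longrightarrow> ?\<mu> w \<in> reach r"
    by (rule ex_closed_reach[OF ne no_cycle]) blast
  define X where "X = ?\<mu> ` reach r"
  have E: "reach r \<subseteq> verts G" by (rule reach_in)
  have XV: "X \<subseteq> verts G" using E mp(1) unfolding X_def by blast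
  have mr: "?\<mu> r \<notin> reach r" using mate_notin_reach[OF r(1)] .
  have inX: "?\<mu> a \<in> X \<longleftrightarrow> a \<in> reach r" if a: "a \<in> verts G" for a
  proof
    assume "?\<mu> a \<in> X"
    then obtain b where b: "b \<in> reach r" "?\<mu> a = ?\<mu> b" unfolding X_def by blast
    then have "?\<mu> (?\<mu> a) = ?\<mu> (?\<mu> b)" "b \<in> verts G" using E by auto
    then show "a \<in> reach r" using mp(2)[OF a] mp(2)[of b] b(1) by simp
  next
    assume "a \<in> reach r"
    then show "?\<mu> a \<in> X" unfolding X_def by blast
  qed
  \<comment> \<open>The predecessor of \<open>a\<close> on a path from \<open>r\<close> is reachable
    and has an arc to \<open>a\<close>, so the closure property yields the mate of \<open>a\<close>.
    Thus only \<open>r\<close> lacks a reachable mate.\<close>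
  have reach_mate: "?\<mu> a \<in> reach r" if a: "a \<in> reach r" "a \<noteq> r" for a
  proof -
    obtain xs where xs: "regular xs" "hd xs = r" "last xs = a" using a(1) unfolding reach_def by blast
    obtain zs where zs: "xs = zs @ [a]" using xs(1,3) unfolding regular_def by (metis append_butlast_last_id)
    then have "zs \<noteq> []" using xs(2) a(2) by auto
    then have "regular zs" "hd zs = r" using regular_appendD(1)[of zs "[a]"] xs(1,2) zs by auto
    then have "last zs \<in> reach r" unfolding reach_def by blast
    moreover have "T (last zs) a" using xs(1) zs \<open>zs \<noteq> []\<close> unfolding regular_def
      by (simp add: successively_append_iff)
    ultimately show ?thesis using r(3) by blast
  qed
  obtain e0 where e0: "e0 \<in> M" "ends G e0 = {r, ?\<mu> r}" using mate_edge[OF G M r(1)] by blast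
  have rX: "r \<notin> X" "?\<mu> r \<in> X" using inX[of "?\<mu> r"] inX[of r] mp[OF r(1)] mr r(1,2) by auto
  have only: "e = e0" if e: "e \<in> edges G" "ends G e = {a, b}" "a \<in> X" "b \<notin> X" for e a b
  proof -
    have V: "a \<in> verts G" "b \<in> verts G" using G e unfolding graph_def by blast+
    have ma: "?\<mu> a \<in> reach r" using inX[of "?\<mu> a"] mp[OF V(1)] e(3) by simp
    have "e \<in> M"
    proof (rule ccontr)
      assume "e \<notin> M"
      then have "T (?\<mu> a) b" using e V mp[OF V(1)] unfolding T_def by auto
      then have "?\<mu> b \<in> reach r" using r(3)[OF ma] by blast
      then show False using inX[of "?\<mu> b"] mp[OF V(2)] e(4) by simp
    qed
    then have "b = ?\<mu> a" using mateI[OF G M _ e(2)] by simp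
    moreover have "?\<mu> a = r"
    proof (rule ccontr)
      assume "?\<mu> a \<noteq> r"
      then have "?\<mu> (?\<mu> a) \<in> reach r" using reach_mate ma by blast
      then show False using inX[of a] mp(2)[OF V(1)] V e(4) \<open>b = ?\<mu> a\<close> by simp
    qed
    ultimately have "r \<in> ends G e" using e(2) by simp
    then show ?thesis using \<open>e \<in> M\<close> e0 M r(1) unfolding perfect_matching_iff by (metis insertI1)
  qed
  have "cut G X = {e0}"
  proof (intro equalityI subsetI)
    fix e assume "e \<in> cut G X"
    then have e: "e \<in> edges G" "card (ends G e \<inter> X) = 1" unfolding cut_def by auto
    then have "card (ends G e) = 2" using G unfolding graph_def by blast
    then obtain a b where ab: "ends G e = {a, b}" "a \<noteq> b" by (auto simp: card_2_iff)
    have "(a \<in> X \<and> b \<notin> X) \<or> (b \<in> X \<and> a \<notin> X)" using e(2) ab by (cases "a \<in> X"; cases "b \<in> X") auto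
    then have "e = e0" using only e(1) ab(1) by (metis insert_commute)
    then show "e \<in> {e0}" by simp
  next
    fix e assume "e \<in> {e0}"
    then show "e \<in> cut G X" using e0 M rX unfolding cut_def perfect_matching_def by auto
  qed
  then show ?thesis using that XV e0(1) by blast
qed

section \<open>Regularity and odd cuts\<close>

definition degree :: "('v, 'e) mgraph \<Rightarrow> 'v \<Rightarrow> nat" where
  "degree G v = card {e \<in> edges G. v \<in> ends G e}"

lemma card_filter_sum: "finite A \<Longrightarrow> card {x \<in> A. P x} = (\<Sum>x\<in>A. if P x then 1 else 0)"
  by (simp add: sum.If_cases Int_def)

lemma edge_ends:
  assumes "graph G" "e \<in> edges G"
  shows "\<exists>a b. ends G e = {a, b} \<and> a \<noteq> b \<and> a \<in> verts G \<and> b \<in> verts G"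
proof -
  have "card (ends G e) = 2" "ends G e \<subseteq> verts G" using assms unfolding graph_def by blast+
  then show ?thesis unfolding card_2_iff by blast
qed

lemma cut_iff:
  assumes "e \<in> edges G" "ends G e = {a, b}" "a \<noteq> b"
  shows "e \<in> cut G X \<longleftrightarrow> (a \<in> X) \<noteq> (b \<in> X)"
  using assms unfolding cut_def by (cases "a \<in> X"; cases "b \<in> X") simp_all

lemma cut_subset: "cut G X \<subseteq> edges G"
  unfolding cut_def by blast

lemma degree_sum:
  assumes G: "graph G" and X: "X \<subseteq> verts G"
  shows "(\<Sum>v\<in>X. degree G v) = card (cut G X) + 2 * card {e \<in> edges G. ends G e \<subseteq> X}"
proof -
  have fE: "finite (edges G)" and fX: "finite X" using G X finite_subset unfolding graph_def by blast+
  have "(\<Sum>v\<in>X. degree G v) = (\<Sum>e\<in>edges G. \<Sum>v\<in>X. if v \<in> ends G e then 1 else 0)"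
    unfolding degree_def card_filter_sum[OF fE] by (rule sum.swap)
  also have "\<dots> = (\<Sum>e\<in>edges G. (if e \<in> cut G X then 1 else 0) + 2 * (if ends G e \<subseteq> X then 1 else 0))"
  proof (rule sum.cong[OF refl])
    fix e assume e: "e \<in> edges G"
    obtain a b where ab: "ends G e = {a, b}" "a \<noteq> b" using edge_ends[OF G e] by blast
    have "(\<Sum>v\<in>X. if v \<in> ends G e then 1 else 0::nat) = card (X \<inter> {a, b})"
      unfolding ab(1) using fX by (simp add: sum.If_cases Int_def)
    also have "\<dots> = (if e \<in> cut G X then 1 else 0) + 2 * (if ends G e \<subseteq> X then 1 else 0)"
      unfolding cut_iff[OF e ab] unfolding ab(1) using ab(2) by (cases "a \<in> X"; cases "b \<in> X") simp_all
    finally show "(\<Sum>v\<in>X. if v \<in> ends G e then 1 else (0::nat)) = (if e \<in> cut G X then 1 else 0) + 2 * (if ends G e \<subseteq> X then 1 else 0)" .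
  qed
  also have "\<dots> = card {e \<in> edges G. e \<in> cut G X} + 2 * card {e \<in> edges G. ends G e \<subseteq> X}"
    unfolding card_filter_sum[OF fE] by (simp add: sum.distrib sum_distrib_left)
  also have "{e \<in> edges G. e \<in> cut G X} = cut G X" using cut_subset[of G X] by blast
  finally show ?thesis .
qed

text \<open>In the graph with edge set \<open>M\<close> every degree is 1, so the degree sum over
  \<open>X\<close> is \<open>card X\<close>, and \<open>degree_sum\<close> gives the parity.\<close>

lemma perfect_matching_parity:
  assumes G: "graph G" and M: "perfect_matching G M" and X: "X \<subseteq> verts G"
  shows "odd (card (M \<inter> cut G X)) \<longleftrightarrow> odd (card X)"
proof -
  let ?H = "G\<lparr>edges := M\<rparr>"
  have ME: "M \<subseteq> edges G" using M unfolding perfect_matching_def by blast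
  then have H: "graph ?H" using G finite_subset unfolding graph_def by auto
  have "degree ?H v = 1" if "v \<in> verts G" for v
  proof -
    obtain e where e: "e \<in> M" "v \<in> ends G e" "\<forall>f\<in>M. v \<in> ends G f \<longrightarrow> f = e"
      using M \<open>v \<in> verts G\<close> unfolding perfect_matching_iff by blast
    then have "{e \<in> M. v \<in> ends G e} = {e}" by blast
    then show ?thesis unfolding degree_def by simp
  qed
  then have "(\<Sum>v\<in>X. degree ?H v) = card X" using X by (simp add: subset_iff)
  moreover have "cut ?H X = M \<inter> cut G X" using ME unfolding cut_def by auto
  ultimately have "card X = card (M \<inter> cut G X) + 2 * card {e \<in> M. ends G e \<subseteq> X}"
    using degree_sum[OF H, of X] X by simp
  then show ?thesis by presburger
qed

lemma perfect_matching_subset_eq: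
  assumes "graph G" "perfect_matching G M" "perfect_matching G N" "M \<subseteq> N"
  shows "M = N"
proof
  show "N \<subseteq> M"
  proof
    fix e assume e: "e \<in> N"
    then have "e \<in> edges G" using assms(3) unfolding perfect_matching_def by blast
    then obtain a b where a: "ends G e = {a, b}" "a \<in> verts G" using edge_ends[OF assms(1)] by blast
    obtain f where f: "f \<in> M" "a \<in> ends G f" using assms(2) a(2) unfolding perfect_matching_iff by blast
    then have "f = e" using assms(3,4) e a unfolding perfect_matching_iff by (metis insertI1 subsetD)
    then show "e \<in> M" using f by simp
  qed
qed fact

lemma cut_complement:
  assumes "graph G" "X \<subseteq> verts G"
  shows "cut G (verts G - X) = cut G X"
proof -
  have "e \<in> cut G (verts G - X) \<longleftrightarrow> e \<in> cut G X" if e: "e \<in> edges G" for e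
  proof -
    obtain a b where "ends G e = {a, b}" "a \<noteq> b" "a \<in> verts G" "b \<in> verts G" using edge_ends[OF assms(1) e] by blast
    then show ?thesis by (simp add: cut_iff[OF e])
  qed
  then show ?thesis using cut_subset[of G X] cut_subset[of G "verts G - X"] by blast
qed

text \<open>When the cuts agree, lying in exactly one of \<open>X\<close> and \<open>Y\<close> is
  invariant along every edge, hence constant on a connected graph.\<close>

lemma connected_cut_eq:
  assumes "graph G" "connected G" "X \<subseteq> verts G" "Y \<subseteq> verts G" "cut G X = cut G Y"
  shows "X = Y \<or> X = verts G - Y"
proof -
  let ?Z = "{v. (v \<in> X) \<noteq> (v \<in> Y)}"
  have step: "u \<in> ?Z \<longleftrightarrow> v \<in> ?Z" if uv: "(u, v) \<in> adj G" for u v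
  proof -
    obtain e where e: "e \<in> edges G" "ends G e = {u, v}" using uv unfolding adj_def by blast
    show ?thesis
    proof (cases "u = v")
      case False
      then show ?thesis using cut_iff[OF e, of X] cut_iff[OF e, of Y] assms(5) by auto
    qed simp
  qed
  have "u \<in> ?Z \<longleftrightarrow> v \<in> ?Z" if uv: "(u, v) \<in> (adj G)\<^sup>*" for u v
    using uv by (induction rule: rtrancl_induct) (use step in blast)+
  then have all: "u \<in> ?Z \<longleftrightarrow> v \<in> ?Z" if "u \<in> verts G" "v \<in> verts G" for u v
    using that assms(2) unfolding connected_def by blast
  show ?thesis
  proof (cases "\<exists>u\<in>verts G. u \<in> ?Z")
    case True
    then have "v \<in> ?Z" if "v \<in> verts G" for v using all that by blast
    then show ?thesis using assms(3,4) by blast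
  next
    case False
    then show ?thesis using assms(3,4) by blast
  qed
qed

section \<open>Bricks of the class: weights and odd cuts\<close>

locale brick_B =
  fixes G :: "('v, 'e) mgraph"
  assumes brick: "brick G" and B: "class_B G"
begin

abbreviation "V \<equiv> verts G"
abbreviation "E \<equiv> edges G"
abbreviation "d \<equiv> ends G"

definition "PM = {M. perfect_matching G M}"

definition wt :: "'e set \<Rightarrow> nat" where
  "wt M = (if \<exists>e\<in>M. matching_edge 1 G e then 2 else 1)"

text \<open>The total weight equals twice the degree of any vertex, so the division is exact and
  \<open>r\<close> is the common degree.\<close>

definition r :: nat where "r = (\<Sum>M\<in>PM. wt M) div 2"

lemma G: "graph G" and conn: "connected G"
  using B unfolding class_B_def by blast+

lemma fin: "finite V" "finite E"
  using G unfolding graph_def by blast+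

lemma PM_D: "M \<in> PM \<Longrightarrow> perfect_matching G M" "M \<in> PM \<Longrightarrow> M \<subseteq> E"
  unfolding PM_def perfect_matching_def by blast+

lemma fin_PM: "finite PM"
  using PM_D(2) fin(2) by (meson Pow_iff finite_Pow_iff finite_subset subsetI)

lemma PM_ne: "PM \<noteq> {}"
  using B unfolding class_B_def PM_def by blast

lemma even_V: "even (card V)"
proof -
  obtain M where "perfect_matching G M" using PM_ne unfolding PM_def by blast
  then have "odd (card (M \<inter> cut G V)) \<longleftrightarrow> odd (card V)" using perfect_matching_parity[OF G] by blast
  moreover have "cut G V = {}" using cut_complement[OF G, of "{}"] unfolding cut_def by simp
  ultimately show ?thesis by simp
qed

lemma edge_12: "e \<in> E \<Longrightarrow> matching_edge 1 G e \<or> matching_edge 2 G e"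
  using B unfolding class_B_def by blast

lemma matching_edge_iff: "matching_edge k G e \<longleftrightarrow> e \<in> E \<and> card {M \<in> PM. e \<in> M} = k"
  unfolding matching_edge_def PM_def by simp

lemma wt_edge:
  assumes e: "e \<in> E"
  shows "(\<Sum>M\<in>{M \<in> PM. e \<in> M}. wt M) = 2"
  using edge_12[OF e]
proof
  assume m: "matching_edge 1 G e"
  then obtain M where M: "{M \<in> PM. e \<in> M} = {M}" unfolding matching_edge_iff by (meson card_1_singletonE)
  then have "e \<in> M" by blast
  then have "wt M = 2" using m unfolding wt_def by auto
  then show ?thesis unfolding M by simp
next
  assume m: "matching_edge 2 G e"
  have "wt M = 1" if M: "M \<in> {M \<in> PM. e \<in> M}" for M
  proof -
    have "perfect_matching G M" "e \<in> M" using M PM_D by blast+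
    then have "\<not> (\<exists>f\<in>M. matching_edge 1 G f)" using B m unfolding class_B_def by blast
    then show ?thesis unfolding wt_def by simp
  qed
  then show ?thesis using m unfolding matching_edge_iff by simp
qed

lemma wt_pos: "wt M > 0" unfolding wt_def by simp

text \<open>Both sides count pairs of an edge of \<open>F\<close> and a matching through it,
  weighted by \<open>wt\<close>. Applied to the star of a vertex this gives regularity, applied to
  an odd cut the bound \<open>r\<close>.\<close>

lemma wt_sum:
  assumes F: "F \<subseteq> E"
  shows "(\<Sum>M\<in>PM. wt M * card (M \<inter> F)) = 2 * card F"
proof -
  have fF: "finite F" using F fin finite_subset by blast
  have "(\<Sum>M\<in>PM. wt M * card (M \<inter> F)) = (\<Sum>M\<in>PM. \<Sum>e\<in>F. if e \<in> M then wt M else 0)"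
  proof (rule sum.cong[OF refl])
    fix M
    show "wt M * card (M \<inter> F) = (\<Sum>e\<in>F. if e \<in> M then wt M else 0)"
      unfolding sum.inter_restrict[OF fF, symmetric] by (simp add: Int_commute mult.commute)
  qed
  also have "\<dots> = (\<Sum>e\<in>F. \<Sum>M\<in>PM. if e \<in> M then wt M else 0)" by (rule sum.swap)
  also have "\<dots> = (\<Sum>e\<in>F. 2)"
  proof (rule sum.cong[OF refl])
    fix e assume "e \<in> F"
    then show "(\<Sum>M\<in>PM. if e \<in> M then wt M else 0) = 2"
      using wt_edge[of e] F fin_PM by (auto simp: sum.inter_filter)
  qed
  finally show ?thesis by simp
qed

lemma wt_degree: "v \<in> V \<Longrightarrow> (\<Sum>M\<in>PM. wt M) = 2 * degree G v"
proof -
  assume v: "v \<in> V"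
  let ?F = "{e \<in> E. v \<in> d e}"
  have "card (M \<inter> ?F) = 1" if M: "M \<in> PM" for M
  proof -
    obtain e where e: "e \<in> M" "v \<in> d e" "\<forall>f\<in>M. v \<in> d f \<longrightarrow> f = e"
      using PM_D(1)[OF M] v unfolding perfect_matching_iff by blast
    then have "M \<inter> ?F = {e}" using PM_D(2)[OF M] by blast
    then show ?thesis by simp
  qed
  then show ?thesis using wt_sum[of ?F] unfolding degree_def by simp
qed

lemma V_ne: "V \<noteq> {}" using conn unfolding connected_def by blast

lemma degree_r: "v \<in> V \<Longrightarrow> degree G v = r"
  using wt_degree unfolding r_def by simp

lemma wt_r: "(\<Sum>M\<in>PM. wt M) = 2 * r"
  using wt_degree V_ne unfolding r_def by force

lemma degree_sum_r: "X \<subseteq> V \<Longrightarrow> r * card X = card (cut G X) + 2 * card {e \<in> E. d e \<subseteq> X}"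
proof -
  assume X: "X \<subseteq> V"
  have "(\<Sum>v\<in>X. degree G v) = (\<Sum>v\<in>X. r)" using X degree_r by (intro sum.cong) auto
  then show ?thesis using degree_sum[OF G X] by (simp add: mult.commute)
qed

lemma cut_card_ge1:
  assumes X: "X \<subseteq> V" "odd (card X)" and M: "M \<in> PM"
  shows "card (M \<inter> cut G X) \<ge> 1"
  using perfect_matching_parity[OF G PM_D(1)[OF M] X(1)] X(2) by (cases "card (M \<inter> cut G X)") auto

lemma cut_ge:
  assumes X: "X \<subseteq> V" "odd (card X)"
  shows "card (cut G X) \<ge> r"
proof -
  have "(\<Sum>M\<in>PM. wt M * 1) \<le> (\<Sum>M\<in>PM. wt M * card (M \<inter> cut G X))"
    using cut_card_ge1[OF X] by (intro sum_mono mult_left_mono) auto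
  then show ?thesis using wt_sum[OF cut_subset] wt_r by simp
qed

lemma cut_eq_r:
  assumes X: "X \<subseteq> V" "odd (card X)" and eq: "card (cut G X) = r"
  shows "card X = 1 \<or> card (V - X) = 1"
proof -
  have "card (M \<inter> cut G X) = 1" if M: "M \<in> PM" for M
  proof (rule ccontr)
    assume "card (M \<inter> cut G X) \<noteq> 1"
    then have "card (M \<inter> cut G X) > 1" using cut_card_ge1[OF X M] by linarith
    then have "wt M * 1 < wt M * card (M \<inter> cut G X)" using wt_pos by simp
    then have "(\<Sum>M\<in>PM. wt M * 1) < (\<Sum>M\<in>PM. wt M * card (M \<inter> cut G X))"
      using cut_card_ge1[OF X] M fin_PM by (intro sum_strict_mono_ex1) auto
    then show False using wt_sum[OF cut_subset] wt_r eq by simp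
  qed
  then have "tight_cut G (cut G X)" unfolding tight_cut_def shore_def
    using X by (auto simp: PM_def Int_commute)
  then have "trivial_cut G (cut G X)" using brick unfolding brick_def by blast
  then obtain Y where Y: "Y \<subseteq> V" "cut G X = cut G Y" "card Y = 1" unfolding trivial_cut_def shore_def by blast
  then consider "X = Y" | "X = V - Y" using connected_cut_eq[OF G conn X(1)] by blast
  then show ?thesis
  proof cases
    case 2
    then have "V - X = Y" using Y(1) by blast
    then show ?thesis using Y by simp
  qed (use Y in simp)
qed

lemma cut_ge2:
  assumes X: "X \<subseteq> V" "odd (card X)" and nt: "card X \<noteq> 1" "card (V - X) \<noteq> 1"
  shows "card (cut G X) \<ge> r + 2"
proof -
  have "card (cut G X) \<ge> r" "card (cut G X) \<noteq> r" using cut_ge[OF X] cut_eq_r[OF X] nt by blast+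
  moreover have "even (card (cut G X)) \<longleftrightarrow> even r"
  proof -
    have "even (r * card X) \<longleftrightarrow> even r" using X(2) by simp
    then show ?thesis unfolding degree_sum_r[OF X(1)] by simp
  qed
  then have "card (cut G X) \<noteq> r + 1" by auto
  ultimately show ?thesis by linarith
qed

text \<open>Compare with the degrees of \<open>u\<close> and \<open>v\<close>, which sum to
  \<open>2 * r\<close>: an edge between \<open>X\<close> and \<open>Y\<close> lies in both cuts, an
  edge from \<open>u\<close> or \<open>v\<close> into \<open>X\<close> or \<open>Y\<close> in one of
  them, and an edge \<open>uv\<close>, counted twice in the degrees, in none.\<close>

lemma cut_sum_two:
  assumes uv: "u \<in> V" "v \<in> V" "u \<noteq> v" and XY: "X \<union> Y = V - {u, v}" "X \<inter> Y = {}"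
  shows "card (cut G X) + card (cut G Y) + 2 * card {e \<in> E. d e = {u, v}} =
    2 * card {e \<in> E. d e \<inter> {u, v} = {} \<and> e \<in> cut G X} + 2 * r"
proof -
  have c: "cut G Z = {e \<in> E. e \<in> cut G Z}" for Z using cut_subset[of G Z] by blast
  have "card {e \<in> E. e \<in> cut G X} + card {e \<in> E. e \<in> cut G Y} + 2 * card {e \<in> E. d e = {u, v}} =
    2 * card {e \<in> E. d e \<inter> {u, v} = {} \<and> e \<in> cut G X} + card {e \<in> E. u \<in> d e} + card {e \<in> E. v \<in> d e}"
    unfolding card_filter_sum[OF fin(2)] sum_distrib_left sum.distrib[symmetric]
  proof (rule sum.cong[OF refl])
    fix e assume e: "e \<in> E"
    obtain a b where ab: "d e = {a, b}" "a \<noteq> b" "a \<in> V" "b \<in> V" using edge_ends[OF G e] by blast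
    have m: "z \<in> Y \<longleftrightarrow> z \<noteq> u \<and> z \<noteq> v \<and> z \<notin> X" if "z \<in> V" for z using XY that by blast
    have ux: "u \<notin> X" "v \<notin> X" using XY by blast+
    have q: "d e = {u, v} \<longleftrightarrow> (u = a \<or> u = b) \<and> (v = a \<or> v = b)" using uv(3) ab(1,2) by (auto simp: doubleton_eq_iff)
    have p: "d e \<inter> {u, v} = {} \<longleftrightarrow> a \<noteq> u \<and> a \<noteq> v \<and> b \<noteq> u \<and> b \<noteq> v" unfolding ab(1) by auto
    have s: "z \<in> d e \<longleftrightarrow> z = a \<or> z = b" for z unfolding ab(1) by simp
    show "(if e \<in> cut G X then 1 else 0) + (if e \<in> cut G Y then 1 else 0) + 2 * (if d e = {u, v} then 1 else 0) =
      2 * (if d e \<inter> {u, v} = {} \<and> e \<in> cut G X then 1 else 0) + (if u \<in> d e then 1 else 0) + (if v \<in> d e then 1 else (0::nat))"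
      unfolding cut_iff[OF e ab(1,2)] q p s m[OF ab(3)] m[OF ab(4)]
      using ux uv(3) ab(2) by (cases "a \<in> X"; cases "b \<in> X"; cases "a = u"; cases "b = u"; cases "a = v"; cases "b = v") auto
  qed
  then show ?thesis using degree_r[OF uv(1)] degree_r[OF uv(2)] unfolding degree_def c[symmetric] by simp
qed

text \<open>Kotzig's theorem for the graph obtained by deleting the ends of \<open>e0\<close> and the edges in \<open>F\<close>.\<close>

lemma unique_extension_cut:
  assumes e0: "e0 \<in> M0" "d e0 = {u, v}" and M0: "M0 \<in> PM" "M0 \<inter> F = {}" and n: "card V > 2"
    and un: "\<And>M. M \<in> PM \<Longrightarrow> e0 \<in> M \<Longrightarrow> M \<inter> F = {} \<Longrightarrow> M = M0"
  shows "\<exists>X g. X \<subseteq> V - {u, v} \<and> odd (card X) \<and> odd (card (V - {u, v} - X)) \<and> g \<in> M0 \<and>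
    {e \<in> E - F. d e \<inter> {u, v} = {} \<and> e \<in> cut G X} = {g}"
proof -
  let ?H = "\<lparr>verts = V - {u, v}, edges = {e \<in> E - F. d e \<inter> {u, v} = {}}, ends = d\<rparr>"
  have e0E: "e0 \<in> E" using e0 PM_D M0 by blast
  have uv: "u \<in> V" "v \<in> V" "u \<noteq> v" using edge_ends[OF G e0E] e0(2) by (metis doubleton_eq_iff)+
  have H: "graph ?H" using G unfolding graph_def by auto
  have cards: "card (V - {u, v}) = card V - 2" using uv fin by (simp add: card_Diff_subset)
  then have "card (V - {u, v}) > 0" using n by simp
  then have ne: "verts ?H \<noteq> {}" by (simp add: card_gt_0_iff)
  have pmH: "perfect_matching ?H (M - {e0})" if M: "M \<in> PM" "e0 \<in> M" "M \<inter> F = {}" for M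
  proof -
    have c: "covers d (M - {e0}) (V - d e0)"
      using covers_remove[of d M V e0] PM_D(1)[OF M(1)] M(2) unfolding perfect_matching_covers[OF G] by simp
    then have "d e \<inter> {u, v} = {}" if "e \<in> M - {e0}" for e
      using that e0(2) unfolding covers_def by blast
    then have "M - {e0} \<subseteq> edges ?H" using PM_D(2)[OF M(1)] M(3) by auto
    then show ?thesis using c e0(2) unfolding perfect_matching_covers[OF H] by simp
  qed
  have pmG: "insert e0 N \<in> PM" if N: "perfect_matching ?H N" for N
  proof -
    have c: "covers d N (V - {u, v})" "N \<subseteq> edges ?H" using N unfolding perfect_matching_covers[OF H] by simp_all
    have "covers d (insert e0 N) (d e0 \<union> (V - {u, v}))" using covers_insert[OF c(1), of e0] e0(2) by blast
    moreover have "d e0 \<union> (V - {u, v}) = V" unfolding e0(2) using uv by blast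
    moreover have "insert e0 N \<subseteq> E" using c(2) e0E by auto
    ultimately show ?thesis unfolding PM_def using perfect_matching_covers[OF G] by simp
  qed
  have unH: "N = M0 - {e0}" if N: "perfect_matching ?H N" for N
  proof -
    have NE: "N \<subseteq> {e \<in> E - F. d e \<inter> {u, v} = {}}" using N unfolding perfect_matching_def by simp
    then have "e0 \<notin> N" using e0(2) by blast
    moreover have "insert e0 N \<inter> F = {}" using NE M0(2) e0(1) by blast
    then have "insert e0 N = M0" using un pmG[OF N] by blast
    ultimately show ?thesis by blast
  qed
  obtain X g where X: "X \<subseteq> verts ?H" "g \<in> M0 - {e0}" "cut ?H X = {g}"
    using unique_perfect_matching_cut[OF H ne pmH[OF M0(1) e0(1) M0(2)] unH] by blast
  have XV: "X \<subseteq> V" "u \<notin> X" "v \<notin> X" using X(1) by auto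
  have cutH: "{e \<in> E - F. d e \<inter> {u, v} = {} \<and> e \<in> cut G X} = {g}"
    using X(3) unfolding cut_def by auto
  \<comment> \<open>\<open>M0\<close> avoids \<open>F\<close>, and \<open>e0\<close> has no end in
    \<open>X\<close>, so the single edge of the reduced cut is the only edge of \<open>M0\<close> in
    the full cut. By parity \<open>X\<close> is odd, and so is the other shore because
    \<open>card V\<close> is even.\<close>
  have "M0 \<inter> cut G X = {g}"
  proof
    show "{g} \<subseteq> M0 \<inter> cut G X" using cutH X(2) by blast
    have "M0 - {e0} \<subseteq> {e \<in> E - F. d e \<inter> {u, v} = {}}"
      using pmH[OF M0(1) e0(1) M0(2)] unfolding perfect_matching_def by simp
    moreover have "e0 \<notin> cut G X" using cut_iff[OF e0E e0(2) uv(3)] XV by simp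
    ultimately show "M0 \<inter> cut G X \<subseteq> {g}" using cutH by blast
  qed
  then have odd: "odd (card X)" using perfect_matching_parity[OF G PM_D(1)[OF M0(1)] XV(1)] by simp
  have "card (V - {u, v} - X) = card V - 2 - card X"
    using X(1) cards fin by (subst card_Diff_subset) (auto intro: finite_subset)
  moreover have "card X \<le> card V - 2" 
    using X(1) cards card_mono[of "V - {u, v}" X] fin by simp
  moreover have "odd (b - 2 - a)" if "odd a" "even b" "a \<le> b - 2" "2 < b" for a b :: nat using that by presburger
  ultimately have "odd (card (V - {u, v} - X))" using odd even_V n by metis
  moreover have "X \<subseteq> V - {u, v}" using X(1) by simp
  moreover have "g \<in> M0" using X(2) by blast
  ultimately show ?thesis using odd cutH by (intro exI[of _ X] exI[of _ g] conjI)
qed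

text \<open>The complement of \<open>X\<close> contains both \<open>u\<close> and \<open>v\<close>,
  so only \<open>X\<close> itself can be the single vertex.\<close>

lemma shore_card1:
  assumes "u \<in> V" "v \<in> V" "u \<noteq> v" "X \<subseteq> V - {u, v}" "odd (card X)" "card (cut G X) < r + 2"
  shows "card X = 1"
proof (rule ccontr)
  assume "card X \<noteq> 1"
  then have "card (V - X) = 1" using cut_ge2[of X] assms by fastforce
  then obtain x where "V - X = {x}" by (meson card_1_singletonE)
  then have "u = x" "v = x" using assms by blast+
  then show False using assms(3) by simp
qed

lemma both_tight_card4:
  assumes uv: "u \<in> V" "v \<in> V" "u \<noteq> v" and X: "X \<subseteq> V - {u, v}" "odd (card X)" "odd (card (V - {u, v} - X))"
    and c: "card (cut G X) + card (cut G (V - {u, v} - X)) \<le> 2 * r"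
  shows "card V = 4"
proof -
  let ?Y = "V - {u, v} - X"
  have "card (cut G X) \<ge> r" "card (cut G ?Y) \<ge> r" using cut_ge[of X] cut_ge[of ?Y] X by blast+
  then have "card (cut G X) < r + 2" "card (cut G ?Y) < r + 2" using c by linarith+
  then have 1: "card X = 1" "card ?Y = 1"
    using shore_card1[OF uv X(1,2)] shore_card1[OF uv _ X(3)] by blast+
  have "V = {u, v} \<union> (X \<union> ?Y)" using X(1) uv by blast
  moreover have "card ({u, v} \<union> (X \<union> ?Y)) = card {u, v} + card (X \<union> ?Y)"
    using X(1) fin by (intro card_Un_disjoint) (auto intro: finite_subset)
  moreover have "card (X \<union> ?Y) = card X + card ?Y"
    using X(1) fin by (intro card_Un_disjoint) (auto intro: finite_subset)
  ultimately show ?thesis using uv(3) 1 by simp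
qed

lemma edge_mult_pos: "e \<in> E \<Longrightarrow> d e = {u, v} \<Longrightarrow> card {e \<in> E. d e = {u, v}} \<ge> 1"
  using fin by (metis (mono_tags, lifting) One_nat_def Suc_leI card_gt_0_iff empty_iff finite_subset mem_Collect_eq subsetI)

lemma matching_edge_1_card:
  assumes m: "matching_edge 1 G e"
  shows "card V \<le> 4"
proof (rule ccontr)
  assume n: "\<not> card V \<le> 4"
  have e: "e \<in> E" using m unfolding matching_edge_def by blast
  obtain u v where uv: "d e = {u, v}" "u \<noteq> v" "u \<in> V" "v \<in> V" using edge_ends[OF G e] by blast
  obtain M where M: "{M \<in> PM. e \<in> M} = {M}" using m unfolding matching_edge_iff by (meson card_1_singletonE)
  have M0: "M \<in> PM" "e \<in> M" using M by blast+
  have un: "N = M" if "N \<in> PM" "e \<in> N" for N using M that by blast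
  obtain X g where X: "X \<subseteq> V - {u, v}" "odd (card X)" "odd (card (V - {u, v} - X))"
    "{e \<in> E - {}. d e \<inter> {u, v} = {} \<and> e \<in> cut G X} = {g}"
    using unique_extension_cut[OF M0(2) uv(1) M0(1), of "{}"] n un by auto
  \<comment> \<open>With nothing deleted, a single edge joins the two shores and contributes 2 on
    the right, while \<open>e\<close> accounts for at least 2 on the left; the two cuts together
    thus have at most \<open>2 * r\<close> edges.\<close>
  have "card (cut G X) + card (cut G (V - {u, v} - X)) + 2 * card {e \<in> E. d e = {u, v}} = 2 + 2 * r"
    using cut_sum_two[OF uv(3,4,2), of X "V - {u, v} - X"] X(1,4) by auto
  then have "card V = 4" using both_tight_card4[OF uv(3,4,2) X(1-3)] edge_mult_pos[OF e uv(1)] by linarith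
  then show False using n by simp
qed

text \<open>After deletion of \<open>f\<close> the matching \<open>N\<close> is the only one through
  \<open>e\<close>, so at most \<open>f\<close> and one further edge \<open>g\<close> join the two
  shores. Beyond four vertices the two cuts must exceed \<open>2 * r\<close> in total, which leaves
  multiplicity 1 and makes both \<open>f\<close> and \<open>g\<close> cross. The total is then
  \<open>2 * r + 2\<close>, so one shore is a single vertex, and its edges avoiding \<open>u\<close>
  and \<open>v\<close> are \<open>f\<close> and \<open>g\<close>.\<close>

lemma degree_two_vertex:
  assumes n: "card V > 4" and M: "M \<in> PM" and N: "N \<in> PM" and e: "e \<in> M" "e \<in> N" "d e = {u, v}"
    and f: "f \<in> M" "f \<notin> N"
  shows "card {e \<in> E. d e = {u, v}} = 1"
    "\<exists>x g. x \<in> d f \<and> x \<noteq> u \<and> x \<noteq> v \<and> g \<noteq> f \<and> {h \<in> E. d h \<inter> {u, v} = {} \<and> x \<in> d h} = {f, g}"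
proof -
  have eE: "e \<in> E" using e PM_D M by blast
  have uv: "u \<noteq> v" "u \<in> V" "v \<in> V" using edge_ends[OF G eE] e(3) by (metis doubleton_eq_iff)+
  have "\<not> matching_edge 1 G e" using matching_edge_1_card n by fastforce
  then have "card {M \<in> PM. e \<in> M} = 2" using edge_12[OF eE] unfolding matching_edge_iff by blast
  moreover have "{M, N} \<subseteq> {M \<in> PM. e \<in> M}" "M \<noteq> N" using assms by blast+
  ultimately have MN: "{M, N} = {M \<in> PM. e \<in> M}" using fin_PM by (intro card_subset_eq) auto
  have "P = N" if "P \<in> PM" "e \<in> P" "P \<inter> {f} = {}" for P using MN that f by blast
  then obtain X g where X: "X \<subseteq> V - {u, v}" "odd (card X)" "odd (card (V - {u, v} - X))"
    and g: "g \<in> N" "{e \<in> E - {f}. d e \<inter> {u, v} = {} \<and> e \<in> cut G X} = {g}"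
    using unique_extension_cut[OF e(2,3) N, of "{f}"] n f(2) by auto
  let ?Y = "V - {u, v} - X" and ?D = "{e \<in> E. d e \<inter> {u, v} = {} \<and> e \<in> cut G X}"
  have gf: "g \<noteq> f" using g f by blast
  have D: "?D \<subseteq> {f, g}" "g \<in> ?D" using g(2) by blast+
  then have "card ?D \<le> 2" using gf card_mono[of "{f, g}" ?D] by simp
  have sum: "card (cut G X) + card (cut G ?Y) + 2 * card {e \<in> E. d e = {u, v}} = 2 * card ?D + 2 * r"
    using cut_sum_two[OF uv(2,3,1), of X ?Y] X(1) by auto
  have mult: "card {e \<in> E. d e = {u, v}} \<ge> 1" using edge_mult_pos[OF eE e(3)] .
  have big: "card (cut G X) + card (cut G ?Y) > 2 * r"
    using both_tight_card4[OF uv(2,3,1) X] n by linarith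
  show m1: "card {e \<in> E. d e = {u, v}} = 1" using sum mult big \<open>card ?D \<le> 2\<close> by linarith
  then have "card ?D = 2" using sum big \<open>card ?D \<le> 2\<close> by linarith
  then have Dfg: "?D = {f, g}" using D(1) gf by (simp add: card_subset_eq)
  have sum': "card (cut G X) + card (cut G ?Y) = 2 * r + 2" using sum m1 \<open>card ?D = 2\<close> by linarith
  have "card (cut G X) < r + 2 \<or> card (cut G ?Y) < r + 2" using sum' cut_ge[of X] cut_ge[of ?Y] X by linarith
  then have "card X = 1 \<or> card ?Y = 1"
    using shore_card1[OF uv(2,3,1) X(1,2)] shore_card1[OF uv(2,3,1) _ X(3)] by blast
  moreover have "\<exists>x g. x \<in> d f \<and> x \<noteq> u \<and> x \<noteq> v \<and> g \<noteq> f \<and> {h \<in> E. d h \<inter> {u, v} = {} \<and> x \<in> d h} = {f, g}"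
    if Z: "card Z = 1" "Z = X \<or> Z = ?Y" for Z
  proof -
    obtain x where x: "Z = {x}" using Z(1) by (meson card_1_singletonE)
    have xuv: "x \<in> V" "x \<noteq> u" "x \<noteq> v" using Z(2) X(1) unfolding x by blast+
    have "(d h \<inter> {u, v} = {} \<and> h \<in> cut G X) \<longleftrightarrow> (d h \<inter> {u, v} = {} \<and> x \<in> d h)" if h: "h \<in> E" for h
    proof -
      obtain a b where ab: "d h = {a, b}" "a \<noteq> b" "a \<in> V" "b \<in> V" using edge_ends[OF G h] by blast
      show ?thesis
      proof (cases "d h \<inter> {u, v} = {}")
        case True
        then have "a \<in> X \<longleftrightarrow> a \<notin> ?Y" "b \<in> X \<longleftrightarrow> b \<notin> ?Y" using ab by blast+
        then have "h \<in> cut G X \<longleftrightarrow> (a \<in> Z) \<noteq> (b \<in> Z)" using Z(2) unfolding cut_iff[OF h ab(1,2)] by blast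
        then show ?thesis using True ab(1,2) unfolding x by auto
      qed blast
    qed
    then have "{h \<in> E. d h \<inter> {u, v} = {} \<and> x \<in> d h} = {f, g}" using Dfg by blast
    then show ?thesis using xuv gf by blast
  qed
  ultimately show "\<exists>x g. x \<in> d f \<and> x \<noteq> u \<and> x \<noteq> v \<and> g \<noteq> f \<and> {h \<in> E. d h \<inter> {u, v} = {} \<and> x \<in> d h} = {f, g}"
    by blast
qed

end

section \<open>Cubic graphs\<close>

text \<open>Perfect matchings of simple graphs are represented by their mate functions, extended by the
  identity.\<close>

definition matching_on :: "('a \<Rightarrow> 'a \<Rightarrow> bool) \<Rightarrow> 'a set \<Rightarrow> ('a \<Rightarrow> 'a) \<Rightarrow> bool" where
  "matching_on A S h \<longleftrightarrow> (\<forall>x\<in>S. A x (h x) \<and> h x \<in> S \<and> h (h x) = x) \<and> (\<forall>x. x \<notin> S \<longrightarrow> h x = x)"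

lemma matching_onD:
  assumes "matching_on A S h"
  shows "x \<in> S \<Longrightarrow> A x (h x)" "x \<in> S \<Longrightarrow> h x \<in> S" "h (h x) = x" "x \<notin> S \<Longrightarrow> h x = x"
  using assms unfolding matching_on_def by (blast, blast, metis, blast)

lemma matching_on_inj: "matching_on A S h \<Longrightarrow> h x = h y \<longleftrightarrow> x = y"
  using matching_onD(3) by metis

lemma matching_on_extend:
  assumes "matching_on A S h" "A a b" "A b a" "a \<notin> S" "b \<notin> S"
  shows "matching_on A (insert a (insert b S)) (h(a := b, b := a))"
proof -
  have "h x \<noteq> a" "h x \<noteq> b" if "x \<in> S" for x using matching_onD(2)[OF assms(1) that] assms(4,5) by blast+
  then show ?thesis using assms unfolding matching_on_def by auto
qed

text \<open>\<open>T\<close> is a union of components of the union of both matchings, so using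
  \<open>f\<close> on \<open>T\<close> and \<open>g\<close> elsewhere again gives a
  matching.\<close>

lemma matching_on_mix:
  assumes f: "matching_on A S f" and g: "matching_on A S g" and T: "T \<subseteq> S" "\<And>x. x \<in> T \<Longrightarrow> f x \<in> T" "\<And>x. x \<in> T \<Longrightarrow> g x \<in> T"
  shows "matching_on A S (\<lambda>x. if x \<in> T then f x else g x)"
proof -
  have "g x \<notin> T" if "x \<notin> T" for x using T(3)[of "g x"] matching_onD(3)[OF g] that by auto
  then show ?thesis using f g T unfolding matching_on_def by auto
qed

text \<open>The assumption \<open>cover\<close> is what \<open>degree_two_vertex\<close> yields for
  degree 3: a vertex left with two edges after the removal of \<open>u\<close> and
  \<open>f u\<close> has lost exactly one, so one of these two is its neighbour.\<close>

locale cubic_matchings =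
  fixes V :: "'a set" and A :: "'a \<Rightarrow> 'a \<Rightarrow> bool"
  assumes fin: "finite V" and A_in: "A x y \<Longrightarrow> x \<in> V \<and> y \<in> V" and A_sym: "A x y \<Longrightarrow> A y x" and A_irrefl: "\<not> A x x"
    and deg: "x \<in> V \<Longrightarrow> card {y. A x y} = 3"
    and triangle_free: "A x y \<Longrightarrow> A y z \<Longrightarrow> \<not> A x z"
    and two: "A x y \<Longrightarrow> card {f. matching_on A V f \<and> f x = y} = 2"
    and cover: "matching_on A V f \<Longrightarrow> matching_on A V g \<Longrightarrow> u \<in> V \<Longrightarrow> f u = g u \<Longrightarrow> c \<in> V \<Longrightarrow> f c \<noteq> g c \<Longrightarrow>
      \<exists>x\<in>{c, f c}. (A u x \<or> A (f u) x) \<and> x \<noteq> u \<and> x \<noteq> f u"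
begin

abbreviation "mt \<equiv> matching_on A V"

lemma mtD:
  assumes "mt f"
  shows "x \<in> V \<Longrightarrow> A x (f x)" "x \<in> V \<Longrightarrow> f x \<in> V" "f (f x) = x" "x \<notin> V \<Longrightarrow> f x = x" "x \<in> V \<Longrightarrow> f x \<noteq> x"
  using matching_onD[OF assms] A_irrefl by (blast, blast, blast, blast, metis)

lemma matching_among_two:
  assumes "mt f" "mt g" "mt h" "f \<noteq> g" "f x = g x" "f x = h x" "x \<in> V"
  shows "h = f \<or> h = g"
proof -
  have c: "card {k. mt k \<and> k x = f x} = 2" using two mtD(1)[OF assms(1,7)] by blast
  then have "finite {k. mt k \<and> k x = f x}" by (intro card_ge_0_finite) simp
  moreover have "{f, g} \<subseteq> {k. mt k \<and> k x = f x}" using assms by auto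
  ultimately have "{f, g} = {k. mt k \<and> k x = f x}" using c assms(4) by (intro card_subset_eq) auto
  moreover have "h \<in> {k. mt k \<and> k x = f x}" using assms(3,6) by simp
  ultimately show ?thesis by blast
qed

lemma ex_other_matching:
  assumes "mt f" "x \<in> V"
  shows "\<exists>g. mt g \<and> g \<noteq> f \<and> g x = f x"
proof (rule ccontr)
  assume "\<not> ?thesis"
  then have "{g. mt g \<and> g x = f x} = {f}" using assms by blast
  then show False using two[OF mtD(1)[OF assms]] by simp
qed

lemma mt_ex: "A x y \<Longrightarrow> \<exists>f. mt f \<and> f x = y"
  using two[of x y] by (metis (mono_tags, lifting) card.empty empty_Collect_eq zero_neq_numeral)

lemma third_nbr:
  assumes "x \<in> V" "A x a" "A x b" "a \<noteq> b"
  shows "\<exists>t. {y. A x y} = {a, b, t} \<and> t \<noteq> a \<and> t \<noteq> b"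
proof -
  have c: "card {y. A x y} = 3" using deg assms(1) by blast
  then have f: "finite {y. A x y}" by (intro card_ge_0_finite) simp
  have "card ({y. A x y} - {a, b}) = 1" using c assms by (subst card_Diff_subset) auto
  then obtain t where "{y. A x y} - {a, b} = {t}" by (meson card_1_singletonE)
  then have "{y. A x y} = {a, b, t} \<and> t \<noteq> a \<and> t \<noteq> b" using assms(2,3) by blast
  then show ?thesis by blast
qed

lemma two_other_nbrs:
  assumes "A x a"
  shows "\<exists>b c. {y. A x y} = {a, b, c} \<and> a \<noteq> b \<and> a \<noteq> c \<and> b \<noteq> c"
proof -
  have x: "x \<in> V" using A_in assms by blast
  have "\<not> {y. A x y} \<subseteq> {a}"
  proof
    assume "{y. A x y} \<subseteq> {a}"
    then have "card {y. A x y} \<le> 1" using card_mono[of "{a}" "{y. A x y}"] by simp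
    then show False using deg[OF x] by simp
  qed
  then obtain b where b: "A x b" "b \<noteq> a" by blast
  show ?thesis using third_nbr[OF x assms b(1) b(2)[symmetric]] b by blast
qed

end

section \<open>Two perfect matchings with a common edge\<close>

locale common_edge = cubic_matchings +
  fixes f g :: "'a \<Rightarrow> 'a" and u :: 'a
  assumes f: "mt f" and g: "mt g" and fg: "f \<noteq> g" and u: "u \<in> V" and fgu: "f u = g u"
begin

definition "C = {x \<in> V. f x \<noteq> g x}"

lemma CV: "x \<in> C \<Longrightarrow> x \<in> V" unfolding C_def by blast

lemma ff[simp]: "f (f x) = x" and gg[simp]: "g (g x) = x"
  using mtD(3) f g by blast+

lemma f_eq[simp]: "f x = f y \<longleftrightarrow> x = y" and g_eq[simp]: "g x = g y \<longleftrightarrow> x = y"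
  using ff gg by metis+

lemma C_closed: "x \<in> C \<Longrightarrow> f x \<in> C" "x \<in> C \<Longrightarrow> g x \<in> C"
proof -
  show "f x \<in> C" if "x \<in> C"
  proof -
    have "x \<in> V" "f x \<noteq> g x" using that unfolding C_def by blast+
    then have "f x \<in> V" "f (f x) \<noteq> g (f x)" using mtD(2)[OF f] ff gg by metis+
    then show ?thesis unfolding C_def by blast
  qed
  show "g x \<in> C" if "x \<in> C"
  proof -
    have "x \<in> V" "f x \<noteq> g x" using that unfolding C_def by blast+
    then have "g x \<in> V" "f (g x) \<noteq> g (g x)" using mtD(2)[OF g] ff gg by metis+
    then show ?thesis unfolding C_def by blast
  qed
qed

lemma C_ne: "C \<noteq> {}"
proof
  assume "C = {}"
  then have "f x = g x" for x using mtD(4)[OF f, of x] mtD(4)[OF g, of x] unfolding C_def by (cases "x \<in> V") auto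
  then show False using fg by blast
qed

text \<open>The matchings differ along one cycle only: switching on a proper closed part
  \<open>S\<close> would produce a third matching containing the common edge at
  \<open>u\<close>.\<close>

lemma single_orbit:
  assumes S: "S \<subseteq> C" "S \<noteq> {}" "\<And>x. x \<in> S \<Longrightarrow> f x \<in> S" "\<And>x. x \<in> S \<Longrightarrow> g x \<in> S"
  shows "S = C"
proof -
  let ?h = "\<lambda>x. if x \<in> S then f x else g x"
  have "S \<subseteq> V" using S(1) CV by blast
  then have h: "mt ?h" by (rule matching_on_mix[OF f g _ S(3,4)])
  have "u \<notin> S" using S(1) fgu unfolding C_def by blast
  then have "f u = ?h u" using fgu by simp
  then have "?h = f \<or> ?h = g" using matching_among_two[OF f g h fg fgu _ u] by blast
  moreover have "?h \<noteq> g"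
  proof
    assume e: "?h = g"
    obtain x where x: "x \<in> S" using S(2) by blast
    then have "f x = g x" using fun_cong[OF e, of x] by simp
    then show False using x S(1) unfolding C_def by blast
  qed
  ultimately have e: "?h = f" by blast
  have "x \<in> S" if "x \<in> C" for x using fun_cong[OF e, of x] that unfolding C_def by (cases "x \<in> S") auto
  then show ?thesis using S(1) by blast
qed

lemma uC: "u \<notin> C" "f u \<notin> C"
proof -
  show "u \<notin> C" using fgu unfolding C_def by blast
  then show "f u \<notin> C" using C_closed(1) ff by metis
qed

definition "t c = (SOME t. {y. A c y} = {f c, g c, t} \<and> t \<noteq> f c \<and> t \<noteq> g c)"

lemma t: 
  assumes "c \<in> C"
  shows "{y. A c y} = {f c, g c, t c}" "t c \<noteq> f c" "t c \<noteq> g c"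
proof -
  have "\<exists>t. {y. A c y} = {f c, g c, t} \<and> t \<noteq> f c \<and> t \<noteq> g c"
    using third_nbr[OF CV[OF assms] mtD(1)[OF f CV[OF assms]] mtD(1)[OF g CV[OF assms]]] assms
    unfolding C_def by blast
  from someI_ex[OF this] show "{y. A c y} = {f c, g c, t c}" "t c \<noteq> f c" "t c \<noteq> g c" unfolding t_def by blast+
qed

lemma A_iff: "c \<in> C \<Longrightarrow> A c y \<longleftrightarrow> y = f c \<or> y = g c \<or> y = t c"
  using t(1) by blast

text \<open>The third edge at \<open>c\<close>, the one beside the two edges of the alternating
  cycle, ends on the common edge of \<open>f\<close> and \<open>g\<close> at \<open>w\<close>. There
  is just one such edge, so \<open>c\<close> cannot be near two disjoint common edges.\<close>

definition near :: "'a \<Rightarrow> 'a \<Rightarrow> bool" where "near w c \<longleftrightarrow> t c = w \<or> t c = f w"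

lemma near_iff:
  assumes "w \<in> V" "w \<notin> C" "c \<in> C"
  shows "(A w c \<or> A (f w) c) \<longleftrightarrow> near w c"
proof -
  have "f w \<notin> C" using C_closed(1)[of "f w"] assms(2) by auto
  then show ?thesis using A_iff[OF assms(3), of w] A_iff[OF assms(3), of "f w"] C_closed[OF assms(3)] assms(2) A_sym
    unfolding near_def by metis
qed

text \<open>This is \<open>cover\<close> for the common edge at \<open>w\<close>, applied to an
  \<open>f\<close>-edge of the cycle and, with the matchings exchanged, to a
  \<open>g\<close>-edge.\<close>

lemma near_cover:
  assumes w: "w \<in> V" "w \<notin> C" and c: "c \<in> C"
  shows "near w c \<or> near w (f c)" "near w c \<or> near w (g c)"
proof -
  have fw: "f w = g w" using w unfolding C_def by blast
  have cc: "c \<in> V" "f c \<noteq> g c" using c unfolding C_def by blast+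
  show "near w c \<or> near w (f c)"
    using cover[OF f g w(1) fw cc] near_iff[OF w c] near_iff[OF w C_closed(1)[OF c]] by blast
  have "\<exists>x\<in>{c, g c}. (A w x \<or> A (f w) x) \<and> x \<noteq> w \<and> x \<noteq> f w"
    using cover[OF g f w(1) fw[symmetric] cc(1) cc(2)[symmetric]] unfolding fw .
  then show "near w c \<or> near w (g c)"
    using near_iff[OF w c] near_iff[OF w C_closed(2)[OF c]] by blast
qed

text \<open>Since \<open>C\<close> is a single alternating even cycle, deleting two vertices on different sides of its
  bipartition \<open>P\<close> leaves two paths with an even number of vertices.\<close>

lemma cycle_minus_two:
  assumes alt: "\<And>c. c \<in> C \<Longrightarrow> P (f c) \<longleftrightarrow> \<not> P c" "\<And>c. c \<in> C \<Longrightarrow> P (g c) \<longleftrightarrow> \<not> P c"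
    and x: "x \<in> C" "P x" and x': "x' \<in> C" "\<not> P x'"
  shows "\<exists>k. matching_on A (C - {x, x'}) k"
proof -
  \<comment> \<open>Every second vertex of the cycle, in the direction that starts with the
    \<open>f\<close>-edge at \<open>x\<close>; all of them satisfy \<open>P\<close>.\<close>
  define s where "s i = ((g \<circ> f) ^^ i) x" for i
  have s0: "s 0 = x" and sS: "s (Suc i) = g (f (s i))" for i unfolding s_def by simp_all
  have sC: "s i \<in> C \<and> P (s i)" for i
    by (induction i) (use x alt C_closed in \<open>auto simp: s0 sS\<close>)
  have "inj (g \<circ> f)" by (auto simp: inj_def)
  moreover have "finite {y. \<exists>n. y = ((g \<circ> f) ^^ n) x}"
    by (rule finite_subset[OF _ fin]) (use sC CV in \<open>auto simp: s_def\<close>)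
  ultimately obtain m where m: "m > 0" "s m = x" unfolding s_def using funpow_inj_finite by metis
  define S where "S = range s \<union> f ` range s"
  have "S = C"
  proof (rule single_orbit)
    show "S \<subseteq> C" unfolding S_def using sC C_closed by blast
    show "S \<noteq> {}" unfolding S_def by blast
    show "f y \<in> S" if "y \<in> S" for y using that unfolding S_def by auto
    show "g y \<in> S" if y: "y \<in> S" for y
    proof -
      consider i where "y = s i" | i where "y = f (s i)" using y unfolding S_def by blast
      then show ?thesis
      proof cases
        case 1
        obtain j where "s i = s (Suc j)"
        proof (cases i)
          case 0
          then show ?thesis using m s0 that[of "m - 1"] by simp
        qed (use that in blast)
        then have "g y = f (s j)" using 1 sS by simp
        then show ?thesis unfolding S_def by blast
      next
        case 2
        then have "g y = s (Suc i)" using sS by simp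
        then show ?thesis unfolding S_def by blast
      qed
    qed
  qed
  then have "x' \<in> range s \<union> f ` range s" using x'(1) unfolding S_def by simp
  moreover have "x' \<notin> range s" using sC x'(2) by blast
  ultimately have "x' \<in> f ` range s" by blast
  then have "\<exists>j. f (s j) = x'" by blast
  define j where "j = (LEAST j. f (s j) = x')"
  have j: "f (s j) = x'" "\<And>i. i < j \<Longrightarrow> f (s i) \<noteq> x'"
    unfolding j_def using LeastI_ex[OF \<open>\<exists>j. f (s j) = x'\<close>] not_less_Least by blast+
  have sadd: "s (i + k) = ((g \<circ> f) ^^ k) (s i)" for i k
    unfolding s_def by (simp add: funpow_add add.commute[of i k])
  have nx: "s (Suc i) \<noteq> x" if "i < j" for i
  proof
    assume e: "s (Suc i) = x"
    have "s j = s (Suc i + (j - Suc i))" using that by simp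
    also have "\<dots> = s (j - Suc i)" unfolding sadd e by (simp add: s_def)
    finally have "f (s (j - Suc i)) = x'" using j(1) by metis
    moreover have "j - Suc i < j" using that by simp
    ultimately show False using j(2) by blast
  qed
  define T where "T = {s i | i. i \<le> j} \<union> {f (s i) | i. i \<le> j}"
  have xT: "x \<in> T" "x' \<in> T" unfolding T_def using s0 j(1) by blast+
  have Tf: "f y \<in> T" if "y \<in> T" for y using that unfolding T_def by auto
  have Tf': "f y \<notin> T" if "y \<notin> T" for y using Tf[of "f y"] that by auto
  have Tg: "g y \<in> T - {x, x'}" if y: "y \<in> T" "y \<noteq> x" "y \<noteq> x'" for y
  proof -
    consider i where "y = s i" "i \<le> j" | i where "y = f (s i)" "i \<le> j" using y unfolding T_def by blast
    then show ?thesis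
    proof cases
      case 1
      then obtain k where k: "i = Suc k" using s0 y(2) by (cases i) auto
      then have "g y = f (s k)" using 1 sS by simp
      moreover have "f (s k) \<noteq> x" using alt(1)[of "s k"] sC[of k] x(2) by metis
      moreover have "f (s k) \<noteq> x'" using j(2) 1 k by simp
      moreover have "f (s k) \<in> T" unfolding T_def using 1 k by (auto intro: exI[of _ k])
      ultimately show ?thesis by simp
    next
      case 2
      then have "i < j" using j(1) y(3) by (cases "i = j") auto
      moreover have "g y = s (Suc i)" using 2 sS by simp
      moreover have "s (Suc i) \<noteq> x'" using sC x'(2) by metis
      moreover have "s (Suc i) \<in> T" unfolding T_def using \<open>i < j\<close> by (auto intro: exI[of _ "Suc i"])
      ultimately show ?thesis using nx by simp
    qed
  qed
  \<comment> \<open>\<open>T\<close> is the arc from \<open>x\<close> to \<open>x'\<close>, which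
    begins and ends with an \<open>f\<close>-edge: its interior is paired by \<open>g\<close>-edges,
    and the rest of the cycle by \<open>f\<close>-edges.\<close>
  define k where "k y = (if y \<in> C - {x, x'} then if y \<in> T then g y else f y else y)" for y
  have "matching_on A (C - {x, x'}) k"
    unfolding matching_on_def
  proof (intro conjI ballI allI impI)
    fix y assume y: "y \<in> C - {x, x'}"
    then have "A y (f y)" "A y (g y)" "f y \<in> C" "g y \<in> C" using mtD(1)[OF f] mtD(1)[OF g] CV C_closed by blast+
    moreover have "f y \<notin> T" "f y \<noteq> x" "f y \<noteq> x'" if "y \<notin> T" using Tf'[OF that] xT by blast+
    moreover have "g y \<in> T" "g y \<noteq> x" "g y \<noteq> x'" if "y \<in> T" using Tg[OF that] y by blast+
    ultimately show "A y (k y)" "k y \<in> C - {x, x'}" "k (k y) = y" using y by (auto simp: k_def)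
  qed (auto simp: k_def)
  then show ?thesis by blast
qed

end

text \<open>Two matchings sharing the edges at \<open>u\<close> and at \<open>w\<close>; this situation is contradictory.\<close>

locale two_common_edges = common_edge +
  fixes w :: 'a
  assumes w: "w \<in> V" "f w = g w" "w \<noteq> u" "w \<noteq> f u"
begin

lemma wC: "w \<notin> C" "f w \<notin> C"
proof -
  show "w \<notin> C" using w(2) unfolding C_def by blast
  then show "f w \<notin> C" using C_closed(1) ff by metis
qed

lemma distinct4: "f w \<noteq> u" "f w \<noteq> f u" "f u \<noteq> u" "f w \<noteq> w" "f u \<noteq> w"
  using w ff mtD(5)[OF f] u by metis+

text \<open>Every edge of the cycle has an end near \<open>u\<close> and an end near
  \<open>w\<close>, and no vertex is near both, so the two kinds alternate along the cycle.\<close>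

lemma near_sides:
  assumes c: "c \<in> C"
  shows "near w c \<longleftrightarrow> \<not> near u c" "near u (f c) \<longleftrightarrow> \<not> near u c" "near u (g c) \<longleftrightarrow> \<not> near u c"
proof -
  have n: "\<not> (near u b \<and> near w b)" for b using distinct4 w(3,4) unfolding near_def by auto
  note cu = near_cover[OF u uC(1)] near_cover[OF w(1) wC(1)]
  show "near w c \<longleftrightarrow> \<not> near u c" "near u (f c) \<longleftrightarrow> \<not> near u c" "near u (g c) \<longleftrightarrow> \<not> near u c"
    using cu[OF c] n[of c] n[of "f c"] n[of "g c"] by argo+
qed

text \<open>A further vertex \<open>z\<close> off the cycle would lie on a third common edge, and a
  cycle vertex near it would also be near \<open>u\<close> or \<open>w\<close>, although it has only
  one third edge.\<close>

lemma V_eq: "V = C \<union> {u, f u, w, f w}"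
proof
  show "C \<union> {u, f u, w, f w} \<subseteq> V" using CV u w(1) mtD(2)[OF f] by blast
  show "V \<subseteq> C \<union> {u, f u, w, f w}"
  proof
    fix z assume z: "z \<in> V"
    show "z \<in> C \<union> {u, f u, w, f w}"
    proof (rule ccontr)
      assume nz: "z \<notin> C \<union> {u, f u, w, f w}"
      then have d: "z \<noteq> u" "z \<noteq> f u" "z \<noteq> w" "z \<noteq> f w" "z \<notin> C" by blast+
      then have d': "f z \<noteq> u" "f z \<noteq> f u" "f z \<noteq> w" "f z \<noteq> f w" using ff by metis+
      obtain c where c: "c \<in> C" using C_ne by blast
      have "near z c \<or> near z (f c)" using near_cover[OF z d(5) c] by blast
      then obtain b where b: "b \<in> C" "near z b" using c C_closed by blast
      then have "near u b \<or> near w b" using near_sides(1)[OF b(1)] by blast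
      then show False using b(2) d d' unfolding near_def by metis
    qed
  qed
qed

lemma near_nbr: "z \<in> C \<Longrightarrow> A (f u) z \<Longrightarrow> near u z" "z \<in> C \<Longrightarrow> A u z \<Longrightarrow> near u z"
   "z \<in> C \<Longrightarrow> A (f w) z \<Longrightarrow> near w z" "z \<in> C \<Longrightarrow> A w z \<Longrightarrow> near w z"
  using near_iff[OF u uC(1)] near_iff[OF w(1) wC(1)] by blast+

text \<open>\<open>x\<close> is near \<open>u\<close> and \<open>y\<close> is near \<open>w\<close>,
  so they lie on opposite sides of the cycle, and \<open>cycle_minus_two\<close> matches what
  remains of \<open>C\<close> once \<open>u\<close> is paired with \<open>w\<close>,
  \<open>f u\<close> with \<open>x\<close> and \<open>f w\<close> with \<open>y\<close>.\<close>

lemma crossing_matching: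
  assumes uw: "A u w" and x: "x \<in> C" "A (f u) x" and y: "y \<in> C" "A (f w) y"
  shows "\<exists>h. mt h \<and> h u = w \<and> h (f u) = x \<and> h (f w) = y"
proof -
  have nx: "near u x" "\<not> near u y" using near_nbr x y near_sides(1) by blast+
  obtain k where k: "matching_on A (C - {x, y}) k"
    using cycle_minus_two[of "near u" x y] near_sides x(1) y(1) nx by blast
  have ne: "f u \<noteq> x" "f w \<noteq> y" "f u \<noteq> y" "f w \<noteq> x" "u \<noteq> x" "u \<noteq> y" "w \<noteq> x" "w \<noteq> y" "x \<noteq> y"
    using uC wC x(1) y(1) nx by blast+
  have 1: "matching_on A (insert (f u) (insert x (C - {x, y}))) (k(f u := x, x := f u))"
    using matching_on_extend[OF k x(2) A_sym[OF x(2)]] uC by blast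
  have 2: "matching_on A (insert (f w) (insert y (insert (f u) (insert x (C - {x, y}))))) (k(f u := x, x := f u, f w := y, y := f w))"
    by (rule matching_on_extend[OF 1 y(2) A_sym[OF y(2)]]) (use wC distinct4 ne in auto)
  have 3: "matching_on A (insert u (insert w (insert (f w) (insert y (insert (f u) (insert x (C - {x, y}))))))) (k(f u := x, x := f u, f w := y, y := f w, u := w, w := u))"
    by (rule matching_on_extend[OF 2 uw A_sym[OF uw]]) (use uC wC distinct4 ne w(3,4) in auto)
  have "insert u (insert w (insert (f w) (insert y (insert (f u) (insert x (C - {x, y})))))) = V"
    using V_eq x(1) y(1) by blast
  then show ?thesis using 3 ne distinct4 w(3,4)
    by (intro exI[of _ "k(f u := x, x := f u, f w := y, y := f w, u := w, w := u)"]) auto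
qed

lemma square_matching:
  assumes uw: "A u w" "A (f u) (f w)" and k: "k = f \<or> k = g"
  shows "\<exists>h. mt h \<and> h u = w \<and> h (f u) = f w \<and> (\<forall>c\<in>C. h c = k c)"
proof -
  let ?k = "\<lambda>x. if x \<in> C then k x else x"
  have kC: "matching_on A C ?k"
    unfolding matching_on_def using k C_closed mtD(1)[OF f] mtD(1)[OF g] CV by auto
  have 1: "matching_on A (insert u (insert w C)) (?k(u := w, w := u))"
    by (rule matching_on_extend[OF kC uw(1) A_sym[OF uw(1)]]) (use uC wC in auto)
  have 2: "matching_on A (insert (f u) (insert (f w) (insert u (insert w C)))) (?k(u := w, w := u, f u := f w, f w := f u))"
    by (rule matching_on_extend[OF 1 uw(2) A_sym[OF uw(2)]]) (use uC wC distinct4 w(3,4) in auto)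
  have "insert (f u) (insert (f w) (insert u (insert w C))) = V" using V_eq by blast
  then show ?thesis using 2 distinct4 w(3,4) uC wC
    by (intro exI[of _ "?k(u := w, w := u, f u := f w, f w := f u)"]) auto
qed

text \<open>If \<open>u\<close> and \<open>w\<close> were adjacent, at least three matchings would contain that edge: send
  the ends \<open>f u\<close> and \<open>f w\<close> to different neighbours and match the rest along the cycle.\<close>

lemma no_cross: "\<not> A u w"
proof
  assume uw: "A u w"
  have uV: "u \<in> V" by (rule u)
  have fu: "A (f u) u" "A u (f u)" "A (f w) w" "A w (f w)" using mtD(1)[OF f] u w(1) A_sym by blast+
  have three: False if "mt h1" "mt h2" "mt h3" "h1 u = w" "h2 u = w" "h3 u = w" "h1 \<noteq> h2" "h1 \<noteq> h3" "h2 \<noteq> h3" for h1 h2 h3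
    using matching_among_two[OF that(1,2,3,7) _ _ u] that by auto
  obtain y1 y2 where y: "{y. A (f u) y} = {u, y1, y2}" "u \<noteq> y1" "u \<noteq> y2" "y1 \<noteq> y2" using two_other_nbrs[OF fu(1)] by blast
  obtain z1 z2 where z: "{y. A (f w) y} = {w, z1, z2}" "w \<noteq> z1" "w \<noteq> z2" "z1 \<noteq> z2" using two_other_nbrs[OF fu(3)] by blast
  have Ay: "A (f u) y1" "A (f u) y2" and Az: "A (f w) z1" "A (f w) z2" using y(1) z(1) by blast+
  have "\<not> A (f u) w" "\<not> A (f w) u" using triangle_free[OF fu(1) uw] triangle_free[OF fu(3) A_sym[OF uw]] by blast+
  then have inC: "p \<in> C \<or> p = f w" if "A (f u) p" "p \<noteq> u" for p
    using that A_in[OF that(1)] V_eq A_irrefl by blast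
  have inC': "p \<in> C \<or> p = f u" if "A (f w) p" "p \<noteq> w" for p
    using that A_in[OF that(1)] V_eq A_irrefl \<open>\<not> A (f w) u\<close> by blast
  show False
  proof (cases "A (f u) (f w)")
    case True
    have "\<exists>p\<in>C. A (f u) p" using inC[OF Ay(1)] inC[OF Ay(2)] y Ay by metis
    then obtain p where p: "p \<in> C" "A (f u) p" by blast
    have "\<exists>p\<in>C. A (f w) p" using inC'[OF Az(1)] inC'[OF Az(2)] z Az by metis
    then obtain q where q: "q \<in> C" "A (f w) q" by blast
    obtain h1 where h1: "mt h1" "h1 u = w" "h1 (f u) = p" using crossing_matching[OF uw p q] by blast
    obtain h2 where h2: "mt h2" "h2 u = w" "h2 (f u) = f w" "\<forall>c\<in>C. h2 c = f c" using square_matching[OF uw True, of f] by blast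
    obtain h3 where h3: "mt h3" "h3 u = w" "h3 (f u) = f w" "\<forall>c\<in>C. h3 c = g c" using square_matching[OF uw True, of g] by blast
    have "p \<noteq> f w" using p wC by blast
    then have "h1 \<noteq> h2" "h1 \<noteq> h3" using h1 h2 h3 by auto
    moreover have "h2 p \<noteq> h3 p" using h2(4) h3(4) p(1) unfolding C_def by simp
    ultimately show False using three[OF h1(1) h2(1) h3(1)] h1 h2 h3 by blast
  next
    case False
    then have "A (f w) p \<Longrightarrow> p \<noteq> f u" for p using A_sym by blast
    \<comment> \<open>Without an edge between \<open>f u\<close> and \<open>f w\<close>, both
      further neighbours of each of them lie on the cycle, and three of the four choices already
      give too many matchings.\<close>
    then have C: "y1 \<in> C" "y2 \<in> C" "z1 \<in> C" "z2 \<in> C" using inC inC' Ay Az y z False by metis+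
    obtain h1 where h1: "mt h1" "h1 u = w" "h1 (f u) = y1" "h1 (f w) = z1" using crossing_matching[OF uw C(1) Ay(1) C(3) Az(1)] by blast
    obtain h2 where h2: "mt h2" "h2 u = w" "h2 (f u) = y2" "h2 (f w) = z1" using crossing_matching[OF uw C(2) Ay(2) C(3) Az(1)] by blast
    obtain h3 where h3: "mt h3" "h3 u = w" "h3 (f u) = y1" "h3 (f w) = z2" using crossing_matching[OF uw C(1) Ay(1) C(4) Az(2)] by blast
    have "h1 \<noteq> h2" "h1 \<noteq> h3" "h2 \<noteq> h3" using h1 h2 h3 y z by auto
    then show False using three[OF h1(1) h2(1) h3(1)] h1 h2 h3 by blast
  qed
qed

text \<open>By \<open>no_cross\<close>, applied to either end of each common edge, no edge joins the
  two common edges. The second matching through a cycle edge from \<open>c\<close> to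
  \<open>f c\<close> then forces the cycle to have length four; only two of its vertices are near
  \<open>u\<close>, and they are attached to different ends of that common edge, which leaves an end
  short of a neighbour.\<close>

lemma contradiction: False
proof -
  have i1: "two_common_edges V A f g (f u) w" by unfold_locales (metis f g fg u fgu w mtD(2)[OF f] distinct4 ff gg)+
  have i2: "two_common_edges V A f g u (f w)" by unfold_locales (metis f g fg u fgu w mtD(2)[OF f] distinct4 ff gg)+
  have i3: "two_common_edges V A f g (f u) (f w)" by unfold_locales (metis f g fg u fgu w mtD(2)[OF f] distinct4 ff gg)+
  have "\<not> A p q" if "p \<in> {u, f u}" "q \<in> {w, f w}" for p q
    using that no_cross two_common_edges.no_cross[OF i1] two_common_edges.no_cross[OF i2] two_common_edges.no_cross[OF i3] by blast
  then have nc: "\<not> A p q" "\<not> A q p" if "p \<in> {u, f u}" "q \<in> {w, f w}" for p q using that A_sym by blast+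
  \<comment> \<open>Two steps along the cycle in the \<open>f\<close> direction move the attachment
    to the other end of the common edge at \<open>u\<close>; two steps in the \<open>g\<close>
    direction keep it at \<open>t c\<close>, unless both walks lead to the same vertex.\<close>
  have alternation: "t (g (f c)) \<noteq> t c \<and> (f (g c) = g (f c) \<or> t (f (g c)) = t c)" if c: "c \<in> C" "near u c" for c
  proof -
    note cl = C_closed[OF c(1)] C_closed[OF C_closed(1)[OF c(1)]] C_closed[OF C_closed(2)[OF c(1)]]
    have n: "\<not> near u (f c)" "\<not> near u (g c)" "near u (g (f c))" "near u (f (g c))" "near w (f c)" "near w (g c)"
      using near_sides c cl by metis+
    \<comment> \<open>\<open>P\<close> is the second matching through the edge from \<open>c\<close>
      to \<open>f c\<close>. Being neither \<open>f\<close> nor \<open>g\<close>, it contains none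
      of the edges off the cycle on which these agree, and each of its edges that is not in
      \<open>f\<close> must meet the four outer neighbours listed in \<open>Dm\<close>.\<close>
    obtain P where P: "mt P" "P \<noteq> f" "P c = f c" using ex_other_matching[OF f CV[OF c(1)]] by blast
    have "P \<noteq> g" using P(3) c(1) unfolding C_def by auto
    then have Pu: "P z \<noteq> f z" if "z \<in> V" "z \<notin> C" for z
      using matching_among_two[OF f g P(1) fg _ _ that(1)] that P(2) unfolding C_def by auto
    have cov: "\<exists>x\<in>{x, P x}. (A c x \<or> A (f c) x) \<and> x \<noteq> c \<and> x \<noteq> f c" if "x \<in> V" "f x \<noteq> P x" for x
      using cover[OF P(1) f CV[OF c(1)] P(3) that(1) that(2)[symmetric]] unfolding P(3) .
    have Dm: "(A c x \<or> A (f c) x) \<and> x \<noteq> c \<and> x \<noteq> f c \<longleftrightarrow> x \<in> {g c, t c, g (f c), t (f c)}" for x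
    proof -
      have "g c \<noteq> f c" "g (f c) \<noteq> c" "g c \<noteq> c" "g (f c) \<noteq> f c"
      proof -
        show "g c \<noteq> f c" using c(1) unfolding C_def by (metis (mono_tags, lifting) mem_Collect_eq)
        then show "g (f c) \<noteq> c" using gg by metis
        show "g c \<noteq> c" "g (f c) \<noteq> f c" using mtD(5)[OF g CV] c(1) cl(1) by blast+
      qed
      moreover have "t c \<noteq> f c" "t (f c) \<noteq> c" using t[OF c(1)] t[OF cl(1)] by auto
      moreover have "t c \<noteq> c" "t (f c) \<noteq> f c" 
        using A_iff[OF c(1), of "t c"] A_iff[OF cl(1), of "t (f c)"] A_irrefl by metis+
      moreover have "A c x \<longleftrightarrow> x = f c \<or> x = g c \<or> x = t c" "A (f c) x \<longleftrightarrow> x = c \<or> x = g (f c) \<or> x = t (f c)"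
        using A_iff[OF c(1)] A_iff[OF cl(1)] by simp_all
      ultimately show ?thesis unfolding insert_iff empty_iff by metis
    qed
    have tc: "t c \<in> {u, f u}" "t (f c) \<in> {w, f w}" using c(2) n(5) unfolding near_def by auto
    \<comment> \<open>\<open>v\<close> and \<open>v'\<close> are the ends of the two common edges to
      which \<open>c\<close> and \<open>f c\<close> are not attached. Neither is among the four
      vertices of \<open>Dm\<close>, so their partners in \<open>P\<close> are.\<close>
    define v where "v = f (t c)"
    define v' where "v' = f (t (f c))"
    have v: "v \<in> {u, f u}" "f v = t c" "v \<noteq> t c" using tc(1) distinct4 unfolding v_def by auto
    have v': "v' \<in> {w, f w}" "f v' = t (f c)" "v' \<noteq> t (f c)" using tc(2) distinct4 unfolding v'_def by auto
    have vV: "v \<in> V" "v \<notin> C" "v' \<in> V" "v' \<notin> C" using v(1) v'(1) uC wC u w(1) mtD(2)[OF f] by auto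
    have tC: "t c \<notin> C" "t (f c) \<notin> C" using tc uC wC by auto
    have att: "t z = y" if "z \<in> C" "y \<notin> C" "A z y" for z y
      using A_iff[OF that(1), of y] C_closed[OF that(1)] that(2,3) by metis
    have "P v = g (f c)"
    proof -
      have "v \<notin> {g c, t c, g (f c), t (f c)}" using v(1,3) vV cl tc(2) distinct4 w(3,4) by auto
      then have "P v \<in> {g c, t c, g (f c), t (f c)}" using cov[OF vV(1)] Pu[OF vV(1,2)] Dm by fastforce
      moreover have "P v \<noteq> t c" using Pu[OF vV(1,2)] v(2) by simp
      moreover have "P v \<noteq> g c"
      proof
        assume "P v = g c"
        then have "A (g c) v" using mtD(1)[OF P(1) vV(1)] A_sym by simp
        then have "t (g c) = v" using att cl vV by blast
        then show False using n(2) v(1) unfolding near_def by auto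
      qed
      moreover have "P v \<noteq> t (f c)" using mtD(1)[OF P(1) vV(1)] nc(1)[OF v(1) tc(2)] by auto
      ultimately show ?thesis by blast
    qed
    then have "A (g (f c)) v" using mtD(1)[OF P(1) vV(1)] A_sym by simp
    then have 1: "t (g (f c)) \<noteq> t c" using att cl vV v(3) by blast
    have Pv': "P v' = g c"
    proof -
      have "v' \<notin> {g c, t c, g (f c), t (f c)}" using v'(1,3) vV cl tc(1) distinct4 w(3,4) by auto
      then have "P v' \<in> {g c, t c, g (f c), t (f c)}" using cov[OF vV(3)] Pu[OF vV(3,4)] Dm by fastforce
      moreover have "P v' \<noteq> t (f c)" using Pu[OF vV(3,4)] v'(2) by simp
      moreover have "P v' \<noteq> g (f c)"
      proof
        assume "P v' = g (f c)"
        then have "A (g (f c)) v'" using mtD(1)[OF P(1) vV(3)] A_sym by simp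
        then have "t (g (f c)) = v'" using att cl vV by blast
        then have "near w (g (f c))" using v'(1) unfolding near_def by auto
        then show False using n(3) near_sides(1) cl by blast
      qed
      moreover have "P v' \<noteq> t c" using mtD(1)[OF P(1) vV(3)] nc(2)[OF tc(1) v'(1)] by auto
      ultimately show ?thesis by blast
    qed
    \<comment> \<open>The vertex two steps from \<open>c\<close> in the \<open>g\<close> direction.
      Its partner is not \<open>g c\<close>, which \<open>P\<close> gives to \<open>v'\<close>, and
      of the remaining ways to meet the four neighbours only the two claimed alternatives
      survive.\<close>
    let ?x = "f (g c)"
    have "P ?x \<noteq> g c"
    proof
      assume "P ?x = g c"
      then have "?x = v'" using Pv' matching_on_inj[OF P(1)] by metis
      then show False using vV cl by blast
    qed
    then have "?x \<in> {g c, t c, g (f c), t (f c)} \<or> P ?x \<in> {g c, t c, g (f c), t (f c)}"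
      using cov[OF CV[OF cl(5)]] Dm by fastforce
    moreover have "?x \<noteq> g c" "?x \<noteq> t c" "?x \<noteq> t (f c)" using mtD(5)[OF f CV[OF cl(2)]] tC cl by auto
    moreover have "P ?x \<noteq> g (f c)"
    proof
      assume "P ?x = g (f c)"
      then have "A ?x (g (f c))" using mtD(1)[OF P(1) CV[OF cl(5)]] by simp
      then have "g (f c) = f ?x \<or> g (f c) = g ?x \<or> g (f c) = t ?x" using A_iff[OF cl(5)] by blast
      moreover have "g (f c) \<noteq> f ?x" "g (f c) \<noteq> g ?x" using near_sides(2,3)[OF cl(5)] n(3,4) by metis+
      moreover have "t ?x \<notin> C" using n(4) uC unfolding near_def by auto
      ultimately show False using cl by metis
    qed
    moreover have "P ?x \<noteq> t (f c)"
    proof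
      assume "P ?x = t (f c)"
      then have "A ?x (t (f c))" using mtD(1)[OF P(1) CV[OF cl(5)]] by simp
      then have "t ?x = t (f c)" using att[OF cl(5) tC(2)] by blast
      then show False using n(4) tc(2) distinct4 w(3,4) unfolding near_def by auto
    qed
    moreover have "t ?x = t c" if "P ?x = t c"
    proof -
      have "A ?x (t c)" using mtD(1)[OF P(1) CV[OF cl(5)]] that by simp
      then show ?thesis using att[OF cl(5) tC(1)] by blast
    qed
    ultimately have "f (g c) = g (f c) \<or> t (f (g c)) = t c" using \<open>P ?x \<noteq> g c\<close> by blast
    then show ?thesis using 1 by blast
  qed
  obtain c where c: "c \<in> C" "near u c" using C_ne near_sides(2) C_closed by blast
  define c2 where "c2 = g (f c)"
  have c2: "c2 \<in> C" "near u c2" unfolding c2_def using c C_closed near_sides by metis+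
  have tne: "t c2 \<noteq> t c" using alternation[OF c] unfolding c2_def by blast
  have "f (g c2) = c" unfolding c2_def by simp
  \<comment> \<open>This is \<open>alternation\<close> at \<open>c2\<close>, whose walk in the
    \<open>g\<close> direction leads back to \<open>c\<close>: the attachments of \<open>c\<close>
    and \<open>c2\<close> differ, so both walks from \<open>c2\<close> end at
    \<open>c\<close>.\<close>
  then have cyc: "g (f c2) = c" using alternation[OF c2] tne by metis
  then have gc: "g c = f c2" using gg by metis
  have gc2: "g c2 = f c" unfolding c2_def by simp
  have gf: "g (f c) = c2" "g (f c2) = c" using cyc c2_def by simp_all
  have "{c, f c, c2, f c2} = C"
  proof (rule single_orbit)
    show "{c, f c, c2, f c2} \<subseteq> C" using c c2 C_closed by blast
    show "f x \<in> {c, f c, c2, f c2}" if "x \<in> {c, f c, c2, f c2}" for x using that by auto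
    show "g x \<in> {c, f c, c2, f c2}" if "x \<in> {c, f c, c2, f c2}" for x using that gc gc2 gf by auto
  qed simp
  then have only: "x = c \<or> x = c2" if "x \<in> C" "near u x" for x
    using that near_sides(2)[OF c(1)] near_sides(2)[OF c2(1)] c(2) c2(2) by blast
  define v where "v = t c"
  have v: "v \<in> {u, f u}" using c(2) unfolding near_def v_def by auto
  then have vV: "v \<in> V" using u mtD(2)[OF f] by auto
  obtain y1 y2 where y: "{y. A v y} = {f v, y1, y2}" "f v \<noteq> y1" "f v \<noteq> y2" "y1 \<noteq> y2" using two_other_nbrs[OF mtD(1)[OF f vV]] by blast
  \<comment> \<open>A neighbour of \<open>v\<close> other than \<open>f v\<close> lies on
    \<open>C\<close> and is near \<open>u\<close>, so it is \<open>c\<close> or \<open>c2\<close>;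
    but \<open>c2\<close> is attached to the other end.\<close>
  have "y = c" if y: "A v y" "y \<noteq> f v" for y
  proof -
    have "y \<noteq> v" using y(1) A_irrefl by blast
    moreover have "y \<notin> {w, f w}" using nc(1)[OF v] y(1) by blast
    moreover have "{u, f u} = {v, f v}" using v by auto
    ultimately have yC: "y \<in> C" using A_in[OF y(1)] y(2) V_eq by blast
    have "v \<notin> C" using v uC by blast
    then have "t y = v" using A_iff[OF yC, of v] C_closed[OF yC] A_sym[OF y(1)] by metis
    then have "near u y" using v unfolding near_def by blast
    then show ?thesis using only[OF yC] tne \<open>t y = v\<close> unfolding v_def by metis
  qed
  then have "y1 = c" "y2 = c" using y by blast+
  then show False using y(4) by simp
qed

end

section \<open>Counting the perfect matchings of the cubic graph\<close>

context cubic_matchings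
begin

lemma common_vertices:
  assumes "mt f" "mt g" "f \<noteq> g" "u \<in> V" "f u = g u"
  shows "{x \<in> V. f x = g x} = {u, f u}"
proof -
  interpret common_edge V A f g u using assms by unfold_locales
  have "x \<in> {u, f u}" if x: "x \<in> V" "f x = g x" for x
  proof (rule ccontr)
    assume n: "x \<notin> {u, f u}"
    interpret two_common_edges V A f g u x by unfold_locales (use x n in auto)
    show False by (rule contradiction)
  qed
  moreover have "f u \<in> V" "f (f u) = g (f u)" using mtD(2)[OF f u] ff gg fgu by metis+
  ultimately show ?thesis using u fgu by blast
qed

lemma finite_mt: "finite {f. mt f}" and card_mt: "V \<noteq> {} \<Longrightarrow> card {f. mt f} = 6"
proof -
  have fin_xy: "finite {f. mt f \<and> f x = y}" if "A x y" for x y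
    using two[OF that] by (intro card_ge_0_finite) simp
  have "finite {f. mt f} \<and> card {f. mt f} = 6" if V: "V \<noteq> {}"
  proof -
    obtain x where x: "x \<in> V" using V by blast
    have N: "finite {y. A x y}" "card {y. A x y} = 3" using deg[OF x] by (auto intro: card_ge_0_finite)
    have e: "{f. mt f} = (\<Union>y\<in>{y. A x y}. {f. mt f \<and> f x = y})" using mtD(1)[OF _ x] by blast
    have "card {f. mt f} = (\<Sum>y\<in>{y. A x y}. card {f. mt f \<and> f x = y})"
      unfolding e by (rule card_UN_disjoint) (use N fin_xy in auto)
    also have "\<dots> = 6" using two N by simp
    finally show ?thesis unfolding e using N fin_xy by auto
  qed
  moreover have "finite {f. mt f}" if "V = {}"
  proof -
    have "{f. mt f} \<subseteq> {\<lambda>x. x}" using that unfolding matching_on_def by auto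
    then show ?thesis using finite_subset by blast
  qed
  ultimately show "finite {f. mt f}" "V \<noteq> {} \<Longrightarrow> card {f. mt f} = 6" by blast+
qed

lemma card_common: "mt f \<Longrightarrow> mt g \<Longrightarrow> f \<noteq> g \<Longrightarrow> card {x \<in> V. f x = g x} \<le> 2"
proof -
  assume a: "mt f" "mt g" "f \<noteq> g"
  show ?thesis
  proof (cases "{x \<in> V. f x = g x} = {}")
    case True
    show ?thesis unfolding True by simp
  next
    case False
    then obtain u where "u \<in> V" "f u = g u" by blast
    then have "{x \<in> V. f x = g x} = {u, f u}" using common_vertices a by blast
    then show ?thesis by (simp add: card_insert_if)
  qed
qed

lemma common_cover: "mt f \<Longrightarrow> V = (\<Union>g\<in>{g. mt g} - {f}. {x \<in> V. f x = g x})"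
  using ex_other_matching by fastforce

text \<open>Every edge of \<open>f\<close> lies in a second matching. This is neither
  \<open>g\<close> nor the complementary matching \<open>h\<close>, both being disjoint from
  \<open>f\<close>, so it is one of three others, each agreeing with \<open>f\<close> on at most two
  vertices.\<close>

lemma disjoint_card:
  assumes f: "mt f" and g: "mt g" and d: "\<And>x. x \<in> V \<Longrightarrow> f x \<noteq> g x"
  shows "card V \<le> 6"
proof (cases "V = {}")
  case False
  have "\<exists>t. x \<in> V \<longrightarrow> {y. A x y} = {f x, g x, t} \<and> t \<noteq> f x \<and> t \<noteq> g x" for x
    using third_nbr[of x "f x" "g x"] mtD(1)[OF f] mtD(1)[OF g] d by blast
  then obtain t where t: "\<And>x. x \<in> V \<Longrightarrow> {y. A x y} = {f x, g x, t x}" "\<And>x. x \<in> V \<Longrightarrow> t x \<noteq> f x" "\<And>x. x \<in> V \<Longrightarrow> t x \<noteq> g x"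
    by metis
  \<comment> \<open>the complement of two disjoint perfect matchings is a third one\<close>
  define h where "h x = (if x \<in> V then t x else x)" for x
  have "mt h" unfolding matching_on_def
  proof (intro conjI ballI allI impI)
    fix x assume x: "x \<in> V"
    show A: "A x (h x)" using t(1)[OF x] x unfolding h_def by auto
    then show tV: "h x \<in> V" using A_in by blast
    have "x \<in> {f (h x), g (h x), t (h x)}" using t(1)[OF tV] A_sym[OF A] by blast
    moreover have "x \<noteq> f (h x)" "x \<noteq> g (h x)" using t(2,3)[OF x] x mtD(3)[OF f] mtD(3)[OF g] unfolding h_def by metis+
    ultimately show "h (h x) = x" using tV unfolding h_def[of "h x"] by simp
  qed (simp add: h_def)
  have hd: "h x \<noteq> f x" "h x \<noteq> g x" if "x \<in> V" for x using t(2,3)[OF that] that unfolding h_def by simp_all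
  have ne: "f \<noteq> g" "f \<noteq> h" "g \<noteq> h" using False d hd by blast+
  let ?R = "{k. mt k} - {f, g, h}"
  have "card ?R = 3" using card_mt[OF False] finite_mt ne f g \<open>mt h\<close> by (subst card_Diff_subset) auto
  have "x \<in> (\<Union>k\<in>?R. {x \<in> V. f x = k x})" if x: "x \<in> V" for x
  proof -
    obtain k where k: "mt k" "k \<noteq> f" "k x = f x" using ex_other_matching[OF f x] by blast
    moreover have "k \<noteq> g" "k \<noteq> h" using k(3) d[OF x] hd[OF x] by auto
    ultimately have "k \<in> ?R" "x \<in> {x \<in> V. f x = k x}" using x by simp_all
    then show ?thesis by blast
  qed
  then have "V \<subseteq> (\<Union>k\<in>?R. {x \<in> V. f x = k x})" by blast
  then have "card V \<le> card (\<Union>k\<in>?R. {x \<in> V. f x = k x})" using fin finite_mt by (intro card_mono) auto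
  also have "\<dots> \<le> (\<Sum>k\<in>?R. card {x \<in> V. f x = k x})" using finite_mt by (intro card_UN_le) auto
  also have "\<dots> \<le> (\<Sum>k\<in>?R. 2)" using card_common[OF f] by (intro sum_mono) auto
  finally show ?thesis using \<open>card ?R = 3\<close> by simp
qed simp

text \<open>Above six vertices no matching is disjoint from \<open>f\<close>, so each of the five
  others agrees with \<open>f\<close> on exactly the two ends of one edge. These edges are
  different, since an edge lies in only two matchings, and they exhaust \<open>f\<close>.\<close>

lemma card_10:
  assumes big: "card V > 6"
  shows "card V = 10"
proof -
  have ne: "V \<noteq> {}" using big by auto
  then obtain x where x: "x \<in> V" by blast
  then have "{y. A x y} \<noteq> {}" using deg[OF x] by (metis card.empty zero_neq_numeral)
  then obtain f where f: "mt f" using mt_ex by blast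
  let ?R = "{g. mt g} - {f}"
  have R: "finite ?R" "card ?R = 5" using card_mt[OF ne] finite_mt f by auto
  have c2: "card {x \<in> V. f x = g x} = 2" if g: "g \<in> ?R" for g
  proof -
    obtain u where u: "u \<in> V" "f u = g u" using disjoint_card[OF f, of g] g big by fastforce
    then have "{x \<in> V. f x = g x} = {u, f u}" using common_vertices f g by blast
    then show ?thesis using mtD(5)[OF f u(1)] by (simp add: card_insert_if)
  qed
  have "card V = card (\<Union>g\<in>?R. {x \<in> V. f x = g x})" using common_cover[OF f] by simp
  also have "\<dots> = (\<Sum>g\<in>?R. card {x \<in> V. f x = g x})"
  proof (rule card_UN_disjoint)
    show "\<forall>g\<in>?R. \<forall>h\<in>?R. g \<noteq> h \<longrightarrow> {x \<in> V. f x = g x} \<inter> {x \<in> V. f x = h x} = {}"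
      using matching_among_two[OF f] by blast
  qed (use R fin in auto)
  also have "\<dots> = 10" using c2 R by simp
  finally show ?thesis .
qed

section \<open>Recognising the Petersen graph\<close>

lemma matching_of_pairs:
  assumes "distinct (map fst ps @ map snd ps)" "\<forall>(a, b)\<in>set ps. A a b"
  shows "\<exists>h. matching_on A (set (map fst ps) \<union> set (map snd ps)) h \<and> (\<forall>(a, b)\<in>set ps. h a = b)"
  using assms
proof (induction ps)
  case Nil
  show ?case by (intro exI[of _ "\<lambda>x. x"]) (simp add: matching_on_def)
next
  case (Cons p ps)
  obtain a b where p: "p = (a, b)" by fastforce
  let ?S = "set (map fst ps) \<union> set (map snd ps)"
  obtain h where h: "matching_on A ?S h" "\<forall>(a, b)\<in>set ps. h a = b" using Cons by auto
  have ab: "A a b" "a \<notin> ?S" "b \<notin> ?S" "a \<noteq> b" using Cons.prems p by auto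
  have "matching_on A (insert a (insert b ?S)) (h(a := b, b := a))"
    using matching_on_extend[OF h(1) ab(1) A_sym[OF ab(1)] ab(2,3)] .
  moreover have "insert a (insert b ?S) = set (map fst (p # ps)) \<union> set (map snd (p # ps))" using p by auto
  moreover have "\<forall>(c, e)\<in>set (p # ps). (h(a := b, b := a)) c = e"
  proof -
    have "c \<noteq> a \<and> c \<noteq> b \<and> h c = e" if ce: "(c, e) \<in> set ps" for c e
    proof -
      have "c \<in> ?S" using ce by force
      moreover have "h c = e" using h(2) ce by auto
      ultimately show ?thesis using ab(2,3) by metis
    qed
    then show ?thesis using p ab(4) by auto
  qed
  ultimately show ?case by (intro exI[of _ "h(a := b, b := a)"]) (simp only: simp_thms)
qed

text \<open>A refutation device: two explicitly listed matchings that are different and yet have two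
  common edges contradict \<open>common_vertices\<close>.\<close>

lemma no_two_common_pairs:
  assumes d: "distinct (map fst ps @ map snd ps)" "\<forall>(a, b)\<in>set ps. A a b" "set (map fst ps) \<union> set (map snd ps) = V"
    and e: "distinct (map fst qs @ map snd qs)" "\<forall>(a, b)\<in>set qs. A a b" "set (map fst qs) \<union> set (map snd qs) = V"
    and c: "(x, y) \<in> set ps \<inter> set qs" "(z, w) \<in> set ps \<inter> set qs" "z \<noteq> x" "z \<noteq> y"
    and ne: "(a, b) \<in> set ps" "(a, b') \<in> set qs" "b \<noteq> b'"
  shows False
proof -
  obtain f where f: "mt f" "\<forall>(a, b)\<in>set ps. f a = b" using matching_of_pairs[OF d(1,2)] d(3) by auto
  obtain g where g: "mt g" "\<forall>(a, b)\<in>set qs. g a = b" using matching_of_pairs[OF e(1,2)] e(3) by auto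
  have "f \<noteq> g" using f(2) g(2) ne by auto
  moreover have "f x = y" "g x = y" "f z = g z" using f(2) g(2) c(1,2) by auto
  moreover have "x \<in> V" "z \<in> V" using c(1,2) d(3) by force+
  ultimately have "z \<in> {x, y}" using common_vertices[OF f(1) g(1), of x] by auto
  then show False using c(3,4) by blast
qed

text \<open>Two matchings sharing an edge \<open>uv\<close> alternate along an 8-cycle through the
  other vertices, whose even vertices are the remaining neighbours of \<open>u\<close> and
  \<open>v\<close>. Triangle-freeness leaves only antipodal chords between the odd ones, and the
  position of the second cycle neighbour of \<open>u\<close> is settled by exhibiting forbidden
  pairs of matchings.\<close>

theorem petersen_vertices:
  assumes big: "card V > 6"
  obtains c0 c1 c2 c3 c4 c5 c6 c7 u v where
    "distinct [c0, c1, c2, c3, c4, c5, c6, c7, u, v]" "set [c0, c1, c2, c3, c4, c5, c6, c7, u, v] = V"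
    "A c0 c1" "A c1 c2" "A c2 c3" "A c3 c4" "A c4 c5" "A c5 c6" "A c6 c7" "A c7 c0" "A c1 c5" "A c3 c7"
    "A u v" "A u c0" "A u c4" "A v c2" "A v c6"
proof -
  have V10: "card V = 10" using card_10 big by blast
  then obtain u where u: "u \<in> V" by fastforce
  have "{y. A u y} \<noteq> {}" using deg[OF u] by (metis card.empty zero_neq_numeral)
  then obtain f where f: "mt f" using mt_ex by blast
  obtain g where g': "mt g" "g \<noteq> f" "g u = f u" using ex_other_matching[OF f u] by blast
  note g = g'(1) g'(2)[symmetric] g'(3)[symmetric]
  interpret common_edge V A f g u by unfold_locales (fact f g u)+
  have "{x \<in> V. f x = g x} = {u, f u}" by (rule common_vertices[OF f g fg u fgu])
  then have CVu: "C = V - {u, f u}" unfolding C_def by blast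
  define v where "v = f u"
  have v: "v \<in> V" "v \<noteq> u" "A u v" "A v u" using mtD[OF f] u A_sym unfolding v_def by blast+
  have fv: "f v = u" unfolding v_def by simp
  have C8: "card C = 8" using CVu u v V10 fin unfolding v_def[symmetric] by (simp add: card_Diff_subset)
  have finC: "finite C" using C8 by (intro card_ge_0_finite) simp
  obtain p1 p2 where p: "{y. A u y} = {v, p1, p2}" "v \<noteq> p1" "v \<noteq> p2" "p1 \<noteq> p2" using two_other_nbrs[OF v(3)] by blast
  obtain q1 q2 where q: "{y. A v y} = {u, q1, q2}" "u \<noteq> q1" "u \<noteq> q2" "q1 \<noteq> q2" using two_other_nbrs[OF v(4)] by blast
  have Ap: "A u p1" "A u p2" "A v q1" "A v q2" using p(1) q(1) by blast+
  have tri: "\<not> (A u z \<and> A v z)" for z using triangle_free[OF v(3)] by blast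
  have pqne: "p1 \<noteq> q1" "p1 \<noteq> q2" "p2 \<noteq> q1" "p2 \<noteq> q2" using tri Ap by blast+
  have inC: "p1 \<in> C" "p2 \<in> C" "q1 \<in> C" "q2 \<in> C"
    using Ap A_in A_irrefl p q unfolding CVu v_def[symmetric] by blast+
  have Ceq: "z \<in> C \<longleftrightarrow> z \<in> V \<and> z \<noteq> u \<and> z \<noteq> v" for z unfolding CVu v_def by blast
  define D where "D = {p1, p2, q1, q2}"
  have D4: "card D = 4" "D \<subseteq> C" "finite D" unfolding D_def using p q pqne inC by auto
  have Dn: "near u c \<longleftrightarrow> c \<in> D" if c: "c \<in> C" for c
  proof -
    have "c \<noteq> u" "c \<noteq> v" using c Ceq by blast+
    then have "A u c \<or> A v c \<longleftrightarrow> c \<in> D" using p(1) q(1) unfolding D_def by blast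
    then show ?thesis using near_iff[OF u uC(1) c] unfolding v_def by blast
  qed
  \<comment> \<open>Each cycle edge has an end in \<open>D\<close>, so \<open>k\<close> maps the
    four vertices outside \<open>D\<close> injectively into the four vertices of \<open>D\<close>;
    hence \<open>k\<close> exchanges the two halves.\<close>
  have alt: "k c \<in> D \<longleftrightarrow> c \<notin> D" if c: "c \<in> C" and k: "k = f \<or> k = g" for c k
  proof -
    have kC: "k x \<in> C" "k (k x) = x" if "x \<in> C" for x using k that C_closed by auto
    have sub: "k ` (C - D) \<subseteq> D"
    proof
      fix y assume "y \<in> k ` (C - D)"
      then obtain x where x: "x \<in> C" "x \<notin> D" "y = k x" by blast
      then have "near u (k x)" using near_cover[OF u uC(1) x(1)] Dn[OF x(1)] k by auto
      then show "y \<in> D" using Dn kC x by blast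
    qed
    have "inj_on k (C - D)" using kC(2) by (intro inj_on_inverseI[of _ k]) blast
    then have "card (k ` (C - D)) = 4" using D4 C8 by (simp add: card_image card_Diff_subset)
    then have eq: "k ` (C - D) = D" using sub D4 by (simp add: card_subset_eq)
    show ?thesis
    proof
      assume "k c \<in> D"
      then obtain b where b: "b \<in> C" "b \<notin> D" "k c = k b" using eq by blast
      then have "c = b" using kC(2) c by metis
      then show "c \<notin> D" using b by simp
    next
      assume "c \<notin> D"
      then show "k c \<in> D" using sub c by blast
    qed
  qed
  have altf: "f c \<in> D \<longleftrightarrow> c \<notin> D" and altg: "g c \<in> D \<longleftrightarrow> c \<notin> D" if "c \<in> C" for c using alt[OF that] by blast+
  have fgne: "f c \<noteq> g c" if "c \<in> C" for c using that unfolding C_def by blast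
  define c0 where "c0 = p1"
  define c1 where "c1 = f c0"
  define c2 where "c2 = g c1"
  define c3 where "c3 = f c2"
  define c4 where "c4 = g c3"
  define c5 where "c5 = f c4"
  define c6 where "c6 = g c5"
  define c7 where "c7 = f c6"
  note cdefs = c1_def c2_def c3_def c4_def c5_def c6_def c7_def
  have cC: "c0 \<in> C" "c1 \<in> C" "c2 \<in> C" "c3 \<in> C" "c4 \<in> C" "c5 \<in> C" "c6 \<in> C" "c7 \<in> C"
    unfolding cdefs c0_def by (simp_all add: inC C_closed)
  have ev: "c0 \<in> D" "c2 \<in> D" "c4 \<in> D" "c6 \<in> D" and od: "c1 \<notin> D" "c3 \<notin> D" "c5 \<notin> D" "c7 \<notin> D"
  proof -
    show 0: "c0 \<in> D" unfolding c0_def D_def by blast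
    show 1: "c1 \<notin> D" using 0 altf[OF cC(1)] unfolding c1_def by blast
    show 2: "c2 \<in> D" using 1 altg[OF cC(2)] unfolding c2_def by blast
    show 3: "c3 \<notin> D" using 2 altf[OF cC(3)] unfolding c3_def by blast
    show 4: "c4 \<in> D" using 3 altg[OF cC(4)] unfolding c4_def by blast
    show 5: "c5 \<notin> D" using 4 altf[OF cC(5)] unfolding c5_def by blast
    show 6: "c6 \<in> D" using 5 altg[OF cC(6)] unfolding c6_def by blast
    show 7: "c7 \<notin> D" using 6 altf[OF cC(7)] unfolding c7_def by blast
  qed
  have fs: "f c0 = c1" "f c1 = c0" "f c2 = c3" "f c3 = c2" "f c4 = c5" "f c5 = c4" "f c6 = c7" "f c7 = c6"
    "g c1 = c2" "g c2 = c1" "g c3 = c4" "g c4 = c3" "g c5 = c6" "g c6 = c5" unfolding cdefs by simp_all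
  have orbit: "S = C" if "S \<subseteq> C" "S \<noteq> {}" "\<And>x. x \<in> S \<Longrightarrow> f x \<in> S" "\<And>x. x \<in> S \<Longrightarrow> g x \<in> S" for S
    using single_orbit that by blast
  have n02: "c0 \<noteq> c2" and n24: "c2 \<noteq> c4" and n46: "c4 \<noteq> c6"
    using fgne[OF cC(2)] fgne[OF cC(4)] fgne[OF cC(6)] fs by metis+
  \<comment> \<open>If the walk closed after four steps, its vertices would form a proper part of
    \<open>C\<close> closed under \<open>f\<close> and \<open>g\<close>, against
    \<open>single_orbit\<close>.\<close>
  have n04: "c0 \<noteq> c4"
  proof
    assume e: "c0 = c4"
    then have g0: "g c0 = c3" "g c3 = c0" using fs by metis+
    have "set [c0, c1, c2, c3] = C"
    proof (rule orbit)
      show "f x \<in> set [c0, c1, c2, c3]" if "x \<in> set [c0, c1, c2, c3]" for x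
        using that by (auto simp: fs(1-4))
      show "g x \<in> set [c0, c1, c2, c3]" if "x \<in> set [c0, c1, c2, c3]" for x
        using that by (auto simp: g0 fs(9-10))
    qed (use cC in simp_all)
    then have "card C \<le> length [c0, c1, c2, c3]" by (metis card_length)
    then show False using C8 by simp
  qed
  have g_inj: "x = y" if "g x = g y" for x y using that by simp
  have f_inj: "x = y" if "f x = f y" for x y using that by simp
  have n26: "c2 \<noteq> c6"
  proof
    assume "c2 = c6"
    then have "c1 = c5" using fs by metis
    then show False using n04 fs by metis
  qed
  have n06: "c0 \<noteq> c6"
  proof
    assume e: "c0 = c6"
    then have g0: "g c0 = c5" "g c5 = c0" using fs by metis+
    have "set [c0, c1, c2, c3, c4, c5] = C"
    proof (rule orbit)
      show "f x \<in> set [c0, c1, c2, c3, c4, c5]" if "x \<in> set [c0, c1, c2, c3, c4, c5]" for x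
        using that by (auto simp: fs(1-6))
      show "g x \<in> set [c0, c1, c2, c3, c4, c5]" if "x \<in> set [c0, c1, c2, c3, c4, c5]" for x
        using that by (auto simp: g0 fs(9-12))
    qed (use cC in simp_all)
    then have "card C \<le> length [c0, c1, c2, c3, c4, c5]" by (metis card_length)
    then show False using C8 by simp
  qed
  have "card {c0, c2, c4, c6} = 4" using n02 n24 n46 n04 n26 n06 by simp
  then have Dev: "D = {c0, c2, c4, c6}" using ev D4 by (intro card_subset_eq[symmetric]) auto
  have "g c7 \<in> D" using altg[OF cC(8)] od by blast
  moreover have "g c7 \<noteq> c2"
  proof
    assume "g c7 = c2"
    then have "c7 = c1" using fs g_inj by metis
    then show False using n06 fs f_inj by metis
  qed
  moreover have "g c7 \<noteq> c4"
  proof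
    assume "g c7 = c4"
    then have "c7 = c3" using fs g_inj by metis
    then show False using n26 fs f_inj by metis
  qed
  moreover have "g c7 \<noteq> c6"
  proof
    assume "g c7 = c6"
    then have "c7 = c5" using fs g_inj by metis
    then show False using n46 fs f_inj by metis
  qed
  ultimately have g7: "g c7 = c0" unfolding Dev by blast
  have no: "c1 \<noteq> c3" "c1 \<noteq> c5" "c1 \<noteq> c7" "c3 \<noteq> c5" "c3 \<noteq> c7" "c5 \<noteq> c7"
    using n02 n24 n46 n04 n26 n06 fs f_inj by metis+
  have mix: "x \<noteq> y" if "x \<in> D" "y \<notin> D" for x y using that by blast
  have dist8: "distinct [c0, c1, c2, c3, c4, c5, c6, c7]"
    using n02 n24 n46 n04 n26 n06 no mix[OF ev(1)] mix[OF ev(2)] mix[OF ev(3)] mix[OF ev(4)] od by (simp, metis)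
  have "card (set [c0, c1, c2, c3, c4, c5, c6, c7]) = 8" using distinct_card[OF dist8] by simp
  then have C_set: "C = {c0, c1, c2, c3, c4, c5, c6, c7}" using cC C8 finC by (intro card_subset_eq[symmetric]) auto
  have dist: "distinct [c0, c1, c2, c3, c4, c5, c6, c7, u, v]"
    using dist8 cC Ceq v(2) by auto
  have Vset: "set [c0, c1, c2, c3, c4, c5, c6, c7, u, v] = V"
    using C_set Ceq u v by auto
  have A: "A c0 c1" "A c1 c2" "A c2 c3" "A c3 c4" "A c4 c5" "A c5 c6" "A c6 c7" "A c7 c0"
    using mtD(1)[OF f CV] mtD(1)[OF g CV] cC fs g7 by metis+
  \<comment> \<open>The third edge of a vertex of \<open>D\<close> ends at \<open>u\<close> or
    \<open>v\<close>, so the third edge of an odd vertex must end at another odd vertex.\<close>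
  have third: "t c \<in> {c1, c3, c5, c7} \<and> A c (t c) \<and> t c \<noteq> c" if c: "c \<in> C" "c \<notin> D" for c
  proof -
    have tA: "A c (t c)" using A_iff[OF c(1)] by blast
    have "\<not> near u c" using Dn c by blast
    then have "t c \<noteq> u" "t c \<noteq> v" unfolding near_def v_def by auto
    then have tC: "t c \<in> C" using A_in[OF tA] Ceq by blast
    have "t c \<notin> D"
    proof
      assume "t c \<in> D"
      then have "near u (t c)" using Dn tC by blast
      then have "t (t c) \<notin> C" using uC unfolding near_def by auto
      then have "c = f (t c) \<or> c = g (t c)" using A_iff[OF tC, of c] A_sym[OF tA] c(1) by metis
      then have "t c = f c \<or> t c = g c" using ff gg by metis
      then show False using t[OF c(1)] by blast
    qed
    then have "t c \<in> {c1, c3, c5, c7}" using tC ev unfolding C_set insert_iff empty_iff by metis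
    then show ?thesis using tA A_irrefl by metis
  qed
  have "\<not> A c1 c3" "\<not> A c1 c7" "\<not> A c3 c5" using triangle_free A A_sym by blast+
  then have A15: "A c1 c5" and "t c3 \<in> {c7}" using third[OF cC(2) od(1)] third[OF cC(4) od(2)] A_sym by auto
  then have A37: "A c3 c7" using third[OF cC(4) od(2)] by auto
  note sA = A_sym[OF A(1)] A_sym[OF A(2)] A_sym[OF A(3)] A_sym[OF A(4)] A_sym[OF A(5)] A_sym[OF A(6)] A_sym[OF A(7)] A_sym[OF A(8)]
  have VD: "A v z" if "z \<in> D" "z \<noteq> p1" "z \<noteq> p2" for z using that Ap unfolding D_def by blast
  have "p2 \<in> D" unfolding D_def by simp
  then have "p2 \<in> {c2, c4, c6}" using p(4) unfolding Dev c0_def by simp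
  \<comment> \<open>If the neighbours \<open>c0\<close> and \<open>p2\<close> of \<open>u\<close>
    are at distance two on the cycle, they form a 4-cycle with \<open>u\<close> and the vertex
    between them; switching it yields two matchings with three common edges.\<close>
  then consider "p2 = c2" | "p2 = c6" | "p2 = c4" by blast
  then show thesis
  proof cases
    case 1
    have "A v c4" by (rule VD) (use ev n04 n24 1 c0_def in auto)
    then have False using dist Vset A sA A37 Ap(1,2) 1 c0_def
      by (intro no_two_common_pairs[of "[(u, c0), (c1, c2), (v, c4), (c3, c7), (c5, c6)]"
          "[(u, c2), (c1, c0), (v, c4), (c3, c7), (c5, c6)]" v c4 c3 c7 u c0 c2]) auto
    then show ?thesis ..
  next
    case 2
    have "A v c2" by (rule VD) (use ev n02 n26 2 c0_def in auto)
    then have False using dist Vset A sA A15 Ap(1,2) 2 c0_def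
      by (intro no_two_common_pairs[of "[(u, c0), (c7, c6), (v, c2), (c1, c5), (c3, c4)]"
          "[(u, c6), (c7, c0), (v, c2), (c1, c5), (c3, c4)]" v c2 c1 c5 u c0 c6]) auto
    then show ?thesis ..
  next
    case 3
    have "A v c2" "A v c6" by (rule VD; use ev n02 n24 n46 n06 3 c0_def in auto)+
    then show ?thesis using that[OF dist Vset A A15 A37 v(3)] Ap 3 c0_def by blast
  qed
qed

end

section \<open>Bricks with more than four vertices\<close>

context brick_B
begin

definition A :: "'v \<Rightarrow> 'v \<Rightarrow> bool" where
  "A x y \<longleftrightarrow> (\<exists>e\<in>E. d e = {x, y})"

definition mfun :: "'e set \<Rightarrow> 'v \<Rightarrow> 'v" where
  "mfun M x = (if x \<in> V then mate G M x else x)"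

lemma A_sym: "A x y \<Longrightarrow> A y x"
  unfolding A_def by (simp add: insert_commute)

lemma A_props: "A x y \<Longrightarrow> x \<in> V \<and> y \<in> V \<and> x \<noteq> y"
proof -
  assume "A x y"
  then obtain e where e: "e \<in> E" "d e = {x, y}" unfolding A_def by blast
  then show ?thesis using edge_ends[OF G e(1)] by (metis doubleton_eq_iff)
qed

lemma not_bipartite: "X \<subseteq> V \<Longrightarrow> E \<noteq> cut G X"
  using brick unfolding brick_def bipartite_def by blast

lemma card_E: "r * card V = 2 * card E"
proof -
  have "cut G V = {}" using cut_complement[OF G, of "{}"] unfolding cut_def by simp
  moreover have "{e \<in> E. d e \<subseteq> V} = E" using G unfolding graph_def by blast
  ultimately show ?thesis using degree_sum_r[of V] by simp
qed

end

locale large_brick_B = brick_B +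
  assumes large: "card V > 4"
begin

lemma two_PM: "e \<in> E \<Longrightarrow> card {M \<in> PM. e \<in> M} = 2"
proof -
  assume e: "e \<in> E"
  have "\<not> matching_edge 1 G e" using matching_edge_1_card[of e] large by linarith
  then show ?thesis using edge_12[OF e] unfolding matching_edge_iff by blast
qed

text \<open>Any edge lies in two different matchings, and no perfect matching properly contains
  another, so some \<open>f\<close> separates them and \<open>degree_two_vertex\<close> yields
  multiplicity 1.\<close>

lemma simple: "inj_on d E"
proof (rule inj_onI)
  fix e e' assume e: "e \<in> E" "e' \<in> E" "d e = d e'"
  obtain M N where MN: "{M \<in> PM. e \<in> M} = {M, N}" "M \<noteq> N" using two_PM[OF e(1)] by (meson card_2_iff)
  then have m: "M \<in> PM" "N \<in> PM" "e \<in> M" "e \<in> N" by blast+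
  then have "\<not> M \<subseteq> N" using perfect_matching_subset_eq[OF G] PM_D MN(2) by blast
  then obtain f where f: "f \<in> M" "f \<notin> N" by blast
  obtain u v where "d e = {u, v}" using edge_ends[OF G e(1)] by blast
  then have "card {e \<in> E. d e = {u, v}} = 1" using degree_two_vertex(1)[OF large m _ f] by blast
  then obtain x where "{e \<in> E. d e = {u, v}} = {x}" by (meson card_1_singletonE)
  then show "e = e'" using e \<open>d e = {u, v}\<close> by (metis (mono_tags, lifting) mem_Collect_eq singletonD)
qed

lemma edge_unique: "e \<in> E \<Longrightarrow> f \<in> E \<Longrightarrow> d e = d f \<Longrightarrow> e = f"
  using simple by (simp add: inj_on_def)

lemma nbr_card: "x \<in> V \<Longrightarrow> card {y. A x y \<and> y \<in> Y} = card {e \<in> E. x \<in> d e \<and> d e - {x} \<subseteq> Y}"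
proof -
  assume x: "x \<in> V"
  define g where "g y = (SOME e. e \<in> E \<and> d e = {x, y})" for y
  have g: "g y \<in> E \<and> d (g y) = {x, y}" if "A x y" for y
    unfolding g_def by (rule someI_ex) (use that in \<open>auto simp: A_def\<close>)
  have "bij_betw g {y. A x y \<and> y \<in> Y} {e \<in> E. x \<in> d e \<and> d e - {x} \<subseteq> Y}"
    unfolding bij_betw_def
  proof
    show "inj_on g {y. A x y \<and> y \<in> Y}" using g by (intro inj_onI) (metis doubleton_eq_iff mem_Collect_eq)
    show "g ` {y. A x y \<and> y \<in> Y} = {e \<in> E. x \<in> d e \<and> d e - {x} \<subseteq> Y}"
    proof
      show "g ` {y. A x y \<and> y \<in> Y} \<subseteq> {e \<in> E. x \<in> d e \<and> d e - {x} \<subseteq> Y}" using g by auto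
      show "{e \<in> E. x \<in> d e \<and> d e - {x} \<subseteq> Y} \<subseteq> g ` {y. A x y \<and> y \<in> Y}"
      proof
        fix e assume "e \<in> {e \<in> E. x \<in> d e \<and> d e - {x} \<subseteq> Y}"
        then have e: "e \<in> E" "x \<in> d e" "d e - {x} \<subseteq> Y" by auto
        then obtain y where y: "d e = {x, y}" "x \<noteq> y" using edge_ends[OF G e(1)] by (metis insertE insert_commute singletonD)
        then have "A x y" "y \<in> Y" using e unfolding A_def by auto
        moreover have "g y = e" using g[OF \<open>A x y\<close>] e(1) y(1) edge_unique by simp
        ultimately show "e \<in> g ` {y. A x y \<and> y \<in> Y}" by blast
      qed
    qed
  qed
  then show ?thesis by (rule bij_betw_same_card)
qed

lemma card_nbrs: "x \<in> V \<Longrightarrow> card {y. A x y} = r"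
  using nbr_card[of x UNIV] degree_r[of x] unfolding degree_def by simp

lemma fin_nbrs: "finite {y. A x y}"
  by (rule finite_subset[OF _ fin(1)]) (use A_props in blast)

lemma mfun_matching:
  assumes M: "M \<in> PM" shows "matching_on A V (mfun M)"
  unfolding matching_on_def
proof (intro conjI ballI allI impI)
  note mp = mate_props[OF G PM_D(1)[OF M]]
  fix x assume x: "x \<in> V"
  show "A x (mfun M x)" using mate_edge[OF G PM_D(1)[OF M] x] PM_D(2)[OF M] x unfolding mfun_def A_def by auto
  show "mfun M x \<in> V" using mp(1)[OF x] x unfolding mfun_def by simp
  show "mfun M (mfun M x) = x" using mp(1,2)[OF x] x unfolding mfun_def by simp
qed (simp add: mfun_def)

lemma mfun_iff:
  assumes M: "M \<in> PM" and e: "e \<in> E" "d e = {x, y}"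
  shows "e \<in> M \<longleftrightarrow> mfun M x = y"
proof -
  have x: "x \<in> V" using G e unfolding graph_def by blast
  show ?thesis
  proof
    assume "e \<in> M"
    then show "mfun M x = y" using mateI[OF G PM_D(1)[OF M] _ e(2)] x unfolding mfun_def by simp
  next
    assume "mfun M x = y"
    then obtain f where "f \<in> M" "d f = {x, y}" using mate_edge[OF G PM_D(1)[OF M] x] x unfolding mfun_def by auto
    then show "e \<in> M" using edge_unique e PM_D(2)[OF M] by (metis subsetD)
  qed
qed

lemma mfun_inj: "inj_on mfun PM"
proof (rule inj_onI)
  fix M N assume MN: "M \<in> PM" "N \<in> PM" "mfun M = mfun N"
  have "M \<subseteq> N"
  proof
    fix e assume e: "e \<in> M"
    then have eE: "e \<in> E" using PM_D(2) MN(1) by blast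
    obtain x y where "d e = {x, y}" using edge_ends[OF G eE] by blast
    then show "e \<in> N" using mfun_iff[OF MN(1) eE] mfun_iff[OF MN(2) eE] MN(3) e by metis
  qed
  then show "M = N" using perfect_matching_subset_eq[OF G] PM_D(1) MN by blast
qed

lemma mfun_surj:
  assumes h: "matching_on A V h" shows "\<exists>M\<in>PM. mfun M = h"
proof -
  let ?M = "{e \<in> E. \<exists>x\<in>V. d e = {x, h x}}"
  note hD = matching_onD[OF h]
  have "\<exists>e\<in>?M. v \<in> d e \<and> (\<forall>f\<in>?M. v \<in> d f \<longrightarrow> f = e)" if v: "v \<in> V" for v
  proof -
    obtain e where e: "e \<in> E" "d e = {v, h v}" using hD(1)[OF v] unfolding A_def by blast
    have uq: "f = e" if f: "f \<in> ?M" "v \<in> d f" for f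
    proof -
      obtain x where x: "x \<in> V" "d f = {x, h x}" "f \<in> E" using f(1) by blast
      then have "v = x \<or> v = h x" using f(2) by blast
      then have "d f = d e" using x(2) e(2) hD(3) by (metis insert_commute)
      then show ?thesis using edge_unique x(3) e(1) by blast
    qed
    have "e \<in> ?M" "v \<in> d e" using e v by auto
    then show ?thesis using uq by (intro bexI[of _ e] conjI ballI impI)
  qed
  then have M: "?M \<in> PM" unfolding PM_def perfect_matching_iff by blast
  have "mfun ?M x = h x" for x
  proof (cases "x \<in> V")
    case True
    obtain e where e: "e \<in> E" "d e = {x, h x}" using hD(1)[OF True] unfolding A_def by blast
    then show ?thesis using mfun_iff[OF M e] True by blast
  next
    case False
    then show ?thesis using hD(4) unfolding mfun_def by simp
  qed
  then show ?thesis using M by blast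
qed

lemma card_matchings: "A x y \<Longrightarrow> card {h. matching_on A V h \<and> h x = y} = 2"
proof -
  assume "A x y"
  then obtain e where e: "e \<in> E" "d e = {x, y}" unfolding A_def by blast
  have "{h. matching_on A V h \<and> h x = y} = mfun ` {M \<in> PM. e \<in> M}"
  proof (intro equalityI subsetI)
    fix h assume "h \<in> {h. matching_on A V h \<and> h x = y}"
    then obtain M where "M \<in> PM" "mfun M = h" "h x = y" using mfun_surj by blast
    then show "h \<in> mfun ` {M \<in> PM. e \<in> M}" using mfun_iff[OF _ e] by blast
  next
    fix h assume "h \<in> mfun ` {M \<in> PM. e \<in> M}"
    then obtain M where "M \<in> PM" "e \<in> M" "h = mfun M" by blast
    then show "h \<in> {h. matching_on A V h \<and> h x = y}" using mfun_iff[OF _ e] mfun_matching by blast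
  qed
  moreover have "card (mfun ` {M \<in> PM. e \<in> M}) = card {M \<in> PM. e \<in> M}"
    by (rule card_image[OF inj_on_subset[OF mfun_inj]]) blast
  ultimately show ?thesis using two_PM[OF e(1)] by simp
qed

text \<open>After the removal of \<open>u\<close> and \<open>f u\<close>, the vertex
  \<open>x\<close> of \<open>degree_two_vertex\<close> keeps two of its \<open>r\<close> edges, so
  it was adjacent to \<open>r - 2\<close> of the removed vertices: to one if \<open>r\<close> is 3,
  to both if \<open>r\<close> is 4.\<close>

lemma cover_count:
  assumes f: "matching_on A V f" and g: "matching_on A V g" and u: "u \<in> V" "f u = g u" and c: "c \<in> V" "f c \<noteq> g c"
  shows "\<exists>x\<in>{c, f c}. x \<noteq> u \<and> x \<noteq> f u \<and> r = 2 + card ({y. A x y} \<inter> {u, f u})"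
proof -
  obtain M where M: "M \<in> PM" "mfun M = f" using mfun_surj[OF f] by blast
  obtain N where N: "N \<in> PM" "mfun N = g" using mfun_surj[OF g] by blast
  obtain e where e: "e \<in> E" "d e = {u, f u}" using matching_onD(1)[OF f u(1)] unfolding A_def by blast
  obtain h where h: "h \<in> E" "d h = {c, f c}" using matching_onD(1)[OF f c(1)] unfolding A_def by blast
  have "e \<in> M" "e \<in> N" "h \<in> M" "h \<notin> N"
    using mfun_iff[OF M(1) e] mfun_iff[OF N(1) e] mfun_iff[OF M(1) h] mfun_iff[OF N(1) h] M N u c by auto
  then obtain x k where x: "x \<in> d h" "x \<noteq> u" "x \<noteq> f u" "k \<noteq> h" "{k \<in> E. d k \<inter> {u, f u} = {} \<and> x \<in> d k} = {h, k}"
    using degree_two_vertex(2)[OF large M(1) N(1) _ _ e(2)] by blast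
  have xV: "x \<in> V" using x(1) h(1) G unfolding graph_def by blast
  have "{k \<in> E. x \<in> d k \<and> d k - {x} \<subseteq> - {u, f u}} = {h, k}"
    unfolding x(5)[symmetric] using x(2,3) by blast
  then have "card {y. A x y \<and> y \<in> - {u, f u}} = 2" using nbr_card[OF xV, of "- {u, f u}"] x(4) by simp
  moreover have "card {y. A x y} = card {y. A x y \<and> y \<in> - {u, f u}} + card ({y. A x y} \<inter> {u, f u})"
  proof -
    have "{y. A x y} = {y. A x y \<and> y \<in> - {u, f u}} \<union> ({y. A x y} \<inter> {u, f u})" by blast
    moreover have "card ({y. A x y \<and> y \<in> - {u, f u}} \<union> ({y. A x y} \<inter> {u, f u})) =
      card {y. A x y \<and> y \<in> - {u, f u}} + card ({y. A x y} \<inter> {u, f u})"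
      by (rule card_Un_disjoint) (use fin_nbrs[of x] in \<open>auto intro: finite_subset\<close>)
    ultimately show ?thesis by simp
  qed
  ultimately show ?thesis using card_nbrs[OF xV] x h(2) by auto
qed

text \<open>The degree sum over a nontrivial odd set is its cut, at least \<open>r + 2\<close>, plus
  twice the number of edges inside. Three vertices with too many edges among them violate this,
  which excludes \<open>r = 2\<close> and, for \<open>r = 3\<close>, triangles.\<close>

lemma inner_bound:
  assumes X: "X \<subseteq> V" "odd (card X)" "card X \<noteq> 1" "card (V - X) \<noteq> 1"
    and Q: "\<And>q. q \<in> Q \<Longrightarrow> \<exists>x y. q = {x, y} \<and> A x y \<and> x \<in> X \<and> y \<in> X"
  shows "r + 2 + 2 * card Q \<le> r * card X"
proof -
  let ?I = "{e \<in> E. d e \<subseteq> X}"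
  have "Q \<subseteq> d ` ?I"
  proof
    fix q assume "q \<in> Q"
    then obtain x y where q: "q = {x, y}" "A x y" "x \<in> X" "y \<in> X" using Q by blast
    then obtain e where e: "e \<in> E" "d e = {x, y}" unfolding A_def by blast
    then have "e \<in> ?I" using q(3,4) by simp
    then show "q \<in> d ` ?I" unfolding q(1) e(2)[symmetric] by (rule imageI)
  qed
  then have "card Q \<le> card (d ` ?I)" using fin by (intro card_mono) auto
  also have "\<dots> \<le> card ?I" using fin by (intro card_image_le) auto
  finally show ?thesis using degree_sum_r[OF X(1)] cut_ge2[OF X] by linarith
qed

lemma card_complement_ne: "X \<subseteq> V \<Longrightarrow> card X = 3 \<Longrightarrow> card (V - X) \<noteq> 1"
  using large fin finite_subset[of X V] by (subst card_Diff_subset) auto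

lemma ex_edge: "\<exists>u v. A u v"
proof -
  have "E \<noteq> {}" using not_bipartite[of "{}"] unfolding cut_def by auto
  then show ?thesis using edge_ends[OF G] unfolding A_def by blast
qed

lemma ex_two_matchings:
  assumes "A u v"
  shows "\<exists>f g. matching_on A V f \<and> matching_on A V g \<and> f u = v \<and> g u = v \<and> (\<exists>c\<in>V. f c \<noteq> g c)"
proof -
  obtain f g where fg: "{h. matching_on A V h \<and> h u = v} = {f, g}" "f \<noteq> g"
    using card_matchings[OF assms] by (meson card_2_iff)
  then have m: "matching_on A V f" "matching_on A V g" "f u = v" "g u = v" by blast+
  obtain c where "f c \<noteq> g c" using fg(2) by blast
  moreover then have "c \<in> V" using matching_onD(4)[OF m(1)] matching_onD(4)[OF m(2)] by metis
  ultimately show ?thesis using m by blast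
qed

lemma r_cases: "r = 3 \<or> r = 4"
proof -
  obtain u v where uv: "A u v" using ex_edge by blast
  obtain f g c where fg: "matching_on A V f" "matching_on A V g" "f u = v" "g u = v" "c \<in> V" "f c \<noteq> g c"
    using ex_two_matchings[OF uv] by blast
  have uV: "u \<in> V" "f u = g u" using uv A_props fg by auto
  obtain x where "r = 2 + card ({y. A x y} \<inter> {u, f u})"
    using cover_count[OF fg(1,2) uV fg(5,6)] by blast
  moreover have "card ({y. A x y} \<inter> {u, f u}) \<le> card {u, f u}" for x by (intro card_mono) auto
  moreover have "card {u, f u} \<le> 2" by (simp add: card_insert_if)
  ultimately have r: "2 \<le> r" "r \<le> 4" by (linarith, metis add_le_cancel_left le_trans numeral_Bit0)
  have "r \<noteq> 2"
  proof
    assume r2: "r = 2"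
    have "card {y. A u y} = 2" using card_nbrs[OF uV(1)] r2 by simp
    then obtain y z where yz: "{y. A u y} = {y, z}" "y \<noteq> z" unfolding card_2_iff by blast
    then have Ayz: "A u y" "A u z" by blast+
    then have p: "y \<in> V" "z \<in> V" "u \<noteq> y" "u \<noteq> z" using A_props by blast+
    have c3: "card {u, y, z} = 3" using p yz by simp
    have "r + 2 + 2 * card {{u, y}, {u, z}} \<le> r * card {u, y, z}"
      by (rule inner_bound) (use c3 p uV Ayz card_complement_ne[of "{u, y, z}"] in auto)
    moreover have "{u, y} \<noteq> {u, z}" using yz(2) by (auto simp: doubleton_eq_iff)
    ultimately show False using r2 c3 by simp
  qed
  then show ?thesis using r by linarith
qed

text \<open>Different listed pairs give different edges of \<open>G\<close>, and since there are as
  many pairs as edges, none is missed.\<close>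

lemma list_graph_isomorphic:
  assumes vl: "distinct vl" "set vl = V" and ps: "wf_list_graph (length vl) ps" "\<And>i j. (i, j) \<in> set ps \<Longrightarrow> A (vl ! i) (vl ! j)"
    "distinct (map (\<lambda>p. {fst p, snd p}) ps)" "length ps = card E"
  shows "isomorphic (list_graph (length vl) ps) G"
proof -
  define g where "g p = (SOME e. e \<in> E \<and> d e = {vl ! fst p, vl ! snd p})" for p
  have g: "g p \<in> E \<and> d (g p) = {vl ! fst p, vl ! snd p}" if "p \<in> set ps" for p
  proof -
    have "A (vl ! fst p) (vl ! snd p)" using ps(2)[of "fst p" "snd p"] that by simp
    then have "\<exists>e. e \<in> E \<and> d e = {vl ! fst p, vl ! snd p}" unfolding A_def by blast
    from someI_ex[OF this] show ?thesis unfolding g_def .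
  qed
  have inj: "inj_on g (set ps)"
  proof (rule inj_onI)
    fix p q assume pq: "p \<in> set ps" "q \<in> set ps" "g p = g q"
    then have "{vl ! fst p, vl ! snd p} = {vl ! fst q, vl ! snd q}" using g by metis
    moreover have "fst p < length vl" "snd p < length vl" "fst q < length vl" "snd q < length vl"
      using ps(1) pq unfolding wf_list_graph_def by blast+
    ultimately have "{fst p, snd p} = {fst q, snd q}" using vl(1)
      by (auto simp: doubleton_eq_iff nth_eq_iff_index_eq)
    then show "p = q" using ps(3) pq by (simp add: distinct_map inj_on_def)
  qed
  have "distinct ps" using ps(3) unfolding distinct_map by blast
  then have dg: "distinct (map g ps)" using inj by (simp add: distinct_map)
  have "set (map g ps) \<subseteq> E" using g by auto
  moreover have "card (set (map g ps)) = card E" using distinct_card[OF dg] ps(4) by simp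
  ultimately have "set (map g ps) = E" using fin by (intro card_subset_eq) auto
  then show ?thesis using g by (intro isomorphic_list_graphI[OF vl dg]) auto
qed

section \<open>The 4-regular case\<close>

lemma r4_common:
  assumes r4: "r = 4" and uv: "A u v"
  shows "\<exists>x1 x2. x1 \<noteq> x2 \<and> A u x1 \<and> A v x1 \<and> A u x2 \<and> A v x2"
proof -
  obtain f g c where fg: "matching_on A V f" "matching_on A V g" "f u = v" "g u = v" "c \<in> V" "f c \<noteq> g c"
    using ex_two_matchings[OF uv] by blast
  have uV: "u \<in> V" "u \<noteq> v" using uv A_props by blast+
  have both: "A u x \<and> A v x" if "r = 2 + card ({y. A x y} \<inter> {u, v})" for x
  proof -
    have "card ({y. A x y} \<inter> {u, v}) = card {u, v}" using that r4 uV by simp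
    then have "{y. A x y} \<inter> {u, v} = {u, v}" by (intro card_subset_eq) auto
    then show ?thesis using A_sym by blast
  qed
  have ff: "f (f x) = x" and gg: "g (g x) = x" for x using matching_onD(3) fg(1,2) by metis+
  obtain x where x: "x \<in> {c, f c}" "A u x" "A v x"
    using cover_count[OF fg(1,2) uV(1) _ fg(5,6)] fg(3,4) both by auto
  have xV: "x \<in> V" using x A_props by blast
  have xC: "f x \<noteq> g x" using x(1) fg(6) ff gg by (metis insertE singletonD)
  \<comment> \<open>The second common neighbour comes from the \<open>g\<close>-edge at
    \<open>f x\<close>, the next edge of the alternating cycle, which does not contain
    \<open>x\<close>.\<close>
  let ?y = "f x"
  have yV: "?y \<in> V" using matching_onD(2)[OF fg(1) xV] .
  have yC: "g ?y \<noteq> f ?y" using xC ff gg by metis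
  obtain z where z: "z \<in> {?y, g ?y}" "A u z" "A v z"
    using cover_count[OF fg(2,1) uV(1) _ yV yC] fg(3,4) both by auto
  have "z \<noteq> x"
  proof -
    have "?y \<noteq> x" using matching_onD(1)[OF fg(1) xV] A_props by metis
    moreover have "g ?y \<noteq> x" using xC gg by metis
    ultimately show ?thesis using z(1) by (metis insertE singletonD)
  qed
  then show ?thesis using x z by blast
qed

lemma r4_card: 
  assumes r4: "r = 4" shows "card V = 6"
proof (rule ccontr)
  assume n6: "card V \<noteq> 6"
  obtain u v where uv: "A u v" using ex_edge by blast
  have uV: "u \<in> V" using uv A_props by blast
  let ?N = "{y. A u y}"
  let ?X = "insert u ?N"
  have uN: "u \<notin> ?N" using A_props by blast
  have N4: "card ?N = 4" using card_nbrs[OF uV] r4 by simp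
  have XV: "?X \<subseteq> V" using uV A_props by blast
  have X5: "card ?X = 5" using uN N4 fin_nbrs by simp
  have "card (V - ?X) = card V - 5" using XV X5 fin finite_subset by (metis card_Diff_subset)
  moreover have "card V \<ge> 5" using X5 XV fin by (metis card_mono)
  ultimately have "card (V - ?X) \<noteq> 1" using n6 by linarith
  then have ge: "card (cut G ?X) \<ge> 6" using cut_ge2[OF XV] X5 r4 by simp
  \<comment> \<open>Of the four edges at \<open>x\<close>, one goes to \<open>u\<close> and two go
    to common neighbours of \<open>u\<close> and \<open>x\<close>, all inside
    \<open>?X\<close>.\<close>
  have out: "card {e \<in> E. x \<in> d e \<and> d e - {x} \<subseteq> - ?X} \<le> 1" if x: "x \<in> ?N" for x
  proof -
    have xV: "x \<in> V" "A u x" "A x u" using x A_props A_sym by blast+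
    obtain x1 x2 where x12: "x1 \<noteq> x2" "A u x1" "A x x1" "A u x2" "A x x2" using r4_common[OF r4 xV(2)] by blast
    have ne: "x1 \<noteq> u" "x2 \<noteq> u" using x12 A_props by blast+
    have "card ({y. A x y \<and> y \<in> - ?X} \<union> {u, x1, x2}) \<le> card {y. A x y}"
      using fin_nbrs xV(3) x12 by (intro card_mono) auto
    moreover have "card ({y. A x y \<and> y \<in> - ?X} \<union> {u, x1, x2}) = card {y. A x y \<and> y \<in> - ?X} + card {u, x1, x2}"
      using fin_nbrs[of x] x12 by (intro card_Un_disjoint) (auto intro: finite_subset)
    moreover have "card {u, x1, x2} = 3" using ne x12(1) by auto
    ultimately have "card {y. A x y \<and> y \<in> - ?X} \<le> 1" using card_nbrs[OF xV(1)] r4 by linarith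
    then show ?thesis unfolding nbr_card[OF xV(1), of "- ?X"] .
  qed
  have "cut G ?X \<subseteq> (\<Union>x\<in>?N. {e \<in> E. x \<in> d e \<and> d e - {x} \<subseteq> - ?X})"
  proof
    fix e assume e: "e \<in> cut G ?X"
    then have eE: "e \<in> E" using cut_subset[of G ?X] by blast
    obtain a b where ab: "d e = {a, b}" "a \<noteq> b" using edge_ends[OF G eE] by blast
    have "(a \<in> ?X) \<noteq> (b \<in> ?X)" using e unfolding cut_iff[OF eE ab] .
    then obtain x y where xy: "d e = {x, y}" "x \<noteq> y" "x \<in> ?X" "y \<notin> ?X" using ab by (metis insert_commute)
    have "A x y" using xy eE unfolding A_def by blast
    then have "x \<in> ?N" using xy by blast
    moreover have "x \<in> d e \<and> d e - {x} \<subseteq> - ?X" using xy by auto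
    ultimately show "e \<in> (\<Union>x\<in>?N. {e \<in> E. x \<in> d e \<and> d e - {x} \<subseteq> - ?X})" using eE by blast
  qed
  then have "card (cut G ?X) \<le> card (\<Union>x\<in>?N. {e \<in> E. x \<in> d e \<and> d e - {x} \<subseteq> - ?X})"
    using fin fin_nbrs by (intro card_mono) auto
  also have "\<dots> \<le> (\<Sum>x\<in>?N. card {e \<in> E. x \<in> d e \<and> d e - {x} \<subseteq> - ?X})" using fin_nbrs by (intro card_UN_le)
  also have "\<dots> \<le> (\<Sum>x\<in>?N. 1)" using out by (intro sum_mono) blast
  finally show False using N4 ge by simp
qed

text \<open>On six vertices each vertex has exactly one non-neighbour \<open>b x\<close>, and
  \<open>b\<close> is an involution; three antipodal pairs with all other pairs adjacent make the
  octahedron.\<close>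

lemma r4_T1:
  assumes r4: "r = 4" shows "isomorphic (list_graph 6 T1_pairs) G"
proof -
  have n6: "card V = 6" using r4_card r4 by blast
  have "\<exists>y. V - insert x {y. A x y} = {y}" if x: "x \<in> V" for x
  proof -
    have sub: "insert x {y. A x y} \<subseteq> V" using x A_props by blast
    have "card (insert x {y. A x y}) = 5" using card_nbrs[OF x] r4 fin_nbrs A_props by (subst card_insert_disjoint) auto
    then have "card (V - insert x {y. A x y}) = 1"
      using card_Diff_subset[OF finite_subset[OF sub fin(1)] sub] n6 by simp
    then show ?thesis by (meson card_1_singletonE)
  qed
  then obtain b where b: "\<And>x. x \<in> V \<Longrightarrow> V - insert x {y. A x y} = {b x}" by metis
  have bV: "b x \<in> V" "b x \<noteq> x" "\<not> A x (b x)" if "x \<in> V" for x using b[OF that] by blast+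
  have Ab: "A x y" if "x \<in> V" "y \<in> V" "y \<noteq> x" "y \<noteq> b x" for x y using b[OF that(1)] that by blast
  have bb: "b (b x) = x" if "x \<in> V" for x
    using Ab[OF bV(1)[OF that] that] bV[OF that] A_sym by metis
  have ex: "\<exists>x. x \<in> V - S" if "card S < 6" "S \<subseteq> V" for S
    using that n6 by (metis DiffI psubsetI psubset_imp_ex_mem nat_neq_iff)
  obtain x where x: "x \<in> V" using ex[of "{}"] by auto
  obtain y where y: "y \<in> V" "y \<noteq> x" "y \<noteq> b x" using ex[of "{x, b x}"] bV[OF x] x by (auto simp: card_insert_if)
  obtain z where z: "z \<in> V" "z \<noteq> x" "z \<noteq> b x" "z \<noteq> y" "z \<noteq> b y"
  proof -
    have "card (set [x, b x, y, b y]) < 6" using card_length[of "[x, b x, y, b y]"] by simp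
    then show ?thesis using ex[of "{x, b x, y, b y}"] bV[OF x] bV[OF y(1)] x y that by auto
  qed
  have b_inj: "p = q" if "b p = b q" "p \<in> V" "q \<in> V" for p q using bb that by metis
  have ne: "b y \<noteq> x" "b y \<noteq> b x" "b z \<noteq> x" "b z \<noteq> b x" "b z \<noteq> y" "b z \<noteq> b y"
    using bb[OF x] bb[OF y(1)] bb[OF z(1)] b_inj x y z by metis+
  \<comment> \<open>The order puts the antipodal pairs at the positions \<open>05\<close>,
    \<open>12\<close> and \<open>34\<close> that \<open>T1_pairs\<close> omits.\<close>
  define vl where "vl = [x, y, b y, z, b z, b x]"
  have dist: "distinct vl" unfolding vl_def
    using ne y z bV(2)[OF x] bV(2)[OF y(1)] bV(2)[OF z(1)] x by auto
  have "card (set vl) = 6" using distinct_card[OF dist] by (simp add: vl_def)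
  moreover have "set vl \<subseteq> V" unfolding vl_def using x y z bV(1) by auto
  ultimately have set: "set vl = V" using n6 fin by (intro card_subset_eq) auto
  have len: "length vl = 6" by (simp add: vl_def)
  have adj: "\<forall>(i, j)\<in>set T1_pairs. A (vl ! i) (vl ! j)"
  proof -
    have bx: "b x \<in> V" "b y \<in> V" "b z \<in> V" using bV x y z by blast+
    have bbs: "b (b x) = x" "b (b y) = y" "b (b z) = z" using bb x y z by blast+
    show ?thesis unfolding T1_pairs_def vl_def using Ab x y z bx ne bbs by (auto intro!: Ab)
  qed
  have "isomorphic (list_graph (length vl) T1_pairs) G"
  proof (rule list_graph_isomorphic[OF dist set])
    show "wf_list_graph (length vl) T1_pairs" unfolding len by (rule T1_pairs_check)
    show "distinct (map (\<lambda>p. {fst p, snd p}) T1_pairs)" by (simp add: T1_pairs_def doubleton_eq_iff)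
    show "length T1_pairs = card E" using card_E r4 n6 by (simp add: T1_pairs_def)
  qed (use adj in blast)
  then show ?thesis unfolding len .
qed

section \<open>The cubic case\<close>

lemma r3_petersen:
  assumes r3: "r = 3" shows "isomorphic (list_graph 10 petersen_pairs) G"
proof -
  have finE: "finite E" using fin by blast
  have tri: "\<not> A x z" if xy: "A x y" "A y z" for x y z
  proof
    assume xz: "A x z"
    have p: "x \<in> V" "y \<in> V" "z \<in> V" "x \<noteq> y" "y \<noteq> z" "x \<noteq> z" using xy xz A_props by blast+
    have c3: "card {x, y, z} = 3" using p by simp
    have "r + 2 + 2 * card {{x, y}, {y, z}, {x, z}} \<le> r * card {x, y, z}"
      by (rule inner_bound) (use c3 p xy xz card_complement_ne[of "{x, y, z}"] in auto)
    moreover have "card {{x, y}, {y, z}, {x, z}} = 3" using p by (simp add: doubleton_eq_iff)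
    ultimately show False using r3 c3 by simp
  qed
  interpret cubic_matchings V A
  proof
    show "card {y. A x y} = 3" if "x \<in> V" for x using card_nbrs that r3 by simp
    show "\<exists>x\<in>{c, f c}. (A u x \<or> A (f u) x) \<and> x \<noteq> u \<and> x \<noteq> f u"
      if fg: "matching_on A V f" "matching_on A V g" "u \<in> V" "f u = g u" "c \<in> V" "f c \<noteq> g c" for f g u c
    proof -
      obtain x where x: "x \<in> {c, f c}" "x \<noteq> u" "x \<noteq> f u" "r = 2 + card ({y. A x y} \<inter> {u, f u})"
        using cover_count[OF fg] by blast
      then have "card ({y. A x y} \<inter> {u, f u}) = 1" using r3 by linarith
      then have "{y. A x y} \<inter> {u, f u} \<noteq> {}" by (metis card.empty zero_neq_one)
      then have "A u x \<or> A (f u) x" using A_sym by blast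
      then show ?thesis using x by blast
    qed
  qed (use fin A_props A_sym tri card_matchings in blast)+
  \<comment> \<open>The three neighbours of a vertex are independent and so meet nine different
    edges, which are all the edges; each has one end among them, and the graph would be
    bipartite.\<close>
  have "card V \<noteq> 6"
  proof
    assume n6: "card V = 6"
    obtain u v where uv: "A u v" using ex_edge by blast
    obtain p q where pq: "{y. A v y} = {u, p, q}" "u \<noteq> p" "u \<noteq> q" "p \<noteq> q" using two_other_nbrs[OF A_sym[OF uv]] by blast
    then have Apq: "A v p" "A v q" by blast+
    let ?X = "{u, p, q}"
    have XV: "?X \<subseteq> V" using uv Apq A_props by blast
    have nA: "\<not> A u p" "\<not> A u q" "\<not> A p q" using tri uv Apq A_sym by blast+
    then have ind: "\<not> A a b" if "a \<in> ?X" "b \<in> ?X" for a b using that A_sym A_props by blast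
    have "{e \<in> E. d e \<subseteq> ?X} = {}"
    proof (rule ccontr)
      assume "{e \<in> E. d e \<subseteq> ?X} \<noteq> {}"
      then obtain e where e: "e \<in> E" "d e \<subseteq> ?X" by blast
      obtain a b where "d e = {a, b}" using edge_ends[OF G e(1)] by blast
      then show False using ind[of a b] e unfolding A_def by blast
    qed
    then have "card {e \<in> E. d e \<subseteq> ?X} = 0" by (simp only: card.empty)
    then have "card (cut G ?X) = 9" using degree_sum_r[OF XV] r3 pq(2-4) by simp
    moreover have "card E = 9" using card_E r3 n6 by simp
    ultimately have "cut G ?X = E" using cut_subset[of G ?X] by (intro card_subset_eq[OF finE]) auto
    then show False using not_bipartite[OF XV] by simp
  qed
  then have big: "card V > 6" using large even_V by presburger
  obtain c0 c1 c2 c3 c4 c5 c6 c7 u v where dist: "distinct [c0, c1, c2, c3, c4, c5, c6, c7, u, v]"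
    and set: "set [c0, c1, c2, c3, c4, c5, c6, c7, u, v] = V" and
    adj: "A c0 c1" "A c1 c2" "A c2 c3" "A c3 c4" "A c4 c5" "A c5 c6" "A c6 c7" "A c7 c0" "A c1 c5" "A c3 c7"
    "A u v" "A u c0" "A u c4" "A v c2" "A v c6" by (rule petersen_vertices[OF big])
  let ?vl = "[c0, c1, c2, c3, c4, c5, c6, c7, u, v]"
  have "isomorphic (list_graph (length ?vl) petersen_pairs) G"
  proof (rule list_graph_isomorphic[OF dist set])
    have len: "length ?vl = 10" by simp
    show "wf_list_graph (length ?vl) petersen_pairs" unfolding len by (rule petersen_pairs_check(1))
    show "distinct (map (\<lambda>p. {fst p, snd p}) petersen_pairs)" by (simp add: petersen_pairs_def doubleton_eq_iff)
    show "length petersen_pairs = card E" using card_E r3 card_10[OF big] by (simp add: petersen_pairs_def)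
    have "\<forall>(i, j)\<in>set petersen_pairs. A (?vl ! i) (?vl ! j)" unfolding petersen_pairs_def using adj by simp
    then show "A (?vl ! i) (?vl ! j)" if "(i, j) \<in> set petersen_pairs" for i j using that by blast
  qed
  moreover have "length ?vl = 10" by simp
  ultimately show ?thesis by (simp only:)
qed

end

section \<open>Bricks with at most four vertices\<close>

context brick_B
begin

lemma card_V_ne_2: "card V \<noteq> 2"
proof
  assume "card V = 2"
  then obtain a b where ab: "V = {a, b}" "a \<noteq> b" by (meson card_2_iff)
  have "e \<in> cut G {a}" if e: "e \<in> E" for e
  proof -
    obtain x y where xy: "d e = {x, y}" "x \<noteq> y" "x \<in> V" "y \<in> V" using edge_ends[OF G e] by blast
    then show ?thesis unfolding cut_iff[OF e xy(1,2)] using ab by auto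
  qed
  then show False using not_bipartite[of "{a}"] ab cut_subset[of G "{a}"] by blast
qed

text \<open>On four vertices the matchings through an edge \<open>ab\<close> correspond to the edges
  \<open>xy\<close>. Hence each multiplicity is the number of matchings through an opposite edge,
  which is 1 or 2, and the two agree because opposite edges lie in a common perfect matching, which
  may not mix the two kinds.\<close>

lemma pairing_multiplicity:
  assumes V: "V = {a, b, x, y}" "distinct [a, b, x, y]"
  shows "card {e \<in> E. d e = {a, b}} = card {e \<in> E. d e = {x, y}} \<and> card {e \<in> E. d e = {a, b}} \<in> {1, 2}"
proof -
  have me: "card {M \<in> PM. e \<in> M} = card {f \<in> E. d f = {x, y}} \<and> (\<forall>f\<in>E. d f = {x, y} \<longrightarrow> {e, f} \<in> PM)"
    if V: "V = {a, b, x, y}" "distinct [a, b, x, y]" and e: "e \<in> E" "d e = {a, b}" for a b x y e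
  proof -
    have pm: "{e, f} \<in> PM" if f: "f \<in> E" "d f = {x, y}" for f
    proof -
      have "e \<noteq> f" using e f V(2) by (auto simp: doubleton_eq_iff)
      then show ?thesis unfolding PM_def perfect_matching_iff using e f V by auto
    qed
    have "{M \<in> PM. e \<in> M} = (\<lambda>f. {e, f}) ` {f \<in> E. d f = {x, y}}"
    proof
      show "(\<lambda>f. {e, f}) ` {f \<in> E. d f = {x, y}} \<subseteq> {M \<in> PM. e \<in> M}" using pm by blast
      show "{M \<in> PM. e \<in> M} \<subseteq> (\<lambda>f. {e, f}) ` {f \<in> E. d f = {x, y}}"
      proof
        fix M assume "M \<in> {M \<in> PM. e \<in> M}"
        then have M: "M \<in> PM" "e \<in> M" by blast+
        then obtain f where f: "f \<in> M" "x \<in> d f" using PM_D(1)[OF M(1)] V unfolding perfect_matching_iff by blast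
        have fE: "f \<in> E" using f M PM_D by blast
        have uq: "h = k" if "h \<in> M" "k \<in> M" "z \<in> d h" "z \<in> d k" "z \<in> V" for h k z
          using PM_D(1)[OF M(1)] that unfolding perfect_matching_iff by metis
        have "f \<noteq> e" using f(2) e(2) V(2) by auto
        then have "a \<notin> d f" "b \<notin> d f" using uq[OF f(1) M(2)] e(2) V(1) by blast+
        moreover obtain p q where "d f = {p, q}" "p \<noteq> q" "p \<in> V" "q \<in> V" using edge_ends[OF G fE] by blast
        ultimately have df: "d f = {x, y}" using f(2) V(1) by auto
        have "perfect_matching G {e, f}" using pm[OF fE df] PM_D by blast
        then have "{e, f} = M" using perfect_matching_subset_eq[OF G _ PM_D(1)[OF M(1)]] M f by blast
        then show "M \<in> (\<lambda>f. {e, f}) ` {f \<in> E. d f = {x, y}}" using fE df by blast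
      qed
    qed
    moreover have "inj_on (\<lambda>f. {e, f}) {f \<in> E. d f = {x, y}}"
      by (intro inj_onI) (auto simp: doubleton_eq_iff)
    ultimately have "card {M \<in> PM. e \<in> M} = card {f \<in> E. d f = {x, y}}" by (simp add: card_image)
    then show ?thesis using pm by blast
  qed
  let ?m = "\<lambda>x y. card {e \<in> E. d e = {x, y}}"
  have V': "V = {x, y, a, b}" "distinct [x, y, a, b]" using V by auto
  have fm: "finite {e \<in> E. d e = {x, y}}" for x y using fin by simp
  have one_two: "card {M \<in> PM. e \<in> M} \<in> {1, 2}" if "e \<in> E" for e
    using edge_12[OF that] unfolding matching_edge_iff by blast
  have pos: "?m a b > 0 \<longleftrightarrow> ?m x y > 0"
  proof
    assume "?m a b > 0"
    then obtain e where "e \<in> E" "d e = {a, b}" by (auto simp: card_gt_0_iff)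
    then show "?m x y > 0" using me[OF V] one_two by fastforce
  next
    assume "?m x y > 0"
    then obtain e where "e \<in> E" "d e = {x, y}" by (auto simp: card_gt_0_iff)
    then show "?m a b > 0" using me[OF V'] one_two by fastforce
  qed
  \<comment> \<open>If both opposite classes were empty, every edge would join \<open>{a, b}\<close>
    to \<open>{x, y}\<close>, and the graph would be bipartite.\<close>
  have "?m a b > 0"
  proof (rule ccontr)
    assume "\<not> ?m a b > 0"
    then have "card {e \<in> E. d e = {a, b}} = 0" "card {e \<in> E. d e = {x, y}} = 0" using pos by linarith+
    then have none: "{e \<in> E. d e = {a, b}} = {}" "{e \<in> E. d e = {x, y}} = {}"
      using card_0_eq[OF fm] by (blast, blast)
    have "e \<in> cut G {a, b}" if e: "e \<in> E" for e
    proof -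
      obtain p q where pq: "d e = {p, q}" "p \<noteq> q" "p \<in> V" "q \<in> V" using edge_ends[OF G e] by blast
      have "{p, q} \<noteq> {a, b}" "{p, q} \<noteq> {x, y}" using none e pq(1) by auto
      then show ?thesis unfolding cut_iff[OF e pq(1,2)] using pq(2-4) V by auto
    qed
    then show False using not_bipartite[of "{a, b}"] V cut_subset[of G "{a, b}"] by blast
  qed
  then obtain e f where e: "e \<in> E" "d e = {a, b}" and f: "f \<in> E" "d f = {x, y}" using pos by (auto simp: card_gt_0_iff)
  have ef: "{e, f} \<in> PM" using me[OF V e] f by blast
  have ce: "card {M \<in> PM. e \<in> M} = ?m x y" "card {M \<in> PM. f \<in> M} = ?m a b" using me[OF V e] me[OF V' f] by blast+
  have v12: "?m x y \<in> {1, 2}" "?m a b \<in> {1, 2}" using one_two[OF e(1)] one_two[OF f(1)] ce by simp_all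
  have "\<not> (matching_edge 1 G e \<and> matching_edge 2 G f)" "\<not> (matching_edge 1 G f \<and> matching_edge 2 G e)"
    using B PM_D(1)[OF ef] unfolding class_B_def by blast+
  then have "?m x y = ?m a b" using v12 e(1) f(1) unfolding matching_edge_iff ce by auto
  then show ?thesis using v12 by simp
qed

lemma K4_isomorphic:
  assumes V: "V = {a, b, x, y}" "distinct [a, b, x, y]"
  shows "isomorphic (list_graph 4 (K4_pairs (card {e \<in> E. d e = {a, b}}) (card {e \<in> E. d e = {a, x}}) (card {e \<in> E. d e = {a, y}}))) G"
proof -
  let ?S = "\<lambda>p q. {e \<in> E. d e = {p, q}}"
  have "\<exists>L. set L = ?S p q \<and> distinct L" for p q
    using finite_distinct_list[of "?S p q"] fin by simp
  then obtain L where L: "\<And>p q. set (L p q) = ?S p q" "\<And>p q. distinct (L p q)" by metis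
  have len: "length (L p q) = card (?S p q)" for p q using distinct_card[OF L(2)] L(1) by metis
  have md: "map d (L p q) = replicate (card (?S p q)) {p, q}" for p q
    unfolding len[symmetric] map_replicate_const[symmetric] using L(1) by (intro map_cong) auto
  have V2: "V = {a, x, b, y}" "distinct [a, x, b, y]" and V3: "V = {a, y, b, x}" "distinct [a, y, b, x]" using V by auto
  have eq: "card (?S x y) = card (?S a b)" "card (?S b y) = card (?S a x)" "card (?S b x) = card (?S a y)"
    using pairing_multiplicity[OF V] pairing_multiplicity[OF V2] pairing_multiplicity[OF V3] by simp_all
  let ?vl = "[a, b, x, y]"
  let ?ps = "K4_pairs (card (?S a b)) (card (?S a x)) (card (?S a y))"
  let ?el = "L a b @ L x y @ L a x @ L b y @ L a y @ L b x"
  have dist: "a \<noteq> b" "a \<noteq> x" "a \<noteq> y" "b \<noteq> x" "b \<noteq> y" "x \<noteq> y" using V(2) by auto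
  have "isomorphic (list_graph (length ?vl) ?ps) G"
  proof (rule isomorphic_list_graphI[where el = ?el])
    show "set ?vl = V" using V by auto
    show "distinct ?el" using L dist by (auto simp: doubleton_eq_iff)
    show "set ?el = E"
    proof
      show "set ?el \<subseteq> E" using L(1) by auto
      show "E \<subseteq> set ?el"
      proof
        fix e assume e: "e \<in> E"
        obtain p q where pq: "d e = {p, q}" "p \<noteq> q" "p \<in> V" "q \<in> V" using edge_ends[OF G e] by blast
        from pq(2-4) have "{p, q} \<in> {{a, b}, {x, y}, {a, x}, {b, y}, {a, y}, {b, x}}"
          unfolding V(1) by (elim insertE emptyE) (simp_all add: insert_commute)
        then have "d e \<in> {{a, b}, {x, y}, {a, x}, {b, y}, {a, y}, {b, x}}" unfolding pq(1) .
        then show "e \<in> set ?el" using e L(1) by auto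
      qed
    qed
    show len2: "length ?el = length ?ps" unfolding K4_pairs_def by (simp add: len eq)
    have mp: "map d ?el = map (\<lambda>p. {?vl ! fst p, ?vl ! snd p}) ?ps"
      unfolding K4_pairs_def by (simp add: md eq map_replicate numeral_2_eq_2 numeral_3_eq_3)
    show "d (?el ! k) = {?vl ! fst (?ps ! k), ?vl ! snd (?ps ! k)}" if k: "k < length ?ps" for k
    proof -
      have "d (?el ! k) = map d ?el ! k" by (rule nth_map[symmetric]) (use k len2 in linarith)
      also have "\<dots> = {?vl ! fst (?ps ! k), ?vl ! snd (?ps ! k)}" unfolding mp by (rule nth_map[OF k])
      finally show ?thesis .
    qed
  qed (use V in simp)
  moreover have "length ?vl = 4" by simp
  ultimately show ?thesis by (simp only:)
qed

text \<open>Reordering \<open>b\<close>, \<open>x\<close>, \<open>y\<close> permutes the three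
  multiplicities at \<open>a\<close>, so each of the eight combinations reduces to one in which the
  doubled classes come first.\<close>

lemma K4_cases:
  assumes "card V = 4"
  shows "isomorphic (list_graph 4 (K4_pairs 1 1 1)) G \<or> isomorphic (list_graph 4 (K4_pairs 2 1 1)) G \<or>
    isomorphic (list_graph 4 (K4_pairs 2 2 1)) G \<or> isomorphic (list_graph 4 (K4_pairs 2 2 2)) G"
proof -
  obtain vl where vl: "set vl = V" "distinct vl" using finite_distinct_list fin by blast
  then have "length vl = 4" using assms distinct_card by fastforce
  then obtain a b x y where "vl = [a, b, x, y]" by (auto simp: length_Suc_conv numeral_eq_Suc)
  then have V: "V = {a, b, x, y}" "distinct [a, b, x, y]" using vl by auto
  let ?m = "\<lambda>p q. card {e \<in> E. d e = {p, q}}"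
  have perms: "V = {a, b, y, x}" "distinct [a, b, y, x]" "V = {a, x, b, y}" "distinct [a, x, b, y]"
    "V = {a, x, y, b}" "distinct [a, x, y, b]" "V = {a, y, b, x}" "distinct [a, y, b, x]"
    "V = {a, y, x, b}" "distinct [a, y, x, b]" using V by auto
  have m: "?m a b \<in> {1, 2}" "?m a x \<in> {1, 2}" "?m a y \<in> {1, 2}"
    using pairing_multiplicity[OF V] pairing_multiplicity[OF perms(3,4)] pairing_multiplicity[OF perms(7,8)] by blast+
  note iso = K4_isomorphic[OF V] K4_isomorphic[OF perms(1,2)] K4_isomorphic[OF perms(3,4)]
    K4_isomorphic[OF perms(5,6)] K4_isomorphic[OF perms(7,8)] K4_isomorphic[OF perms(9,10)]
  show ?thesis using m iso by (elim insertE) (simp_all only: simp_thms, auto)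
qed

end

theorem theorem1p9:
  fixes G :: "('v, 'e) mgraph"
  assumes "brick G"
  shows "class_B G \<longleftrightarrow>
    isomorphic G K4 \<or> isomorphic G K4_2 \<or> isomorphic G K4_4 \<or>
    isomorphic G petersen \<or> isomorphic G T1 \<or> isomorphic G K4_6"
proof -
  have K: "isomorphic G K4 \<longleftrightarrow> isomorphic G (list_graph 4 (K4_pairs 1 1 1))"
    "isomorphic G K4_2 \<longleftrightarrow> isomorphic G (list_graph 4 (K4_pairs 2 1 1))"
    "isomorphic G K4_4 \<longleftrightarrow> isomorphic G (list_graph 4 (K4_pairs 2 2 1))"
    "isomorphic G K4_6 \<longleftrightarrow> isomorphic G (list_graph 4 (K4_pairs 2 2 2))"
    by (rule isomorphic_iff_list_graph[OF list_graph_K4] isomorphic_iff_list_graph[OF list_graph_K4_2]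
        isomorphic_iff_list_graph[OF list_graph_K4_4] isomorphic_iff_list_graph[OF list_graph_K4_6]; rule K4_pairs_check(1); simp)+
  have PT: "isomorphic G petersen \<longleftrightarrow> isomorphic G (list_graph 10 petersen_pairs)"
    "isomorphic G T1 \<longleftrightarrow> isomorphic G (list_graph 6 T1_pairs)"
    using isomorphic_iff_list_graph[OF list_graph_petersen petersen_pairs_check(1)]
      isomorphic_iff_list_graph[OF list_graph_T1 T1_pairs_check(1)] by blast+
  have KB: "class_B G" if "isomorphic G (list_graph 4 (K4_pairs i j k))" "i \<in> {1, 2}" "j \<in> {1, 2}" "k \<in> {1, 2}" for i j k
    using class_B_list_graph[OF assms that(1)] K4_pairs_check[OF that(2-4)] by blast
  have PB: "class_B G" if "isomorphic G (list_graph 10 petersen_pairs)"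
    using class_B_list_graph[OF assms that petersen_pairs_check] .
  have TB: "class_B G" if "isomorphic G (list_graph 6 T1_pairs)"
    using class_B_list_graph[OF assms that T1_pairs_check] .
  have "isomorphic G (list_graph 4 (K4_pairs 1 1 1)) \<or> isomorphic G (list_graph 4 (K4_pairs 2 1 1)) \<or>
    isomorphic G (list_graph 4 (K4_pairs 2 2 1)) \<or> isomorphic G (list_graph 10 petersen_pairs) \<or>
    isomorphic G (list_graph 6 T1_pairs) \<or> isomorphic G (list_graph 4 (K4_pairs 2 2 2))" if "class_B G"
  proof -
    interpret brick_B G by unfold_locales fact+
    have flip: "isomorphic G (list_graph n ps)" if "isomorphic (list_graph n ps) G" "wf_list_graph n ps" for n ps
      by (rule isomorphic_sym[OF that(1)]) (use that(2) in \<open>auto simp: wf_list_graph_def list_graph_def\<close>)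
    show ?thesis
    proof (cases "card (verts G) > 4")
      case True
      then interpret large_brick_B G by unfold_locales
      show ?thesis using r_cases flip[OF r3_petersen petersen_pairs_check(1)] flip[OF r4_T1 T1_pairs_check(1)] by blast
    next
      case False
      have "card (verts G) \<noteq> 0" using V_ne fin by simp
      then have "card (verts G) = 4" using False even_V card_V_ne_2
        by presburger
      then show ?thesis using K4_cases flip[OF _ K4_pairs_check(1)] by blast
    qed
  qed
  then show ?thesis unfolding K PT using KB PB TB by blast
qed

end
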